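(* For all $i,j\in[4]$ with $i\ne j$, the subgroup $K_{i,j}$ of $\mathrm{Aut}(\mathcal{O}_4)$ is contained in $\lambda^{-1}(\mathcal{P}_4^2)$ and is isomorphic to $S_4\times\mathbb{Z}_2^{\times2}$. The kernel of the restriction to $K_{i,j}$ of the canonical projection, $\pi:K_{i,j}\to\mathrm{Out}(\mathcal{O}_4)$, is trivial, and the $6$ groups $\pi(K_{i,j})$, $1\le i<j\le4$, are mutually distinct.
   Context: $[n]=\{1,\dots,n\}$; $S(A)$ is the symmetric group on $A$, $S_n=S([n])$; permutations are in disjoint cycle form, composed right to left. The Cuntz algebra $\mathcal{O}_n$ ($n\ge2$) is the universal $C^*$-algebra generated by isometries $S_1,\dots,S_n$ with $\sum_iS_iS_i^*=1$. For a unitary $u\in\mathcal{O}_n$, $\lambda_u$ is the unique unital $*$-endomorphism of $\mathcal{O}_n$ with $\lambda_u(S_i)=uS_i$ for all $i$. A permutation $u\in S([n]^t)$ is identified with the unitary $\sum_{\alpha\in[n]^t}S_{u(\alpha)}S_\alpha^*$, where $S_\alpha=S_{\alpha_1}\cdots S_{\alpha_t}$; $\mathcal{P}_n^t$ is the set of these unitaries, and $\lambda_u$ for a permutation $u$ means $\lambda$ of the corresponding unitary. $\lambda^{-1}(\mathcal{P}_n^2):=\{\lambda_u\in\mathrm{Aut}(\mathcal{O}_n): u\in\mathcal{P}_n^2\}$. $\mathrm{Out}(\mathcal{O}_n)$ is the quotient of $\mathrm{Aut}(\mathcal{O}_n)$ by inner automorphisms and $\pi$ is the canonical projection. For $i\neq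 j$ in $[4]$ let $\{h,k\}=[4]\setminus\{i,j\}$ and define in $S([4]^2)$: $u_0=((i,h),(i,k))$, $v_0=((j,h),(j,k))$, $w_0'=((i,h),(j,h))$, $x_0=((i,i),(j,i))((i,j),(j,j))$, $y_0=((h,h),(h,k))((k,h),(k,k))$. $K_{i,j}$ is the subgroup of $\mathrm{Aut}(\mathcal{O}_4)$ generated by $\lambda_{u_0},\lambda_{v_0},\lambda_{w_0'},\lambda_{x_0},\lambda_{y_0}$ (so $K_{i,j}=K_{j,i}$). *)

theory Defs
  imports
    "HOL-Algebra.Algebra"
    "HOL-Algebra.Algebraic_Closure_Type"
    "HOL-Analysis.Abstract_Metric_Spaces"
begin

section \<open>Unital C*-algebras\<close>

record 'a cstar = "(complex, 'a) module" +
  adj :: "'a \<Rightarrow> 'a"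
  nrm :: "'a \<Rightarrow> real"

definition cdist :: "('a, 'm) cstar_scheme \<Rightarrow> 'a \<Rightarrow> 'a \<Rightarrow> real" where
  "cdist A x y = nrm A (x \<ominus>\<^bsub>A\<^esub> y)"

text \<open>The library locale \<open>algebra\<close> is restricted to commutative algebras, hence the
  combination of \<open>ring\<close> and \<open>module\<close> below.\<close>

locale cstar_algebra =
  ring A + module "ring_of_type_algebra :: complex ring" A
  for A :: "('a, 'm) cstar_scheme" (structure) +
  assumes smult_mult_left:
      "\<lbrakk>x \<in> carrier A; y \<in> carrier A\<rbrakk> \<Longrightarrow> (c \<odot> x) \<otimes> y = c \<odot> (x \<otimes> y)"
    and smult_mult_right:
      "\<lbrakk>x \<in> carrier A; y \<in> carrier A\<rbrakk> \<Longrightarrow> x \<otimes> (c \<odot> y) = c \<odot> (x \<otimes> y)"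
    and adj_closed: "x \<in> carrier A \<Longrightarrow> adj A x \<in> carrier A"
    and adj_adj: "x \<in> carrier A \<Longrightarrow> adj A (adj A x) = x"
    and adj_add:
      "\<lbrakk>x \<in> carrier A; y \<in> carrier A\<rbrakk> \<Longrightarrow> adj A (x \<oplus> y) = adj A x \<oplus> adj A y"
    and adj_smult: "x \<in> carrier A \<Longrightarrow> adj A (c \<odot> x) = cnj c \<odot> adj A x"
    and adj_mult:
      "\<lbrakk>x \<in> carrier A; y \<in> carrier A\<rbrakk> \<Longrightarrow> adj A (x \<otimes> y) = adj A y \<otimes> adj A x"
    and nrm_nonneg: "x \<in> carrier A \<Longrightarrow> 0 \<le> nrm A x"
    and nrm_eq_0: "x \<in> carrier A \<Longrightarrow> nrm A x = 0 \<longleftrightarrow> x = \<zero>"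
    and nrm_triangle:
      "\<lbrakk>x \<in> carrier A; y \<in> carrier A\<rbrakk> \<Longrightarrow> nrm A (x \<oplus> y) \<le> nrm A x + nrm A y"
    and nrm_smult: "x \<in> carrier A \<Longrightarrow> nrm A (c \<odot> x) = cmod c * nrm A x"
    and nrm_mult:
      "\<lbrakk>x \<in> carrier A; y \<in> carrier A\<rbrakk> \<Longrightarrow> nrm A (x \<otimes> y) \<le> nrm A x * nrm A y"
    and cstar_identity: "x \<in> carrier A \<Longrightarrow> nrm A (adj A x \<otimes> x) = (nrm A x)\<^sup>2"
    and complete: "Metric_space.mcomplete (carrier A) (cdist A)"

text \<open>Homomorphisms are taken to be extensional on the carrier, so that equality of
  functions is equality of homomorphisms.\<close>

definition star_homs :: "'a cstar \<Rightarrow> 'b cstar \<Rightarrow> ('a \<Rightarrow> 'b) set" where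
  "star_homs A B = {f \<in> ring_hom A B \<inter> extensional (carrier A).
     (\<forall>c. \<forall>x \<in> carrier A. f (c \<odot>\<^bsub>A\<^esub> x) = c \<odot>\<^bsub>B\<^esub> f x) \<and>
     (\<forall>x \<in> carrier A. f (adj A x) = adj B (f x))}"

definition unitaries :: "'a cstar \<Rightarrow> 'a set" where
  "unitaries A =
     {u \<in> carrier A. adj A u \<otimes>\<^bsub>A\<^esub> u = \<one>\<^bsub>A\<^esub> \<and> u \<otimes>\<^bsub>A\<^esub> adj A u = \<one>\<^bsub>A\<^esub>}"

definition aut_group :: "'a cstar \<Rightarrow> ('a \<Rightarrow> 'a) monoid" where
  "aut_group A = BijGroup (carrier A) \<lparr>carrier := Bij (carrier A) \<inter> star_homs A A\<rparr>"

definition inner_auts :: "'a cstar \<Rightarrow> ('a \<Rightarrow> 'a) set" where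
  "inner_auts A =
     (\<lambda>z. \<lambda>x \<in> carrier A. z \<otimes>\<^bsub>A\<^esub> x \<otimes>\<^bsub>A\<^esub> adj A z) ` unitaries A"

definition out_group :: "'a cstar \<Rightarrow> ('a \<Rightarrow> 'a) set monoid" where
  "out_group A = aut_group A Mod inner_auts A"

definition out_proj :: "'a cstar \<Rightarrow> ('a \<Rightarrow> 'a) \<Rightarrow> ('a \<Rightarrow> 'a) set" where
  "out_proj A f = inner_auts A #>\<^bsub>aut_group A\<^esub> f"

section \<open>Cuntz algebras\<close>

definition cuntz_family :: "nat \<Rightarrow> 'a cstar \<Rightarrow> (nat \<Rightarrow> 'a) \<Rightarrow> bool" where
  "cuntz_family n A S \<longleftrightarrow>
     (\<forall>i \<in> {1..n}. S i \<in> carrier A \<and> adj A (S i) \<otimes>\<^bsub>A\<^esub> S i = \<one>\<^bsub>A\<^esub>) \<and>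
     (\<Oplus>\<^bsub>A\<^esub>i \<in> {1..n}. S i \<otimes>\<^bsub>A\<^esub> adj A (S i)) = \<one>\<^bsub>A\<^esub>"

definition generates_cstar :: "'a cstar \<Rightarrow> 'a set \<Rightarrow> bool" where
  "generates_cstar A G \<longleftrightarrow> G \<subseteq> carrier A \<and>
     (\<forall>B. G \<subseteq> B \<and> subring B A \<and>
          (\<forall>c. \<forall>x \<in> B. c \<odot>\<^bsub>A\<^esub> x \<in> B) \<and> (\<forall>x \<in> B. adj A x \<in> B) \<and>
          closedin (Metric_space.mtopology (carrier A) (cdist A)) B
          \<longrightarrow> B = carrier A)"

definition cuntz_universal ::
    "'b itself \<Rightarrow> nat \<Rightarrow> 'a cstar \<Rightarrow> (nat \<Rightarrow> 'a) \<Rightarrow> bool" where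
  "cuntz_universal _ n A S \<longleftrightarrow>
     (\<forall>(B :: 'b cstar) T. cstar_algebra B \<and> cuntz_family n B T \<longrightarrow>
        (\<exists>!f. f \<in> star_homs A B \<and> (\<forall>i \<in> {1..n}. f (S i) = T i)))"

text \<open>\<open>cuntz_algebra n A S\<close>: the C*-algebra \<open>A\<close> with generating isometries
  \<open>S 1, \<dots>, S n\<close> is the Cuntz algebra.

  HOL has no quantification over types, so the targets of the universal property are all
  C*-algebras carried by a subset of the type of \<open>A\<close> or by a subset of one fixed large type.
  This is the full universal property: only the C*-subalgebra generated by a Cuntz family
  in the target matters, it is separable, and every separable C*-algebra has an isomorphic
  copy on the fixed type (for instance inside the bounded operators on \<open>\<ell>\<^sup>2\<close>).
  The type of \<open>A\<close> alone would not do, as over a small type the zero algebra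
  would satisfy the property.\<close>

definition cuntz_algebra :: "nat \<Rightarrow> 'a cstar \<Rightarrow> (nat \<Rightarrow> 'a) \<Rightarrow> bool" where
  "cuntz_algebra n A S \<longleftrightarrow> 2 \<le> n \<and> cstar_algebra A \<and> cuntz_family n A S \<and>
     generates_cstar A (S ` {1..n}) \<and>
     cuntz_universal TYPE('a) n A S \<and>
     cuntz_universal TYPE((nat \<Rightarrow> complex) \<Rightarrow> (nat \<Rightarrow> complex)) n A S"

definition cuntz_endo :: "nat \<Rightarrow> 'a cstar \<Rightarrow> (nat \<Rightarrow> 'a) \<Rightarrow> 'a \<Rightarrow> 'a \<Rightarrow> 'a" where
  "cuntz_endo n A S u =
     (THE f. f \<in> star_homs A A \<and> (\<forall>i \<in> {1..n}. f (S i) = u \<otimes>\<^bsub>A\<^esub> S i))"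

section \<open>Permutative unitaries and automorphisms\<close>

definition words :: "nat \<Rightarrow> nat \<Rightarrow> nat list set" where
  "words n t = {\<alpha>. length \<alpha> = t \<and> set \<alpha> \<subseteq> {1..n}}"

definition S_word :: "'a cstar \<Rightarrow> (nat \<Rightarrow> 'a) \<Rightarrow> nat list \<Rightarrow> 'a" where
  "S_word A S \<alpha> = foldr (\<lambda>i x. S i \<otimes>\<^bsub>A\<^esub> x) \<alpha> \<one>\<^bsub>A\<^esub>"

definition perm_unitary ::
    "nat \<Rightarrow> nat \<Rightarrow> 'a cstar \<Rightarrow> (nat \<Rightarrow> 'a) \<Rightarrow> (nat list \<Rightarrow> nat list) \<Rightarrow> 'a" where
  "perm_unitary n t A S u =
     (\<Oplus>\<^bsub>A\<^esub>\<alpha> \<in> words n t. S_word A S (u \<alpha>) \<otimes>\<^bsub>A\<^esub> adj A (S_word A S \<alpha>))"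

definition perm_unitaries :: "nat \<Rightarrow> nat \<Rightarrow> 'a cstar \<Rightarrow> (nat \<Rightarrow> 'a) \<Rightarrow> 'a set" where
  "perm_unitaries n t A S = perm_unitary n t A S ` {u. u permutes words n t}"

definition perm_auts :: "nat \<Rightarrow> nat \<Rightarrow> 'a cstar \<Rightarrow> (nat \<Rightarrow> 'a) \<Rightarrow> ('a \<Rightarrow> 'a) set" where
  "perm_auts n t A S =
     cuntz_endo n A S ` perm_unitaries n t A S \<inter> carrier (aut_group A)"

text \<open>The permutations \<open>u\<^sub>0, v\<^sub>0, w\<^sub>0', x\<^sub>0, y\<^sub>0\<close> of \<open>[4]\<^sup>2\<close>. The choice of which of the
  two elements of \<open>[4] - {i, j}\<close> is called \<open>h\<close> is kept as a parameter.\<close>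

definition K_perms :: "nat \<Rightarrow> nat \<Rightarrow> nat \<Rightarrow> nat \<Rightarrow> (nat list \<Rightarrow> nat list) set" where
  "K_perms i j h k =
     {Transposition.transpose [i, h] [i, k],
      Transposition.transpose [j, h] [j, k],
      Transposition.transpose [i, h] [j, h],
      Transposition.transpose [i, i] [j, i] \<circ> Transposition.transpose [i, j] [j, j],
      Transposition.transpose [h, h] [h, k] \<circ> Transposition.transpose [k, h] [k, k]}"

definition K_group ::
    "'a cstar \<Rightarrow> (nat \<Rightarrow> 'a) \<Rightarrow> nat \<Rightarrow> nat \<Rightarrow> nat \<Rightarrow> nat \<Rightarrow> ('a \<Rightarrow> 'a) set" where
  "K_group A S i j h k =
     generate (aut_group A) ((\<lambda>u. cuntz_endo 4 A S (perm_unitary 4 2 A S u)) ` K_perms i j h k)"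

end

theory Submission
  imports Defs "HOL-Analysis.Analysis"
begin

text \<open>
  A permutation \<open>u\<close> in the group \<open>\<Gamma>\<close> generated by \<open>u\<^sub>0, v\<^sub>0, w\<^sub>0', x\<^sub>0, y\<^sub>0\<close> permutes the four words
  of the block \<open>{i,j} \<times> {h,k}\<close> arbitrarily, possibly exchanges \<open>i\<close> and \<open>j\<close> as first letters on
  \<open>{i,j} \<times> {i,j}\<close>, and possibly exchanges \<open>h\<close> and \<open>k\<close> as second letters on \<open>{h,k} \<times> {h,k}\<close>; hence
  \<open>\<Gamma>\<close> is \<open>S\<^sub>4 \<times> \<int>\<^sub>2 \<times> \<int>\<^sub>2\<close>. On words of length three, the action of one element of \<open>\<Gamma>\<close> on the
  first two letters commutes with that of another one on the last two, and this makes
  \<open>u \<mapsto> \<lambda>\<^sub>u\<close> multiplicative on \<open>\<Gamma>\<close>.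

  To see that \<open>\<lambda>\<^sub>u\<close> and \<open>\<lambda>\<^sub>v\<close> differ modulo inner automorphisms, compare them in a permutative
  representation of the Cuntz algebra on \<open>\<ell>\<^sup>2\<close> whose basis consists of the infinite words with a
  given periodic tail: for a suitable finite word \<open>w\<close>, one of \<open>\<lambda>\<^sub>u(S\<^sub>w)\<close> and \<open>\<lambda>\<^sub>v(S\<^sub>w)\<close> has a fixed
  vector and the other one has not. Tails of period one detect the two exchanges, those of
  period two the permutation of the block, and a tail of period three is needed only to separate
  \<open>K\<^sub>i\<^sub>j\<close> from \<open>K\<^sub>h\<^sub>k\<close>.

  That the permutation unitaries are unitary rests on the orthogonality of the ranges of the
  \<open>S\<^sub>i\<close>, that is, on the fact that four projections with sum \<open>1\<close> in a C*-algebra are orthogonal.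
\<close>

section \<open>The Hilbert space of square summable sequences\<close>

text \<open>The C*-algebra is given by axioms alone, without spectral theory or positivity, and this
  shapes the proof twice. Orthogonality of the ranges has to be extracted from ring identities and
  norm estimates. Inequivalence modulo inner automorphisms has to be seen in concrete
  representations, which the universal property supplies on the fixed type \<open>(nat \<Rightarrow>
  complex) \<Rightarrow> (nat \<Rightarrow> complex)\<close>; hence the operators on
  \<open>ell2\<close> are recoded at that type.

  That an isometry has no fixed vector is decided by the numbering of the basis: if every basis
  vector goes to one of strictly larger index, the coordinates of a fixed vector vanish by induction
  on the index. Each separation thus becomes a statement about two maps on the natural numbers, one
  with a fixed point and one that strictly raises every number. Reading infinite words as base-4
  numbers suits this: prefixing a letter multiplies by four up to a digit, so only the few indices
  of the periodic tail need care.\<close>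

typedef ell2 = "{f :: nat \<Rightarrow> complex. (\<lambda>n. (cmod (f n))\<^sup>2) summable_on UNIV}"
  morphisms coord ell2_of
  by (rule exI[of _ "\<lambda>_. 0"]) simp

lemma summable_coord: "(\<lambda>n. (cmod (coord x n))\<^sup>2) summable_on UNIV"
  using coord[of x] by simp

lemma coord_ell2_of [simp]:
  "(\<lambda>n. (cmod (f n))\<^sup>2) summable_on UNIV \<Longrightarrow> coord (ell2_of f) = f"
  by (simp add: ell2_of_inverse)

lemma ell2_eqI: "(\<And>n. coord x n = coord y n) \<Longrightarrow> x = y"
  by (metis coord_inject ext)

lemma square_summable_add:
  fixes f g :: "nat \<Rightarrow> complex"
  assumes "(\<lambda>n. (cmod (f n))\<^sup>2) summable_on UNIV" "(\<lambda>n. (cmod (g n))\<^sup>2) summable_on UNIV"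
  shows "(\<lambda>n. (cmod (f n + g n))\<^sup>2) summable_on UNIV"
proof (rule summable_on_comparison_test)
  show "(\<lambda>n. 2 * (cmod (f n))\<^sup>2 + 2 * (cmod (g n))\<^sup>2) summable_on UNIV"
    by (intro summable_on_add summable_on_cmult_right assms)
  fix n
  have "(cmod (f n + g n))\<^sup>2 \<le> (cmod (f n) + cmod (g n))\<^sup>2"
    by (intro power_mono norm_triangle_ineq) auto
  also have "\<dots> \<le> 2 * (cmod (f n))\<^sup>2 + 2 * (cmod (g n))\<^sup>2"
    using sum_squares_bound[of "cmod (f n)" "cmod (g n)"] by (simp add: power2_sum)
  finally show "(cmod (f n + g n))\<^sup>2 \<le> 2 * (cmod (f n))\<^sup>2 + 2 * (cmod (g n))\<^sup>2" .
qed auto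

lemma square_summable_mult:
  fixes f :: "nat \<Rightarrow> complex"
  assumes "(\<lambda>n. (cmod (f n))\<^sup>2) summable_on UNIV"
  shows "(\<lambda>n. (cmod (c * f n))\<^sup>2) summable_on UNIV"
  using summable_on_cmult_right[OF assms, of "(cmod c)\<^sup>2"] by (simp add: norm_mult power_mult_distrib)

lemma summable_inner:
  fixes f g :: "nat \<Rightarrow> complex"
  assumes "(\<lambda>n. (cmod (f n))\<^sup>2) summable_on UNIV" "(\<lambda>n. (cmod (g n))\<^sup>2) summable_on UNIV"
  shows "(\<lambda>n. inner (f n) (g n)) summable_on UNIV"
proof (rule abs_summable_summable, rule summable_on_comparison_test)
  show "(\<lambda>n. (cmod (f n))\<^sup>2 + (cmod (g n))\<^sup>2) summable_on UNIV"
    by (intro summable_on_add assms)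
  fix n
  have "norm (inner (f n) (g n)) \<le> cmod (f n) * cmod (g n)"
    using Cauchy_Schwarz_ineq2 by auto
  also have "\<dots> \<le> (cmod (f n))\<^sup>2 + (cmod (g n))\<^sup>2"
    using sum_squares_bound[of "cmod (f n)" "cmod (g n)"]
      mult_nonneg_nonneg[OF norm_ge_zero norm_ge_zero, of "f n" "g n"] by linarith
  finally show "norm (inner (f n) (g n)) \<le> (cmod (f n))\<^sup>2 + (cmod (g n))\<^sup>2" .
qed auto

instantiation ell2 :: real_vector
begin
definition "0 = ell2_of (\<lambda>_. 0)"
definition "x + y = ell2_of (\<lambda>n. coord x n + coord y n)"
definition "- x = ell2_of (\<lambda>n. - coord x n)"
definition "x - y = ell2_of (\<lambda>n. coord x n + - coord y n)" for x y :: ell2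
definition "scaleR r x = ell2_of (\<lambda>n. complex_of_real r * coord x n)"

lemma coord_zero [simp]: "coord 0 = (\<lambda>_. 0)"
  by (simp add: zero_ell2_def)

lemma coord_plus [simp]: "coord (x + y) = (\<lambda>n. coord x n + coord y n)"
  by (simp add: plus_ell2_def square_summable_add summable_coord)

lemma coord_uminus [simp]: "coord (- x) = (\<lambda>n. - coord x n)"
  by (simp add: uminus_ell2_def summable_coord)

lemma coord_minus [simp]: "coord (x - y) = (\<lambda>n. coord x n - coord y n)"
  using square_summable_add[OF summable_coord[of x], of "\<lambda>n. - coord y n"]
  by (simp add: minus_ell2_def summable_coord)

lemma coord_scaleR [simp]: "coord (scaleR r x) = (\<lambda>n. complex_of_real r * coord x n)"
  by (simp only: scaleR_ell2_def coord_ell2_of square_summable_mult summable_coord)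

instance
  by standard (rule ell2_eqI; simp add: algebra_simps)+
end

text \<open>The inner product is the real part of the Hermitian one. It makes \<open>ell2\<close> a
  real inner product space, to which \<open>blinfun\<close> applies; complex scalars return as the
  maps \<open>cscale\<close>, and for complex linear operators the adjoints with respect to both
  products coincide.\<close>

instantiation ell2 :: real_inner
begin
definition "inner x y = (\<Sum>\<^sub>\<infinity>n. inner (coord x n) (coord y n))"
definition "norm x = sqrt (inner x x)" for x :: ell2
definition "dist x y = norm (x - y)" for x y :: ell2
definition "sgn x = x /\<^sub>R norm x" for x :: ell2
definition "uniformity = (INF e\<in>{0 <..}. principal {(x, y). dist (x :: ell2) y < e})"
definition "open U = (\<forall>x\<in>U. eventually (\<lambda>(x', y). x' = x \<longrightarrow> y \<in> U) uniformity)" for U :: "ell2 set"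

lemma summable_inner_coord: "(\<lambda>n. inner (coord x n) (coord y n)) summable_on UNIV"
  by (intro summable_inner summable_coord)

instance
proof
  fix x y z :: ell2 and r :: real
  show "inner x y = inner y x"
    by (simp add: inner_ell2_def inner_commute)
  show "inner (x + y) z = inner x z + inner y z"
    by (simp add: inner_ell2_def inner_add_left infsum_add summable_inner_coord)
  show "inner (scaleR r x) y = r * inner x y"
    by (simp add: inner_ell2_def infsum_cmult_right' flip: scaleR_conv_of_real)
  show "0 \<le> inner x x"
    by (simp add: inner_ell2_def infsum_nonneg)
  show "(inner x x = 0) = (x = 0)"
  proof
    assume "inner x x = 0"
    then have "inner (coord x n) (coord x n) = 0" for n
      using nonneg_infsum_le_0D[of "\<lambda>n. inner (coord x n) (coord x n)" UNIV]
      by (simp add: inner_ell2_def summable_inner_coord)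
    then show "x = 0"
      by (intro ell2_eqI) simp
  qed (simp add: inner_ell2_def)
qed (simp_all add: norm_ell2_def dist_ell2_def sgn_ell2_def uniformity_ell2_def open_ell2_def)
end

lemma norm_ell2_sq: "(norm x)\<^sup>2 = (\<Sum>\<^sub>\<infinity>n. (cmod (coord x n))\<^sup>2)"
  unfolding power2_norm_eq_inner by (simp add: inner_ell2_def power2_norm_eq_inner)

lemma sum_coord_le_norm:
  assumes "finite F"
  shows "(\<Sum>n\<in>F. (cmod (coord x n))\<^sup>2) \<le> (norm x)\<^sup>2"
  unfolding norm_ell2_sq using assms by (intro finite_sum_le_infsum summable_coord) auto

lemma norm_coord_le: "cmod (coord x n) \<le> norm x"
proof (rule power2_le_imp_le)
  show "(cmod (coord x n))\<^sup>2 \<le> (norm x)\<^sup>2"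
    using sum_coord_le_norm[of "{n}" x] by simp
qed simp

text \<open>The limit is taken coordinatewise. The estimates concern finite partial sums, uniformly
  in the finite set, so that limits pass through finite sums only.\<close>

lemma Cauchy_ell2_convergent:
  fixes xs :: "nat \<Rightarrow> ell2"
  assumes xs: "Cauchy xs"
  shows "convergent xs"
proof -
  have "Cauchy (\<lambda>k. coord (xs k) n)" for n
  proof (rule metric_CauchyI)
    fix e :: real assume "0 < e"
    then have "\<exists>M. \<forall>m\<ge>M. \<forall>k\<ge>M. dist (xs m) (xs k) < e"
      by (rule metric_CauchyD[OF xs])
    then obtain M where M: "\<And>m k. m \<ge> M \<Longrightarrow> k \<ge> M \<Longrightarrow> norm (xs m - xs k) < e"
      by (auto simp: dist_norm)
    have "dist (coord (xs m) n) (coord (xs k) n) < e" if "m \<ge> M" "k \<ge> M" for m k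
      using norm_coord_le[of "xs m - xs k" n] M[OF that] by (simp add: dist_norm)
    then show "\<exists>M. \<forall>m\<ge>M. \<forall>k\<ge>M. dist (coord (xs m) n) (coord (xs k) n) < e"
      by blast
  qed
  then have "\<forall>n. \<exists>l. (\<lambda>k. coord (xs k) n) \<longlonglongrightarrow> l"
    using Cauchy_convergent unfolding convergent_def by blast
  then obtain f where f: "\<And>n. (\<lambda>k. coord (xs k) n) \<longlonglongrightarrow> f n"
    by (auto dest!: choice)
  have bound: "\<exists>M. \<forall>k\<ge>M. \<forall>F. finite F \<longrightarrow> (\<Sum>n\<in>F. (cmod (coord (xs k) n - f n))\<^sup>2) \<le> e\<^sup>2"
    if "0 < e" for e
  proof -
    obtain M where M: "\<And>m k. m \<ge> M \<Longrightarrow> k \<ge> M \<Longrightarrow> dist (xs m) (xs k) < e"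
      using metric_CauchyD[OF xs \<open>0 < e\<close>] by blast
    have "(\<Sum>n\<in>F. (cmod (coord (xs k) n - f n))\<^sup>2) \<le> e\<^sup>2" if "k \<ge> M" "finite F" for k F
    proof (rule Lim_bounded)
      show "(\<lambda>m. \<Sum>n\<in>F. (cmod (coord (xs k) n - coord (xs m) n))\<^sup>2) \<longlonglongrightarrow>
          (\<Sum>n\<in>F. (cmod (coord (xs k) n - f n))\<^sup>2)"
        by (intro tendsto_intros f)
      show "\<forall>m\<ge>M. (\<Sum>n\<in>F. (cmod (coord (xs k) n - coord (xs m) n))\<^sup>2) \<le> e\<^sup>2"
      proof (intro allI impI)
        fix m assume "m \<ge> M"
        have "(\<Sum>n\<in>F. (cmod (coord (xs k) n - coord (xs m) n))\<^sup>2) \<le> (norm (xs k - xs m))\<^sup>2"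
          using sum_coord_le_norm[OF \<open>finite F\<close>, of "xs k - xs m"] by simp
        also have "\<dots> \<le> e\<^sup>2"
          using M[OF \<open>k \<ge> M\<close> \<open>m \<ge> M\<close>] by (intro power_mono) (auto simp: dist_norm)
        finally show "(\<Sum>n\<in>F. (cmod (coord (xs k) n - coord (xs m) n))\<^sup>2) \<le> e\<^sup>2" .
      qed
    qed
    then show ?thesis by blast
  qed
  have summ: "(\<lambda>n. (cmod (g n))\<^sup>2) summable_on UNIV"
    if "\<And>F. finite F \<Longrightarrow> (\<Sum>n\<in>F. (cmod (g n))\<^sup>2) \<le> C" for g :: "nat \<Rightarrow> complex" and C
    using that by (intro nonneg_bdd_above_summable_on bdd_aboveI2) auto
  obtain M where M: "\<And>F. finite F \<Longrightarrow> (\<Sum>n\<in>F. (cmod (coord (xs M) n - f n))\<^sup>2) \<le> 1"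
    using bound[of 1] by auto
  \<comment> \<open>\<open>ell2_of f\<close> is meaningful only once \<open>f\<close> is square
    summable: it is the difference of \<open>xs M\<close> and a sequence with bounded partial
    sums.\<close>
  have "(\<lambda>n. (cmod (coord (xs M) n + - (coord (xs M) n - f n)))\<^sup>2) summable_on UNIV"
    using summ[of "\<lambda>n. coord (xs M) n - f n" 1] M
    by (intro square_summable_add summable_coord) (simp add: norm_minus_commute)
  then have lim: "coord (ell2_of f) = f"
    by simp
  have "xs \<longlonglongrightarrow> ell2_of f"
  proof (rule metric_LIMSEQ_I)
    fix e :: real assume e: "0 < e"
    then obtain M where M: "\<And>k F. k \<ge> M \<Longrightarrow> finite F \<Longrightarrow>
        (\<Sum>n\<in>F. (cmod (coord (xs k) n - f n))\<^sup>2) \<le> (e / 2)\<^sup>2"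
      using bound[of "e / 2"] by auto
    have "norm (xs k - ell2_of f) \<le> e / 2" if "k \<ge> M" for k
    proof (rule power2_le_imp_le)
      show "(norm (xs k - ell2_of f))\<^sup>2 \<le> (e / 2)\<^sup>2"
        unfolding norm_ell2_sq using M[OF that]
        by (intro infsum_le_finite_sums summable_coord) (simp add: lim)
    qed (use e in auto)
    then have "\<forall>k\<ge>M. dist (xs k) (ell2_of f) < e"
      using e by (fastforce simp: dist_norm)
    then show "\<exists>M. \<forall>k\<ge>M. dist (xs k) (ell2_of f) < e" ..
  qed
  then show "convergent xs"
    by (auto simp: convergent_def)
qed

instance ell2 :: complete_space
  by standard (rule Cauchy_ell2_convergent)

instance ell2 :: banach ..

section \<open>The C*-algebra of bounded operators\<close>

lemma inner_ell2_indicator: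
  assumes "\<And>n. n \<noteq> m \<Longrightarrow> coord x n = 0 \<or> coord y n = 0"
  shows "inner x y = inner (coord x m) (coord y m)"
proof -
  have "inner x y = (\<Sum>\<^sub>\<infinity>n\<in>{m}. inner (coord x n) (coord y n))"
    unfolding inner_ell2_def
  proof (rule infsum_cong_neutral)
    fix n assume "n \<in> UNIV - {m}"
    then show "inner (coord x n) (coord y n) = 0"
      using assms[of n] by auto
  qed auto
  then show ?thesis by simp
qed

definition cscale :: "complex \<Rightarrow> ell2 \<Rightarrow> ell2" where
  "cscale c x = ell2_of (\<lambda>n. c * coord x n)"

lemma coord_cscale [simp]: "coord (cscale c x) = (\<lambda>n. c * coord x n)"
  by (simp add: cscale_def square_summable_mult summable_coord)

lemma inner_cscale: "inner (cscale c x) y = inner x (cscale (cnj c) y)"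
  by (simp add: inner_ell2_def inner_complex_def algebra_simps)

lemma norm_cscale: "norm (cscale c x) = cmod c * norm x"
proof (rule power2_eq_imp_eq)
  show "(norm (cscale c x))\<^sup>2 = (cmod c * norm x)\<^sup>2"
    by (simp add: norm_ell2_sq norm_mult power_mult_distrib infsum_cmult_right')
qed auto

lemma bounded_linear_cscale: "bounded_linear (cscale c)"
proof
  show "\<exists>K. \<forall>x. norm (cscale c x) \<le> norm x * K"
    by (auto simp: norm_cscale intro!: exI[of _ "cmod c"])
qed (auto intro!: ell2_eqI simp: algebra_simps)

text \<open>With scalars as operators, a complex multiple of \<open>T\<close> is a composition, and
  the continuity and composition facts for \<open>blinfun\<close> cover it.\<close>

definition scale_op :: "complex \<Rightarrow> ell2 \<Rightarrow>\<^sub>L ell2" where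
  "scale_op c = Blinfun (cscale c)"

lemma scale_op_apply [simp]: "scale_op c x = cscale c x"
  by (simp add: scale_op_def bounded_linear_Blinfun_apply bounded_linear_cscale)

lemma norm_scale_op_compose: "norm (scale_op c o\<^sub>L T) = cmod c * norm T" for T :: "ell2 \<Rightarrow>\<^sub>L ell2"
proof (cases "c = 0")
  case True
  have "scale_op 0 o\<^sub>L T = 0"
    by (rule blinfun_eqI, rule ell2_eqI) simp
  then show ?thesis by (simp add: True)
next
  case False
  have le: "norm (scale_op c o\<^sub>L T) \<le> cmod c * norm T" for c and T :: "ell2 \<Rightarrow>\<^sub>L ell2"
    by (rule norm_blinfun_bound)
      (simp_all add: norm_cscale mult.assoc mult_left_mono norm_blinfun)
  \<comment> \<open>The lower bound is the upper bound \<open>le\<close> for the inverse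
    scalar.\<close>
  have "T = scale_op (1 / c) o\<^sub>L (scale_op c o\<^sub>L T)"
    using False by (intro blinfun_eqI ell2_eqI) simp
  then have "norm T \<le> cmod (1 / c) * norm (scale_op c o\<^sub>L T)"
    using le[of "1 / c" "scale_op c o\<^sub>L T"] by simp
  then have "cmod c * norm T \<le> norm (scale_op c o\<^sub>L T)"
    using False by (simp add: field_simps norm_divide)
  with le show ?thesis by (simp add: order_antisym)
qed

section \<open>Complex linear operators and their adjoints\<close>

definition adjoint_to :: "(ell2 \<Rightarrow>\<^sub>L ell2) \<Rightarrow> (ell2 \<Rightarrow>\<^sub>L ell2) \<Rightarrow> bool" where
  "adjoint_to T T' \<longleftrightarrow> (\<forall>x y. inner (T x) y = inner x (T' y))"

text \<open>Every complex linear bounded operator has an adjoint; including its existence in the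
  definition avoids the Riesz representation theorem.\<close>

definition clinear_ops :: "(ell2 \<Rightarrow>\<^sub>L ell2) set" where
  "clinear_ops = {T :: ell2 \<Rightarrow>\<^sub>L ell2. (\<forall>c x. blinfun_apply T (cscale c x) = cscale c (blinfun_apply T x)) \<and> (\<exists>T'. adjoint_to T T')}"

definition op_adj :: "(ell2 \<Rightarrow>\<^sub>L ell2) \<Rightarrow> (ell2 \<Rightarrow>\<^sub>L ell2)" where
  "op_adj T = (THE T'. adjoint_to T T')"

lemma adjoint_to_unique:
  assumes "adjoint_to T T1" "adjoint_to T T2"
  shows "T1 = T2"
proof (rule blinfun_eqI)
  fix y
  have "inner (T1 y - T2 y) (T1 y - T2 y) = 0"
    using assms unfolding adjoint_to_def by (metis diff_self inner_diff_right)
  then show "T1 y = T2 y" by simp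
qed

lemma op_adj_eqI: "adjoint_to T T' \<Longrightarrow> op_adj T = T'"
  unfolding op_adj_def using adjoint_to_unique by blast

lemma adjoint_to_op_adj: "T \<in> clinear_ops \<Longrightarrow> adjoint_to T (op_adj T)"
  using op_adj_eqI by (auto simp: clinear_ops_def)

lemma clinear_opsD: "T \<in> clinear_ops \<Longrightarrow> T (cscale c x) = cscale c (T x)"
  by (simp add: clinear_ops_def)

lemma adjoint_to_sym: "adjoint_to T T' \<Longrightarrow> adjoint_to T' T"
  by (simp add: adjoint_to_def) (metis inner_commute)

text \<open>A scalar crosses the inner product as its conjugate, passes through \<open>T\<close> by
  linearity and crosses back; the real inner product still separates points.\<close>

lemma adjoint_to_clinear:
  fixes T T' :: "ell2 \<Rightarrow>\<^sub>L ell2"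
  assumes T: "\<And>c x. T (cscale c x) = cscale c (T x)" and adj: "adjoint_to T T'"
  shows "T \<in> clinear_ops" "T' \<in> clinear_ops"
proof -
  show "T \<in> clinear_ops"
    using assms by (auto simp: clinear_ops_def)
  have "T' (cscale c y) = cscale c (T' y)" for c y
  proof -
    have "inner x (T' (cscale c y)) = inner x (cscale c (T' y))" for x
    proof -
      have "inner x (T' (cscale c y)) = inner (T x) (cscale c y)"
        using adj by (simp add: adjoint_to_def)
      also have "\<dots> = inner (T (cscale (cnj c) x)) y"
        by (simp add: T inner_cscale)
      also have "\<dots> = inner x (cscale c (T' y))"
        using adj by (simp add: adjoint_to_def inner_cscale)
      finally show ?thesis .
    qed
    then show ?thesis
      by (rule vector_eq_ldot[THEN iffD1, OF allI])
  qed
  then show "T' \<in> clinear_ops"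
    using adjoint_to_sym[OF adj] by (auto simp: clinear_ops_def)
qed

lemma op_adj_clinear: "T \<in> clinear_ops \<Longrightarrow> op_adj T \<in> clinear_ops"
  by (rule adjoint_to_clinear(2)[OF _ adjoint_to_op_adj]) (auto simp: clinear_opsD)

lemma op_adj_op_adj: "T \<in> clinear_ops \<Longrightarrow> op_adj (op_adj T) = T"
  by (rule op_adj_eqI[OF adjoint_to_sym[OF adjoint_to_op_adj]])

lemma
  assumes "adjoint_to T T'" "adjoint_to U U'"
  shows adjoint_to_add: "adjoint_to (T + U) (T' + U')"
    and adjoint_to_diff: "adjoint_to (T - U) (T' - U')"
    and adjoint_to_compose: "adjoint_to (T o\<^sub>L U) (U' o\<^sub>L T')"
  using assms by (simp_all add: adjoint_to_def blinfun.bilinear_simps inner_simps)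

lemma adjoint_to_scale:
  assumes "adjoint_to T T'" "T \<in> clinear_ops"
  shows "adjoint_to (scale_op c o\<^sub>L T) (scale_op (cnj c) o\<^sub>L T')"
  using assms adjoint_to_clinear(2)[OF _ assms(1)]
  by (simp add: adjoint_to_def inner_cscale clinear_opsD)

lemma
  assumes "T \<in> clinear_ops" "U \<in> clinear_ops"
  shows add_clinear: "T + U \<in> clinear_ops" and op_adj_add: "op_adj (T + U) = op_adj T + op_adj U"
    and diff_clinear: "T - U \<in> clinear_ops" and op_adj_diff: "op_adj (T - U) = op_adj T - op_adj U"
    and compose_clinear: "T o\<^sub>L U \<in> clinear_ops"
    and op_adj_compose: "op_adj (T o\<^sub>L U) = op_adj U o\<^sub>L op_adj T"
proof -
  note adj = adjoint_to_op_adj[OF assms(1)] adjoint_to_op_adj[OF assms(2)]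
  note lin = clinear_opsD[OF assms(1)] clinear_opsD[OF assms(2)]
  show "T + U \<in> clinear_ops"
    by (rule adjoint_to_clinear(1)[OF _ adjoint_to_add[OF adj]], rule ell2_eqI)
      (simp add: lin blinfun.bilinear_simps algebra_simps)
  show "T - U \<in> clinear_ops"
    by (rule adjoint_to_clinear(1)[OF _ adjoint_to_diff[OF adj]], rule ell2_eqI)
      (simp add: lin blinfun.bilinear_simps algebra_simps)
  show "T o\<^sub>L U \<in> clinear_ops"
    by (rule adjoint_to_clinear(1)[OF _ adjoint_to_compose[OF adj]]) (simp add: lin)
  show "op_adj (T + U) = op_adj T + op_adj U"
    by (rule op_adj_eqI[OF adjoint_to_add[OF adj]])
  show "op_adj (T - U) = op_adj T - op_adj U"
    by (rule op_adj_eqI[OF adjoint_to_diff[OF adj]])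
  show "op_adj (T o\<^sub>L U) = op_adj U o\<^sub>L op_adj T"
    by (rule op_adj_eqI[OF adjoint_to_compose[OF adj]])
qed

lemma
  assumes "T \<in> clinear_ops"
  shows scale_clinear: "scale_op c o\<^sub>L T \<in> clinear_ops"
    and op_adj_scale: "op_adj (scale_op c o\<^sub>L T) = scale_op (cnj c) o\<^sub>L op_adj T"
proof -
  note adj = adjoint_to_scale[OF adjoint_to_op_adj[OF assms] assms, of c]
  show "scale_op c o\<^sub>L T \<in> clinear_ops"
    by (rule adjoint_to_clinear(1)[OF _ adj], rule ell2_eqI)
      (simp add: clinear_opsD[OF assms])
  show "op_adj (scale_op c o\<^sub>L T) = scale_op (cnj c) o\<^sub>L op_adj T"
    by (rule op_adj_eqI[OF adj])
qed

lemma id_clinear: "id_blinfun \<in> clinear_ops" and zero_clinear: "0 \<in> clinear_ops"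
proof -
  show "id_blinfun \<in> clinear_ops"
    by (rule adjoint_to_clinear(1)[of _ id_blinfun]) (auto simp: adjoint_to_def)
  show "0 \<in> clinear_ops"
    by (rule adjoint_to_clinear(1)[of _ 0]) (auto simp: adjoint_to_def intro: ell2_eqI)
qed

lemma norm_op_adj_le:
  assumes "T \<in> clinear_ops"
  shows "norm (op_adj T) \<le> norm T"
proof (rule norm_blinfun_bound)
  fix y
  show "norm (op_adj T y) \<le> norm T * norm y"
  proof (cases "op_adj T y = 0")
    case False
    have "(norm (op_adj T y))\<^sup>2 = inner (T (op_adj T y)) y"
      using adjoint_to_op_adj[OF assms] by (simp add: adjoint_to_def power2_norm_eq_inner)
    also have "\<dots> \<le> norm (T (op_adj T y)) * norm y"
      by (rule norm_cauchy_schwarz)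
    also have "\<dots> \<le> norm T * norm (op_adj T y) * norm y"
      by (intro mult_right_mono norm_blinfun) auto
    finally show ?thesis
      using False by (simp add: power2_eq_square mult.assoc mult.left_commute)
  qed simp
qed simp

lemma norm_op_adj: "T \<in> clinear_ops \<Longrightarrow> norm (op_adj T) = norm T"
  using norm_op_adj_le[of T] norm_op_adj_le[OF op_adj_clinear, of T] by (simp add: op_adj_op_adj)

lemma norm_op_adj_compose:
  assumes "T \<in> clinear_ops"
  shows "norm (op_adj T o\<^sub>L T) = (norm T)\<^sup>2"
proof (rule antisym)
  show "norm (op_adj T o\<^sub>L T) \<le> (norm T)\<^sup>2"
    using norm_blinfun_compose[of "op_adj T" T] by (simp add: power2_eq_square norm_op_adj assms)
  let ?C = "norm (op_adj T o\<^sub>L T)"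
  have "norm T \<le> sqrt ?C"
  proof (rule norm_blinfun_bound)
    fix x
    have "(norm (T x))\<^sup>2 = inner x ((op_adj T o\<^sub>L T) x)"
      using adjoint_to_op_adj[OF assms] by (simp add: adjoint_to_def power2_norm_eq_inner)
    also have "\<dots> \<le> norm x * norm ((op_adj T o\<^sub>L T) x)"
      by (rule norm_cauchy_schwarz)
    also have "\<dots> \<le> norm x * (?C * norm x)"
      by (intro mult_left_mono norm_blinfun) auto
    also have "\<dots> = (sqrt ?C * norm x)\<^sup>2"
      by (simp only: power_mult_distrib real_sqrt_pow2 norm_ge_zero)
        (simp add: power2_eq_square mult.left_commute)
    finally have "(norm (T x))\<^sup>2 \<le> (sqrt ?C * norm x)\<^sup>2" .
    then show "norm (T x) \<le> sqrt ?C * norm x"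
      by (rule power2_le_imp_le) simp
  qed simp
  then have "(norm T)\<^sup>2 \<le> (sqrt ?C)\<^sup>2"
    by (intro power_mono) auto
  then show "(norm T)\<^sup>2 \<le> ?C" by simp
qed

text \<open>Membership includes the existence of an adjoint, which must survive the limit. Since
  \<open>op_adj\<close> is isometric, the adjoints form a Cauchy sequence too, and its limit is the
  adjoint sought.\<close>

lemma LIMSEQ_clinear_ops:
  fixes U :: "nat \<Rightarrow> ell2 \<Rightarrow>\<^sub>L ell2"
  assumes U: "\<And>n. U n \<in> clinear_ops" and lim: "U \<longlonglongrightarrow> T"
  shows "T \<in> clinear_ops"
proof -
  have "Cauchy (\<lambda>n. op_adj (U n))"
  proof (rule metric_CauchyI)
    fix e :: real assume "0 < e"
    then obtain M where "\<forall>m\<ge>M. \<forall>n\<ge>M. dist (U m) (U n) < e"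
      using metric_CauchyD[OF LIMSEQ_imp_Cauchy[OF lim]] by blast
    moreover have "dist (op_adj (U m)) (op_adj (U n)) = dist (U m) (U n)" for m n
      by (simp add: dist_norm norm_op_adj diff_clinear U flip: op_adj_diff)
    ultimately show "\<exists>M. \<forall>m\<ge>M. \<forall>n\<ge>M. dist (op_adj (U m)) (op_adj (U n)) < e"
      by auto
  qed
  then obtain T' where lim': "(\<lambda>n. op_adj (U n)) \<longlonglongrightarrow> T'"
    using Cauchy_convergent convergent_def by blast
  have "T (cscale c x) = cscale c (T x)" for c x
  proof (rule LIMSEQ_unique)
    show "(\<lambda>n. U n (cscale c x)) \<longlonglongrightarrow> T (cscale c x)"
      by (intro tendsto_intros lim)
    have "(\<lambda>n. scale_op c (U n x)) \<longlonglongrightarrow> scale_op c (T x)"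
      by (intro tendsto_intros lim)
    then show "(\<lambda>n. U n (cscale c x)) \<longlonglongrightarrow> cscale c (T x)"
      by (simp add: clinear_opsD U)
  qed
  moreover have "inner (T x) y = inner x (T' y)" for x y
  proof (rule LIMSEQ_unique)
    show "(\<lambda>n. inner (U n x) y) \<longlonglongrightarrow> inner (T x) y"
      by (intro tendsto_intros lim)
    have "(\<lambda>n. inner x (op_adj (U n) y)) \<longlonglongrightarrow> inner x (T' y)"
      by (intro tendsto_intros lim')
    then show "(\<lambda>n. inner (U n x) y) \<longlonglongrightarrow> inner x (T' y)"
      using adjoint_to_op_adj[OF U] by (simp add: adjoint_to_def)
  qed
  ultimately show "T \<in> clinear_ops"
    by (auto simp: clinear_ops_def adjoint_to_def)
qed

text \<open>Moves operators to the type for which the universal property is assumed.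
  \<open>ell2_of\<close> is unspecified on sequences that are not square summable; this does no
  harm, as an operator is recovered from the values at \<open>coord x\<close>.\<close>

definition encode_op :: "(ell2 \<Rightarrow>\<^sub>L ell2) \<Rightarrow> (nat \<Rightarrow> complex) \<Rightarrow> (nat \<Rightarrow> complex)" where
  "encode_op T f = coord (T (ell2_of f))"

text \<open>Decoding to an operator off the carrier as well makes \<open>cdist\<close> symmetric on the whole type, as
  \<open>Metric_space\<close> demands.\<close>

definition decode_op :: "((nat \<Rightarrow> complex) \<Rightarrow> (nat \<Rightarrow> complex)) \<Rightarrow> (ell2 \<Rightarrow>\<^sub>L ell2)" where
  "decode_op f = (if f \<in> encode_op ` clinear_ops then inv_into clinear_ops encode_op f else 0)"

lemma decode_clinear [simp]: "decode_op f \<in> clinear_ops"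
  by (simp add: decode_op_def zero_clinear inv_into_into)

lemma decode_encode [simp]: "T \<in> clinear_ops \<Longrightarrow> decode_op (encode_op T) = T"
proof -
  have "inj_on encode_op clinear_ops"
  proof (rule inj_onI, rule blinfun_eqI)
    fix T U x assume "encode_op T = encode_op U"
    then have "encode_op T (coord x) = encode_op U (coord x)" by simp
    then show "T x = U x" by (simp add: encode_op_def coord_inverse coord_inject)
  qed
  then show "T \<in> clinear_ops \<Longrightarrow> decode_op (encode_op T) = T" by (simp add: decode_op_def)
qed

definition bounded_ops :: "((nat \<Rightarrow> complex) \<Rightarrow> (nat \<Rightarrow> complex)) cstar" where
  "bounded_ops =
    \<lparr>carrier = encode_op ` clinear_ops,
     monoid.mult = \<lambda>x y. encode_op (decode_op x o\<^sub>L decode_op y),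
     one = encode_op id_blinfun,
     ring.zero = encode_op 0,
     add = \<lambda>x y. encode_op (decode_op x + decode_op y),
     module.smult = \<lambda>c x. encode_op (scale_op c o\<^sub>L decode_op x),
     adj = \<lambda>x. encode_op (op_adj (decode_op x)),
     nrm = \<lambda>x. norm (decode_op x)\<rparr>"

lemma
  shows carrier_bounded_ops: "carrier bounded_ops = encode_op ` clinear_ops"
    and mult_bounded_ops: "x \<otimes>\<^bsub>bounded_ops\<^esub> y = encode_op (decode_op x o\<^sub>L decode_op y)"
    and one_bounded_ops: "\<one>\<^bsub>bounded_ops\<^esub> = encode_op id_blinfun"
    and zero_bounded_ops: "\<zero>\<^bsub>bounded_ops\<^esub> = encode_op 0"
    and add_bounded_ops: "x \<oplus>\<^bsub>bounded_ops\<^esub> y = encode_op (decode_op x + decode_op y)"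
    and smult_bounded_ops: "c \<odot>\<^bsub>bounded_ops\<^esub> x = encode_op (scale_op c o\<^sub>L decode_op x)"
    and adj_bounded_ops: "adj bounded_ops x = encode_op (op_adj (decode_op x))"
    and nrm_bounded_ops: "nrm bounded_ops x = norm (decode_op x)"
  by (simp_all add: bounded_ops_def)

lemmas bounded_ops_simps = carrier_bounded_ops mult_bounded_ops one_bounded_ops zero_bounded_ops
  add_bounded_ops smult_bounded_ops adj_bounded_ops nrm_bounded_ops

lemmas clinear_intros = add_clinear diff_clinear compose_clinear scale_clinear id_clinear
  zero_clinear op_adj_clinear

lemma compose_op_simps:
  fixes R T U :: "ell2 \<Rightarrow>\<^sub>L ell2"
  shows "(R o\<^sub>L T) o\<^sub>L U = R o\<^sub>L (T o\<^sub>L U)" "(R + T) o\<^sub>L U = (R o\<^sub>L U) + (T o\<^sub>L U)"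
    "R o\<^sub>L (T + U) = (R o\<^sub>L T) + (R o\<^sub>L U)" "id_blinfun o\<^sub>L T = T" "T o\<^sub>L id_blinfun = T"
  by (auto intro!: blinfun_eqI simp: blinfun.bilinear_simps)

lemma ring_bounded_ops: "ring bounded_ops"
proof (rule ringI)
  show "abelian_group bounded_ops"
  proof (rule abelian_groupI)
    fix x assume "x \<in> carrier bounded_ops"
    \<comment> \<open>Written \<open>0 - T\<close> instead of \<open>- T\<close>, so that closure
      under differences gives membership.\<close>
    then have "encode_op (0 - decode_op x) \<in> carrier bounded_ops"
      by (simp add: carrier_bounded_ops clinear_intros del: diff_0)
    then show "\<exists>y\<in>carrier bounded_ops. y \<oplus>\<^bsub>bounded_ops\<^esub> x = \<zero>\<^bsub>bounded_ops\<^esub>"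
      by (rule bexI[rotated]) (simp add: bounded_ops_simps clinear_intros del: diff_0)
  qed (auto simp: bounded_ops_simps clinear_intros add_ac)
  show "Group.monoid bounded_ops"
    by (rule monoidI) (auto simp: bounded_ops_simps clinear_intros compose_op_simps)
qed (auto simp: bounded_ops_simps clinear_intros compose_op_simps)

lemma cdist_bounded_ops: "cdist bounded_ops x y = dist (decode_op x) (decode_op y)"
proof -
  \<comment> \<open>\<open>y\<close> is arbitrary, so the inverse is computed from its definite
    description: off the carrier the group laws do not apply, but addition still acts through
    \<open>decode_op\<close>.\<close>
  have "\<ominus>\<^bsub>bounded_ops\<^esub> y = encode_op (0 - decode_op y)"
    unfolding a_inv_def m_inv_def
  proof (rule the_equality)
    fix z
    assume z: "z \<in> carrier (add_monoid bounded_ops) \<and>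
      y \<otimes>\<^bsub>add_monoid bounded_ops\<^esub> z = \<one>\<^bsub>add_monoid bounded_ops\<^esub> \<and>
      z \<otimes>\<^bsub>add_monoid bounded_ops\<^esub> y = \<one>\<^bsub>add_monoid bounded_ops\<^esub>"
    then obtain U where U: "U \<in> clinear_ops" "z = encode_op U"
      by (auto simp: carrier_bounded_ops)
    have "decode_op (z \<oplus>\<^bsub>bounded_ops\<^esub> y) = decode_op \<zero>\<^bsub>bounded_ops\<^esub>"
      using z by simp
    then have "U + decode_op y = 0"
      by (simp add: bounded_ops_simps clinear_intros U)
    then show "z = encode_op (0 - decode_op y)"
      by (simp add: U add_eq_0_iff2)
  qed (simp add: bounded_ops_simps clinear_intros del: diff_0)
  then show ?thesis
    by (simp add: cdist_def a_minus_def bounded_ops_simps clinear_intros dist_norm del: diff_0) simp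
qed

lemma mcomplete_bounded_ops:
  "Metric_space.mcomplete (carrier bounded_ops) (cdist bounded_ops)"
proof -
  interpret Metric_space "carrier bounded_ops" "cdist bounded_ops"
    by standard (auto simp: carrier_bounded_ops cdist_bounded_ops dist_commute dist_triangle)
  show ?thesis
    unfolding mcomplete_def
  proof (intro allI impI)
    fix \<sigma> assume \<sigma>: "MCauchy \<sigma>"
    then have "\<forall>n. \<exists>T\<in>clinear_ops. \<sigma> n = encode_op T"
      unfolding MCauchy_def unfolding carrier_bounded_ops by blast
    then obtain U where U: "\<And>n. U n \<in> clinear_ops" "\<And>n. \<sigma> n = encode_op (U n)"
      by metis
    have "Cauchy U"
      using \<sigma> unfolding Cauchy_def MCauchy_def by (simp add: U cdist_bounded_ops)
    then obtain T where lim: "U \<longlonglongrightarrow> T"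
      using Cauchy_convergent convergent_def by blast
    then have T: "T \<in> clinear_ops"
      by (rule LIMSEQ_clinear_ops[OF U(1)])
    have "limitin mtopology \<sigma> (encode_op T) sequentially"
      unfolding limitin_metric
      using tendstoD[OF lim] T U by (simp add: carrier_bounded_ops cdist_bounded_ops)
    then show "\<exists>x. limitin mtopology \<sigma> x sequentially"
      by (intro exI[where x = "encode_op T"])
  qed
qed

lemma scale_op_simps:
  "scale_op (a + b) o\<^sub>L T = (scale_op a o\<^sub>L T) + (scale_op b o\<^sub>L T)"
  "scale_op a o\<^sub>L (T + U) = (scale_op a o\<^sub>L T) + (scale_op a o\<^sub>L U)"
  "scale_op (a * b) o\<^sub>L T = scale_op a o\<^sub>L (scale_op b o\<^sub>L T)"
  "scale_op 1 o\<^sub>L T = T"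
  by (auto intro!: blinfun_eqI ell2_eqI simp: blinfun.bilinear_simps algebra_simps)

lemma compose_scale_op:
  "T \<in> clinear_ops \<Longrightarrow> T o\<^sub>L (scale_op a o\<^sub>L U) = scale_op a o\<^sub>L (T o\<^sub>L U)"
  by (auto intro!: blinfun_eqI simp: clinear_opsD)

lemma cstar_algebra_bounded_ops: "cstar_algebra bounded_ops"
proof -
  interpret ring bounded_ops by (rule ring_bounded_ops)
  have "module (ring_of_type_algebra :: complex ring) bounded_ops"
    by (rule moduleI[OF cring_from_type_algebra is_abelian_group])
      (auto simp: ring_of_type_algebra_def bounded_ops_simps scale_op_simps clinear_intros)
  then show ?thesis
  proof (intro cstar_algebra.intro ring_bounded_ops cstar_algebra_axioms.intro mcomplete_bounded_ops)
    fix x assume "x \<in> carrier bounded_ops"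
    then obtain T where "T \<in> clinear_ops" "x = encode_op T"
      by (auto simp: carrier_bounded_ops)
    then show "(nrm bounded_ops x = 0) = (x = \<zero>\<^bsub>bounded_ops\<^esub>)"
      by (auto simp: bounded_ops_simps clinear_intros dest!: arg_cong[where f = decode_op])
  qed (auto simp: bounded_ops_simps clinear_intros op_adj_op_adj op_adj_add op_adj_scale op_adj_compose
      scale_op_simps compose_op_simps compose_scale_op norm_scale_op_compose norm_op_adj_compose
      norm_triangle_ineq norm_blinfun_compose)
qed

section \<open>Projections in a C*-algebra\<close>

text \<open>Four projections with sum \<open>1\<close> are orthogonal, but this is not a purely algebraic fact: the
  hypotheses \<open>add2\<close> to \<open>shift4\<close> come from the norm bounds \<open>\<parallel>s\<parallel> \<le> 1\<close> and \<open>\<parallel>1 - s\<parallel> \<le> 1\<close>. The differences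
  \<open>d\<close> and \<open>e\<close> act as ladder operators, \<open>d s = (2 - s) d\<close> and \<open>e s = - s e\<close>, so that \<open>e d\<close> shifts the
  spectrum of \<open>s\<close> by \<open>2\<close>, which leaves no room for a spectrum inside \<open>[0, 1]\<close>.\<close>

lemma (in ring) idempotents_orthogonal:
  assumes [simp]: "p \<in> carrier R" "q \<in> carrier R" "r \<in> carrier R" "v \<in> carrier R"
    and idem: "p \<otimes> p = p" "q \<otimes> q = q" "r \<otimes> r = r" "v \<otimes> v = v"
    and sum: "p \<oplus> q \<oplus> r \<oplus> v = \<one>"
    and s_def: "s = p \<oplus> q" and d_def: "d = p \<ominus> q" and e_def: "e = r \<ominus> v" and t_def: "t = \<one> \<oplus> \<one>"
    and no2: "\<And>x. x \<in> carrier R \<Longrightarrow> x \<oplus> x = \<zero> \<Longrightarrow> x = \<zero>"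
    and add2: "\<And>x. x \<in> carrier R \<Longrightarrow> (s \<oplus> t) \<otimes> x = \<zero> \<Longrightarrow> x = \<zero>"
    and sub2: "\<And>x. x \<in> carrier R \<Longrightarrow> (s \<ominus> t) \<otimes> x = \<zero> \<Longrightarrow> x = \<zero>"
    and sub4: "\<And>x. x \<in> carrier R \<Longrightarrow> (s \<ominus> (t \<oplus> t)) \<otimes> x = \<zero> \<Longrightarrow> x = \<zero>"
    and add1: "\<And>x. x \<in> carrier R \<Longrightarrow> (s \<oplus> \<one>) \<otimes> x = \<zero> \<Longrightarrow> x = \<zero>"
    and shift4: "\<And>x. x \<in> carrier R \<Longrightarrow> x \<otimes> s = (s \<oplus> (t \<oplus> t)) \<otimes> x \<Longrightarrow> x = \<zero>"
    and star: "(\<one> \<ominus> s) \<otimes> (d \<otimes> e) = \<zero> \<Longrightarrow> (e \<otimes> d) \<otimes> (\<one> \<ominus> s) = \<zero>"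
  shows "p \<otimes> q = \<zero>"
proof -
  have [simp]: "s \<in> carrier R" "d \<in> carrier R" "e \<in> carrier R" "t \<in> carrier R"
    by (simp_all add: s_def d_def e_def t_def)
  have ds: "d \<otimes> s = (t \<ominus> s) \<otimes> d"
    unfolding s_def d_def t_def by (simp add: a_minus_def ring_simprules idem)
  have dd: "d \<otimes> d = s \<otimes> (t \<ominus> s)"
    unfolding s_def d_def t_def by (simp add: a_minus_def ring_simprules idem)
  have "s = (p \<oplus> q \<oplus> r \<oplus> v) \<ominus> (r \<oplus> v)"
    unfolding s_def by (simp add: a_minus_def ring_simprules)
  then have s_alt: "s = \<one> \<ominus> (r \<oplus> v)"
    by (simp add: sum)
  have es: "e \<otimes> s = \<ominus> (s \<otimes> e)"
    unfolding s_alt e_def by (simp add: a_minus_def ring_simprules idem)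
  have ee: "e \<otimes> e = \<one> \<ominus> s \<otimes> s"
    unfolding s_alt e_def by (simp add: a_minus_def ring_simprules idem)
  define f g where "f = e \<otimes> d" and "g = d \<otimes> e"
  have [simp]: "f \<in> carrier R" "g \<in> carrier R"
    by (simp_all add: f_def g_def)
  have et: "e \<otimes> (t \<ominus> s) = (s \<oplus> t) \<otimes> e"
    by (simp add: a_minus_def ring_simprules es t_def)
  have fs: "f \<otimes> s = (s \<oplus> t) \<otimes> f"
  proof -
    have "f \<otimes> s = (e \<otimes> (t \<ominus> s)) \<otimes> d"
      by (simp add: f_def m_assoc ds)
    then show ?thesis
      by (simp add: f_def m_assoc et)
  qed
  \<comment> \<open>\<open>f\<close> shifts \<open>s\<close> by two, so \<open>f f\<close> shifts it
    by four, more than \<open>shift4\<close> permits.\<close>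
  have "f \<otimes> (s \<oplus> t) = (s \<oplus> (t \<oplus> t)) \<otimes> f"
    by (simp add: ring_simprules fs t_def)
  then have "(f \<otimes> f) \<otimes> s = (s \<oplus> (t \<oplus> t)) \<otimes> (f \<otimes> f)"
    by (simp add: m_assoc fs) (simp flip: m_assoc)
  then have ff: "f \<otimes> f = \<zero>"
    by (rule shift4[rotated]) auto
  have gs: "g \<otimes> s = (s \<ominus> t) \<otimes> g"
  proof -
    have "g \<otimes> s = \<ominus> ((d \<otimes> s) \<otimes> e)"
      by (simp add: g_def m_assoc es r_minus)
    also have "\<dots> = (s \<ominus> t) \<otimes> g"
      unfolding ds by (simp add: g_def a_minus_def ring_simprules)
    finally show ?thesis .
  qed
  have gt: "g \<otimes> (t \<ominus> s) = ((t \<oplus> t) \<ominus> s) \<otimes> g"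
    by (simp add: a_minus_def ring_simprules gs t_def)
  \<comment> \<open>\<open>e (f f) d = (e e) g (d d)\<close>, where both squares are polynomials in
    \<open>s\<close> and can be collected to the left of \<open>g\<close>.\<close>
  have "(\<one> \<ominus> s \<otimes> s) \<otimes> ((s \<ominus> t) \<otimes> (((t \<oplus> t) \<ominus> s) \<otimes> g)) = (\<one> \<ominus> s \<otimes> s) \<otimes> ((g \<otimes> s) \<otimes> (t \<ominus> s))"
    by (simp add: gs gt m_assoc)
  also have "\<dots> = e \<otimes> (f \<otimes> f) \<otimes> d"
    by (simp add: f_def g_def m_assoc flip: ee dd)
  also have "\<dots> = \<zero>"
    by (simp add: ff)
  finally have prod0: "(\<one> \<ominus> s \<otimes> s) \<otimes> ((s \<ominus> t) \<otimes> (((t \<oplus> t) \<ominus> s) \<otimes> g)) = \<zero>" .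
  \<comment> \<open>Polynomials in \<open>s\<close> commute, so the factors may be reordered. The
    factors \<open>s - 2\<close>, \<open>s - 4\<close> and \<open>s + 1\<close> cancel;
    \<open>1 - s\<close> does not, as 1 may lie in the spectrum of \<open>s\<close>, and
    \<open>star\<close> carries it to the right of \<open>f\<close>.\<close>
  have "(s \<ominus> t) \<otimes> ((s \<ominus> (t \<oplus> t)) \<otimes> ((s \<oplus> \<one>) \<otimes> ((\<one> \<ominus> s) \<otimes> g))) =
      \<ominus> ((\<one> \<ominus> s \<otimes> s) \<otimes> ((s \<ominus> t) \<otimes> (((t \<oplus> t) \<ominus> s) \<otimes> g)))"
    by (simp add: a_minus_def ring_simprules t_def)
  then have "(s \<ominus> t) \<otimes> ((s \<ominus> (t \<oplus> t)) \<otimes> ((s \<oplus> \<one>) \<otimes> ((\<one> \<ominus> s) \<otimes> g))) = \<zero>"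
    by (simp add: prod0)
  then have "(s \<ominus> (t \<oplus> t)) \<otimes> ((s \<oplus> \<one>) \<otimes> ((\<one> \<ominus> s) \<otimes> g)) = \<zero>"
    by (rule sub2[rotated]) auto
  then have "(s \<oplus> \<one>) \<otimes> ((\<one> \<ominus> s) \<otimes> g) = \<zero>"
    by (rule sub4[rotated]) auto
  then have "(\<one> \<ominus> s) \<otimes> g = \<zero>"
    by (rule add1[rotated]) auto
  then have f1: "f \<otimes> (\<one> \<ominus> s) = \<zero>"
    unfolding f_def g_def by (rule star)
  \<comment> \<open>Moved past \<open>f\<close>, the factor \<open>1 - s\<close> becomes
    \<open>- (s + 1)\<close>, which cancels.\<close>
  have "(s \<oplus> \<one>) \<otimes> f = \<ominus> (f \<otimes> (\<one> \<ominus> s))"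
    by (simp add: a_minus_def ring_simprules fs t_def)
  then have "(s \<oplus> \<one>) \<otimes> f = \<zero>"
    by (simp add: f1)
  then have f0: "f = \<zero>"
    by (rule add1[rotated]) simp
  \<comment> \<open>With \<open>e d = 0\<close>, the formula for \<open>d d\<close> gives
    \<open>s e = 0\<close> and the one for \<open>e e\<close> gives \<open>s (1 - s s) = 0\<close>.
    Cancelling \<open>s + 1\<close> makes \<open>s\<close> idempotent, that is, \<open>p\<close> and
    \<open>q\<close> anticommute.\<close>
  have "(s \<oplus> t) \<otimes> (s \<otimes> e) = \<ominus> (e \<otimes> (s \<otimes> (t \<ominus> s)))"
    by (simp add: a_minus_def ring_simprules t_def es flip: m_assoc[of e s])
  also have "\<dots> = \<ominus> (f \<otimes> d)"
    by (simp add: f_def m_assoc dd)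
  finally have "(s \<oplus> t) \<otimes> (s \<otimes> e) = \<zero>"
    by (simp add: f0)
  then have "s \<otimes> e = \<zero>"
    by (rule add2[rotated]) simp
  then have "s \<otimes> (e \<otimes> e) = \<zero>"
    by (simp flip: m_assoc)
  then have s3: "s \<otimes> (\<one> \<ominus> s \<otimes> s) = \<zero>"
    by (simp add: ee)
  have "(s \<oplus> \<one>) \<otimes> (s \<ominus> s \<otimes> s) = s \<otimes> (\<one> \<ominus> s \<otimes> s)"
    by (simp add: a_minus_def ring_simprules)
  then have "(s \<oplus> \<one>) \<otimes> (s \<ominus> s \<otimes> s) = \<zero>"
    by (simp add: s3)
  then have "s \<ominus> s \<otimes> s = \<zero>"
    by (rule add1[rotated]) simp
  moreover have "s \<ominus> s \<otimes> s = \<ominus> (p \<otimes> q \<oplus> q \<otimes> p)"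
    unfolding s_def by (simp add: a_minus_def ring_simprules idem)
  ultimately have "\<ominus> (p \<otimes> q \<oplus> q \<otimes> p) = \<zero>" by simp
  then have anti: "p \<otimes> q \<oplus> q \<otimes> p = \<zero>"
    by (metis \<open>p \<in> carrier R\<close> \<open>q \<in> carrier R\<close> a_closed m_closed minus_minus minus_zero)
  \<comment> \<open>Anticommuting idempotents commute: multiply by \<open>p\<close> on either side
    and compare. Hence twice \<open>p q\<close> is zero.\<close>
  have "p \<otimes> q \<oplus> p \<otimes> q \<otimes> p = p \<otimes> (p \<otimes> q \<oplus> q \<otimes> p)"
    by (simp add: r_distr idem flip: m_assoc)
  moreover have "p \<otimes> q \<otimes> p \<oplus> q \<otimes> p = (p \<otimes> q \<oplus> q \<otimes> p) \<otimes> p"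
    by (simp add: l_distr m_assoc idem)
  ultimately have "p \<otimes> q \<oplus> p \<otimes> q \<otimes> p = \<zero>" "q \<otimes> p \<oplus> p \<otimes> q \<otimes> p = \<zero>"
    by (simp_all add: anti a_comm)
  then have "p \<otimes> q = q \<otimes> p"
    using add.right_cancel[of "p \<otimes> q \<otimes> p" "p \<otimes> q" "q \<otimes> p"] by simp
  then show ?thesis
    using anti by (intro no2[of "p \<otimes> q"]) auto
qed

text \<open>The two blocks of \<open>(p - q)\<^sup>2\<close> are orthogonal contractions, so all powers of \<open>(p - q)\<^sup>2\<close> have norm
  at most \<open>2\<close>; by the C*-identity the norm of \<open>p - q\<close> is then at most \<open>1\<close>.\<close>

lemma (in ring) square_diff_idempotents:
  assumes [simp]: "p \<in> carrier R" "q \<in> carrier R" and "p \<otimes> p = p" "q \<otimes> q = q"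
  shows "(p \<ominus> q) \<otimes> (p \<ominus> q) =
      p \<otimes> ((\<one> \<ominus> q) \<otimes> p) \<oplus> (\<one> \<ominus> p) \<otimes> (q \<otimes> (\<one> \<ominus> p))"
    and "(p \<otimes> ((\<one> \<ominus> q) \<otimes> p)) \<otimes> ((\<one> \<ominus> p) \<otimes> (q \<otimes> (\<one> \<ominus> p))) = \<zero>"
    and "((\<one> \<ominus> p) \<otimes> (q \<otimes> (\<one> \<ominus> p))) \<otimes> (p \<otimes> ((\<one> \<ominus> q) \<otimes> p)) = \<zero>"
proof -
  have 1: "p \<otimes> (\<one> \<ominus> p) = \<zero>" "(\<one> \<ominus> p) \<otimes> p = \<zero>"
    by (simp_all add: a_minus_def ring_simprules assms)
  have "p \<otimes> ((\<one> \<ominus> p) \<otimes> x) = \<zero>" "(\<one> \<ominus> p) \<otimes> (p \<otimes> x) = \<zero>" if "x \<in> carrier R" for x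
    using that by (simp_all add: 1 flip: m_assoc)
  then show "(p \<otimes> ((\<one> \<ominus> q) \<otimes> p)) \<otimes> ((\<one> \<ominus> p) \<otimes> (q \<otimes> (\<one> \<ominus> p))) = \<zero>"
    "((\<one> \<ominus> p) \<otimes> (q \<otimes> (\<one> \<ominus> p))) \<otimes> (p \<otimes> ((\<one> \<ominus> q) \<otimes> p)) = \<zero>"
    by (simp_all add: m_assoc)
qed (simp add: a_minus_def ring_simprules assms)

text \<open>Exponent zero is excluded, since there the right side would be twice the unit.\<close>

lemma (in ring) pow_sum_orthogonal:
  assumes [simp]: "x \<in> carrier R" "y \<in> carrier R" and "x \<otimes> y = \<zero>" "y \<otimes> x = \<zero>"
  shows "(x \<oplus> y) [^] Suc n = x [^] Suc n \<oplus> y [^] Suc n"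
proof (induction n)
  case (Suc n)
  have "x [^] Suc n \<otimes> y = \<zero>" "y [^] Suc n \<otimes> x = \<zero>"
    by (simp_all add: m_assoc assms)
  with Suc show ?case
    by (simp add: l_distr r_distr nat_pow_Suc[of _ "Suc n"] del: nat_pow_Suc)
qed simp

section \<open>Norm estimates for projections\<close>

context cstar_algebra
begin

lemma ring_A: "ring A"
  by (rule cstar_algebra.axioms(1)[OF cstar_algebra_axioms])

lemma smult_A_closed [simp]: "x \<in> carrier A \<Longrightarrow> c \<odot> x \<in> carrier A" for c :: complex
  using smult_closed[of c x] by (simp add: ring_of_type_algebra_def)

lemma smult_A_one: "x \<in> carrier A \<Longrightarrow> (1 :: complex) \<odot> x = x"
  using smult_one[of x] by (simp add: ring_of_type_algebra_def)

lemma smult_A_add: "x \<in> carrier A \<Longrightarrow> (c + d) \<odot> x = c \<odot> x \<oplus> d \<odot> x" for c d :: complex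
  using smult_l_distr[of c d x] by (simp add: ring_of_type_algebra_def)

lemma nrm_double: "x \<in> carrier A \<Longrightarrow> nrm A (x \<oplus> x) = 2 * nrm A x"
  using smult_A_add[of x 1 1] nrm_smult[of x 2] by (simp add: smult_A_one)

lemma nrm_minus: "x \<in> carrier A \<Longrightarrow> nrm A (\<ominus> x) = nrm A x"
proof -
  assume x: "x \<in> carrier A"
  have "(-1) \<odot> x \<oplus> x = (-1 + 1) \<odot> x"
    using x by (subst smult_A_add) (simp_all add: smult_A_one)
  also have "\<dots> = \<zero>"
    using x nrm_smult[of x 0] nrm_eq_0[of "0 \<odot> x"] by simp
  finally have "\<ominus> x = (-1) \<odot> x"
    using x by (intro abelian_group.minus_equality ring.is_abelian_group ring_A) auto
  then show "nrm A (\<ominus> x) = nrm A x"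
    using x nrm_smult[of x "-1"] by simp
qed

lemma adj_zero: "adj A \<zero> = \<zero>"
proof -
  have "adj A \<zero> \<oplus> adj A \<zero> = adj A \<zero> \<oplus> \<zero>"
    using adj_add[of \<zero> \<zero>] by (simp add: adj_closed)
  then show ?thesis
    by (simp add: adj_closed)
qed

lemma adj_minus: "x \<in> carrier A \<Longrightarrow> adj A (\<ominus> x) = \<ominus> adj A x"
proof -
  assume x: "x \<in> carrier A"
  have "adj A (\<ominus> x) \<oplus> adj A x = adj A (\<ominus> x \<oplus> x)"
    using x by (simp add: adj_add)
  also have "\<dots> = \<zero>"
    using x by (simp add: adj_zero ring.ring_simprules[OF ring_A])
  finally show ?thesis
    using x by (intro abelian_group.minus_equality[symmetric] ring.is_abelian_group ring_A)
      (auto simp: adj_closed)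
qed

lemma adj_one: "adj A \<one> = \<one>"
proof -
  have "adj A (adj A \<one> \<otimes> \<one>) = adj A \<one> \<otimes> adj A (adj A \<one>)"
    by (rule adj_mult) (simp_all add: adj_closed)
  then show ?thesis
    by (simp add: adj_adj adj_closed)
qed

definition projection :: "'a \<Rightarrow> bool" where
  "projection p \<longleftrightarrow> p \<in> carrier A \<and> adj A p = p \<and> p \<otimes> p = p"

lemma projection_complement:
  assumes "projection p"
  shows "projection (\<one> \<ominus> p)"
  using assms by (simp add: projection_def a_minus_def adj_add adj_minus adj_one
      ring.ring_simprules[OF ring_A])

lemma nrm_projection_le:
  assumes "projection p"
  shows "nrm A p \<le> 1"
proof -
  have "nrm A p = (nrm A p)\<^sup>2"
    using cstar_identity[of p] assms by (simp add: projection_def)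
  then have "nrm A p = 0 \<or> nrm A p = 1"
    by (simp add: power2_eq_square)
  then show ?thesis by auto
qed

text \<open>For a self-adjoint element the C*-identity gives the norm of the square exactly;
  iterating it reaches the exponents that are powers of two.\<close>

lemma nrm_pow_self_adjoint:
  assumes x: "x \<in> carrier A" and sa: "adj A x = x"
  shows "nrm A (x [^] (2 ^ k :: nat)) = nrm A x ^ 2 ^ k"
proof -
  have cl: "x [^] n \<in> carrier A" for n :: nat
    using x by (simp add: monoid.nat_pow_closed[OF ring.is_monoid[OF ring_A]])
  have sa': "adj A (x [^] n) = x [^] n" for n :: nat
  proof (induction n)
    case (Suc n)
    then have "adj A (x [^] Suc n) = x \<otimes> x [^] n"
      using x by (simp add: adj_mult cl sa)
    also have "\<dots> = x [^] Suc n"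
      using x by (simp only: monoid.nat_pow_Suc2[OF ring.is_monoid[OF ring_A]])
    finally show ?case .
  qed (simp add: adj_one)
  show ?thesis
  proof (induction k)
    case (Suc k)
    have "nrm A (x [^] (2 ^ Suc k :: nat)) = nrm A (x [^] (2 ^ k :: nat) \<otimes> x [^] (2 ^ k :: nat))"
      using x by (simp add: monoid.nat_pow_mult[OF ring.is_monoid[OF ring_A]] mult_2)
    also have "\<dots> = (nrm A (x [^] (2 ^ k :: nat)))\<^sup>2"
      using cstar_identity[OF cl] by (simp add: sa')
    finally show ?case
      by (simp add: Suc power_mult[symmetric] mult.commute)
  qed (simp add: x monoid.l_one[OF ring.is_monoid[OF ring_A]])
qed

lemma nrm_pow_le_one:
  assumes x: "x \<in> carrier A" and le: "nrm A x \<le> 1"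
  shows "nrm A (x [^] Suc n) \<le> 1"
proof (induction n)
  case 0
  then show ?case using assms by simp
next
  case (Suc n)
  have "nrm A (x [^] Suc (Suc n)) \<le> nrm A (x [^] Suc n) * nrm A x"
    using nrm_mult[of "x [^] Suc n" x] x by simp
  also have "\<dots> \<le> 1"
    using Suc le nrm_nonneg[OF x] by (intro mult_le_one) auto
  finally show ?case .
qed

lemma le_one_if_powers_le:
  fixes a :: real
  assumes "\<And>k. a ^ 2 ^ k \<le> C"
  shows "a \<le> 1"
proof (rule ccontr)
  assume "\<not> a \<le> 1"
  then obtain n where "C < a ^ n"
    using real_arch_pow[of a C] by auto
  also have "a ^ n \<le> a ^ 2 ^ n"
    using \<open>\<not> a \<le> 1\<close> by (intro power_increasing) (auto simp: less_imp_le)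
  finally show False
    using assms[of n] by simp
qed

lemma nrm_diff_projections_le:
  assumes "projection p" "projection q"
  shows "nrm A (p \<ominus> q) \<le> 1"
proof -
  have [simp]: "p \<in> carrier A" "q \<in> carrier A" "p \<otimes> p = p" "q \<otimes> q = q" "adj A p = p" "adj A q = q"
    using assms by (simp_all add: projection_def)
  define x y where "x = p \<otimes> ((\<one> \<ominus> q) \<otimes> p)" and "y = (\<one> \<ominus> p) \<otimes> (q \<otimes> (\<one> \<ominus> p))"
  have cl [simp]: "x \<in> carrier A" "y \<in> carrier A" "\<one> \<ominus> p \<in> carrier A" "\<one> \<ominus> q \<in> carrier A"
      "p \<ominus> q \<in> carrier A"
    by (simp_all add: x_def y_def a_minus_def)
  note xy = ring.square_diff_idempotents[OF ring_A, of p q, folded x_def y_def]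
  have le: "nrm A (a \<otimes> (b \<otimes> a)) \<le> 1" if "projection a" "projection b" for a b
  proof -
    have [simp]: "a \<in> carrier A" "b \<in> carrier A"
      using that by (simp_all add: projection_def)
    note nn = nrm_nonneg[of a] nrm_nonneg[of b] nrm_nonneg[of "b \<otimes> a"]
    have "nrm A (b \<otimes> a) \<le> 1"
      using nrm_mult[of b a] mult_le_one[OF nrm_projection_le[OF that(2)] _ nrm_projection_le[OF that(1)]]
        nn by simp
    then show ?thesis
      using nrm_mult[of a "b \<otimes> a"] mult_le_one[OF nrm_projection_le[OF that(1)], of "nrm A (b \<otimes> a)"]
        nn by simp
  qed
  have sa: "adj A (p \<ominus> q) = p \<ominus> q"
    by (simp add: a_minus_def adj_add adj_minus)
  \<comment> \<open>\<open>Suc k\<close>, because one squaring is spent on turning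
    \<open>p - q\<close> into the orthogonal sum \<open>x + y\<close>.\<close>
  have "nrm A (p \<ominus> q) ^ 2 ^ Suc k \<le> 2" for k
  proof -
    obtain n where *: "(2 :: nat) ^ k = Suc n"
      by (metis Suc_pred zero_less_numeral zero_less_power)
    have "nrm A (p \<ominus> q) ^ 2 ^ Suc k = nrm A ((p \<ominus> q) [^] (2 ^ Suc k :: nat))"
      by (rule nrm_pow_self_adjoint[symmetric]) (simp_all add: sa)
    also have "(p \<ominus> q) [^] (2 ^ Suc k :: nat) = ((p \<ominus> q) [^] (2 :: nat)) [^] (2 ^ k :: nat)"
      by (simp add: monoid.nat_pow_pow[OF ring.is_monoid[OF ring_A]])
    also have "(p \<ominus> q) [^] (2 :: nat) = x \<oplus> y"
      using xy by (simp add: numeral_2_eq_2)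
    also have "(x \<oplus> y) [^] (2 ^ k :: nat) = x [^] (2 ^ k :: nat) \<oplus> y [^] (2 ^ k :: nat)"
      using xy unfolding * by (intro ring.pow_sum_orthogonal[OF ring_A]) auto
    also have "nrm A \<dots> \<le> nrm A (x [^] (2 ^ k :: nat)) + nrm A (y [^] (2 ^ k :: nat))"
      by (intro nrm_triangle monoid.nat_pow_closed[OF ring.is_monoid[OF ring_A]]) auto
    also have "\<dots> \<le> 1 + 1"
      unfolding * x_def y_def
      by (intro add_mono nrm_pow_le_one le assms projection_complement)
        (simp_all add: assms projection_complement flip: x_def y_def)
    finally show ?thesis by simp
  qed
  then have "((nrm A (p \<ominus> q))\<^sup>2) ^ 2 ^ k \<le> 2" for k
    by (simp add: power_mult[symmetric])
  then have "(nrm A (p \<ominus> q))\<^sup>2 \<le> 1"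
    by (rule le_one_if_powers_le)
  then show ?thesis
    by (simp add: abs_le_square_iff power_le_one_iff nrm_nonneg)
qed

text \<open>Cancels a factor \<open>a + c\<close> with a scalar \<open>c\<close> of modulus at least
  two: there \<open>y\<close> is \<open>c x\<close>, and a contraction cannot map \<open>x\<close>
  to \<open>- y\<close> unless \<open>x\<close> vanishes.\<close>

lemma contraction_zero:
  assumes x: "a \<in> carrier A" "x \<in> carrier A" "y \<in> carrier A"
    and le: "nrm A a \<le> 1" and zero: "a \<otimes> x \<oplus> y = \<zero>" and ge: "2 * nrm A x \<le> nrm A y"
  shows "x = \<zero>"
proof -
  have "\<ominus> y = a \<otimes> x"
    using x zero by (intro abelian_group.minus_equality ring.is_abelian_group ring_A) auto
  then have "nrm A y = nrm A (a \<otimes> x)"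
    using nrm_minus[of y] x by simp
  also have "\<dots> \<le> nrm A a * nrm A x"
    by (intro nrm_mult x)
  also have "\<dots> \<le> nrm A x"
    using le nrm_nonneg[OF x(2)] mult_right_mono by fastforce
  finally have "nrm A x = 0"
    using ge nrm_nonneg[OF x(2)] by linarith
  then show ?thesis
    using x nrm_eq_0 by simp
qed

text \<open>The norm bounds come from \<open>s = (1 - r) - v\<close> and
  \<open>s - 1 = p - (1 - q)\<close>, both differences of projections. The hypotheses
  \<open>add2\<close>, \<open>sub2\<close>, \<open>sub4\<close> and \<open>add1\<close> then concern
  a contraction plus a scalar of modulus two or four.\<close>

lemma projections_orthogonal:
  assumes "projection p" "projection q" "projection r" "projection v"
    and sum: "p \<oplus> q \<oplus> r \<oplus> v = \<one>"
  shows "p \<otimes> q = \<zero>"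
proof -
  have [simp]: "p \<in> carrier A" "q \<in> carrier A" "r \<in> carrier A" "v \<in> carrier A"
    and idem: "p \<otimes> p = p" "q \<otimes> q = q" "r \<otimes> r = r" "v \<otimes> v = v"
    and sa [simp]: "adj A p = p" "adj A q = q" "adj A r = r" "adj A v = v"
    using assms by (simp_all add: projection_def)
  define s d e t where "s = p \<oplus> q" and "d = p \<ominus> q" and "e = r \<ominus> v" and "t = \<one> \<oplus> \<one>"
  note defs = s_def d_def e_def t_def
  note rs = a_minus_def ring.ring_simprules[OF ring_A]
  have [simp]: "s \<in> carrier A" "d \<in> carrier A" "e \<in> carrier A" "t \<in> carrier A"
    by (simp_all add: defs a_minus_def)
  have sa' [simp]: "adj A s = s" "adj A d = d" "adj A e = e"
    by (simp_all add: defs a_minus_def adj_add adj_minus)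
  have "s = (p \<oplus> q \<oplus> r \<oplus> v) \<ominus> (r \<oplus> v)"
    by (simp add: s_def rs)
  also have "\<dots> = (\<one> \<ominus> r) \<ominus> v"
    unfolding sum by (simp add: rs)
  finally have ns: "nrm A s \<le> 1"
    using assms by (simp add: nrm_diff_projections_le projection_complement)
  have "s \<ominus> \<one> = p \<ominus> (\<one> \<ominus> q)"
    by (simp add: s_def rs)
  then have ns1: "nrm A (s \<ominus> \<one>) \<le> 1"
    using assms by (simp add: nrm_diff_projections_le projection_complement)
  have n4: "nrm A ((x \<oplus> x) \<oplus> (x \<oplus> x)) = 4 * nrm A x" if "x \<in> carrier A" for x
    using that nrm_double[of "x \<oplus> x"] nrm_double[of x] by simp
  show ?thesis
  proof (rule ring.idempotents_orthogonal[OF ring_A _ _ _ _ idem sum s_def d_def e_def t_def])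
    fix x assume x [simp]: "x \<in> carrier A"
    note nn = nrm_nonneg[OF x]
    have xx: "nrm A (x \<oplus> x) = 2 * nrm A x"
      by (rule nrm_double[OF x])
    have xx': "nrm A (\<ominus> (x \<oplus> x)) = 2 * nrm A x"
      using xx by (subst nrm_minus) simp_all
    have x4: "nrm A (\<ominus> ((x \<oplus> x) \<oplus> (x \<oplus> x))) = 4 * nrm A x"
      using n4[OF x] by (subst nrm_minus) simp_all
    show "x = \<zero>" if "x \<oplus> x = \<zero>"
    proof -
      have "nrm A (x \<oplus> x) = 0"
        unfolding that using nrm_eq_0 by blast
      then have "nrm A x = 0"
        using xx by simp
      then show ?thesis
        using nrm_eq_0[OF x] by blast
    qed
    show "x = \<zero>" if 0: "(s \<oplus> t) \<otimes> x = \<zero>"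
    proof (rule contraction_zero[OF _ _ _ ns])
      have "s \<otimes> x \<oplus> (x \<oplus> x) = (s \<oplus> t) \<otimes> x"
        by (simp add: rs t_def)
      then show "s \<otimes> x \<oplus> (x \<oplus> x) = \<zero>"
        unfolding 0 .
    qed (simp_all add: xx)
    show "x = \<zero>" if 0: "(s \<ominus> t) \<otimes> x = \<zero>"
    proof (rule contraction_zero[OF _ _ _ ns])
      have "s \<otimes> x \<oplus> (\<ominus> (x \<oplus> x)) = (s \<ominus> t) \<otimes> x"
        by (simp add: rs t_def)
      then show "s \<otimes> x \<oplus> (\<ominus> (x \<oplus> x)) = \<zero>"
        unfolding 0 .
    qed (simp_all add: xx')
    show "x = \<zero>" if 0: "(s \<ominus> (t \<oplus> t)) \<otimes> x = \<zero>"
    proof (rule contraction_zero[OF _ _ _ ns])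
      have "s \<otimes> x \<oplus> (\<ominus> ((x \<oplus> x) \<oplus> (x \<oplus> x))) = (s \<ominus> (t \<oplus> t)) \<otimes> x"
        by (simp add: rs t_def)
      then show "s \<otimes> x \<oplus> (\<ominus> ((x \<oplus> x) \<oplus> (x \<oplus> x))) = \<zero>"
        unfolding 0 .
    qed (use nn in \<open>simp_all add: x4\<close>)
    \<comment> \<open>As \<open>s\<close> plus one the scalar would be too small for
      \<open>contraction_zero\<close>; as \<open>(s - 1) + 2\<close> it is not.\<close>
    show "x = \<zero>" if 0: "(s \<oplus> \<one>) \<otimes> x = \<zero>"
    proof (rule contraction_zero[OF _ _ _ ns1])
      have "(s \<ominus> \<one>) \<otimes> x \<oplus> (x \<oplus> x) = (s \<oplus> \<one>) \<otimes> x"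
        by (simp add: rs)
      then show "(s \<ominus> \<one>) \<otimes> x \<oplus> (x \<oplus> x) = \<zero>"
        unfolding 0 .
    qed (simp_all add: xx a_minus_def)
    show "x = \<zero>" if comm: "x \<otimes> s = (s \<oplus> (t \<oplus> t)) \<otimes> x"
    proof -
      \<comment> \<open>\<open>4 x\<close> is the commutator of \<open>x\<close> and
        \<open>s\<close>, whose norm is at most \<open>2 * nrm A x\<close>.\<close>
      have "(x \<oplus> x) \<oplus> (x \<oplus> x) = (s \<oplus> (t \<oplus> t)) \<otimes> x \<ominus> s \<otimes> x"
        by (simp add: rs t_def)
      also have "\<dots> = x \<otimes> s \<oplus> \<ominus> (s \<otimes> x)"
        by (simp add: comm a_minus_def)
      finally have "4 * nrm A x = nrm A (x \<otimes> s \<oplus> \<ominus> (s \<otimes> x))"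
        by (simp flip: n4)
      also have "\<dots> \<le> nrm A (x \<otimes> s) + nrm A (s \<otimes> x)"
        using nrm_triangle[of "x \<otimes> s" "\<ominus> (s \<otimes> x)"] by (simp add: nrm_minus)
      also have "\<dots> \<le> nrm A x * nrm A s + nrm A s * nrm A x"
        by (intro add_mono nrm_mult) auto
      also have "\<dots> \<le> 2 * nrm A x"
        using ns nn mult_right_mono[OF ns nn] by (simp add: mult.commute)
      finally show ?thesis
        using nn nrm_eq_0[OF x] by simp
    qed
  next
    assume "(\<one> \<ominus> s) \<otimes> (d \<otimes> e) = \<zero>"
    then have "adj A ((\<one> \<ominus> s) \<otimes> (d \<otimes> e)) = \<zero>"
      by (simp add: adj_zero)
    then show "e \<otimes> d \<otimes> (\<one> \<ominus> s) = \<zero>"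
      by (simp add: adj_mult a_minus_def adj_add adj_minus adj_one)
  qed simp_all
qed

lemma projection_range:
  assumes "x \<in> carrier A" "adj A x \<otimes> x = \<one>"
  shows "projection (x \<otimes> adj A x)"
proof -
  have "(x \<otimes> adj A x) \<otimes> (x \<otimes> adj A x) = x \<otimes> ((adj A x \<otimes> x) \<otimes> adj A x)"
    using assms(1) by (simp add: adj_closed monoid.m_assoc[OF ring.is_monoid[OF ring_A]])
  then show ?thesis
    using assms by (simp add: projection_def adj_closed adj_mult adj_adj)
qed

end

section \<open>Automorphisms and inner automorphisms\<close>

lemma star_homsD:
  assumes "f \<in> star_homs A B"
  shows "x \<in> carrier A \<Longrightarrow> f x \<in> carrier B"
    and "x \<in> carrier A \<Longrightarrow> y \<in> carrier A \<Longrightarrow> f (x \<otimes>\<^bsub>A\<^esub> y) = f x \<otimes>\<^bsub>B\<^esub> f y"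
    and "x \<in> carrier A \<Longrightarrow> y \<in> carrier A \<Longrightarrow> f (x \<oplus>\<^bsub>A\<^esub> y) = f x \<oplus>\<^bsub>B\<^esub> f y"
    and "f \<one>\<^bsub>A\<^esub> = \<one>\<^bsub>B\<^esub>"
    and "x \<in> carrier A \<Longrightarrow> f (c \<odot>\<^bsub>A\<^esub> x) = c \<odot>\<^bsub>B\<^esub> f x"
    and "x \<in> carrier A \<Longrightarrow> f (adj A x) = adj B (f x)"
    and "f \<in> extensional (carrier A)"
  using assms by (auto simp: star_homs_def ring_hom_def)

lemma star_homsI:
  assumes "\<And>x. x \<in> carrier A \<Longrightarrow> f x \<in> carrier B"
    and "\<And>x y. x \<in> carrier A \<Longrightarrow> y \<in> carrier A \<Longrightarrow> f (x \<otimes>\<^bsub>A\<^esub> y) = f x \<otimes>\<^bsub>B\<^esub> f y"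
    and "\<And>x y. x \<in> carrier A \<Longrightarrow> y \<in> carrier A \<Longrightarrow> f (x \<oplus>\<^bsub>A\<^esub> y) = f x \<oplus>\<^bsub>B\<^esub> f y"
    and "f \<one>\<^bsub>A\<^esub> = \<one>\<^bsub>B\<^esub>"
    and "\<And>x c. x \<in> carrier A \<Longrightarrow> f (c \<odot>\<^bsub>A\<^esub> x) = c \<odot>\<^bsub>B\<^esub> f x"
    and "\<And>x. x \<in> carrier A \<Longrightarrow> f (adj A x) = adj B (f x)"
    and "f \<in> extensional (carrier A)"
  shows "f \<in> star_homs A B"
  using assms by (simp add: star_homs_def ring_hom_def)

text \<open>\<open>cstar_algebra\<close> admits record extensions, whereas \<open>star_homs\<close>,
  \<open>unitaries\<close> and \<open>aut_group\<close> are stated for plain records; this locale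
  fixes the type accordingly.\<close>

locale plain_cstar_algebra = cstar_algebra A for A :: "'a cstar" (structure)
begin

lemmas A_assoc = monoid.m_assoc[OF ring.is_monoid[OF ring_A]]

lemma compose_star_homs:
  assumes f: "f \<in> star_homs A A" and g: "g \<in> star_homs A A"
  shows "compose (carrier A) f g \<in> star_homs A A"
  by (rule star_homsI)
    (simp_all add: compose_def star_homsD[OF f] star_homsD[OF g] adj_closed)

lemma id_star_homs: "(\<lambda>x\<in>carrier A. x) \<in> star_homs A A"
  by (rule star_homsI) (simp_all add: adj_closed)

lemma inverse_star_homs:
  assumes f: "f \<in> star_homs A A" and bij: "f \<in> Bij (carrier A)"
  shows "(\<lambda>x\<in>carrier A. inv_into (carrier A) f x) \<in> star_homs A A"
proof -
  let ?g = "\<lambda>x\<in>carrier A. inv_into (carrier A) f x"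
  have bb: "bij_betw f (carrier A) (carrier A)"
    using bij by (simp add: Bij_def)
  have cl: "?g x \<in> carrier A" if "x \<in> carrier A" for x
    using that bb by (simp add: bij_betw_def inv_into_into)
  have fg: "f (?g x) = x" if "x \<in> carrier A" for x
    using that bb by (simp add: bij_betw_inv_into_right)
  have eqI: "a = b" if "a \<in> carrier A" "b \<in> carrier A" "f a = f b" for a b
    using that bb by (auto simp: bij_betw_def inj_on_def)
  show ?thesis
  proof (rule star_homsI)
    fix x y assume xy: "x \<in> carrier A" "y \<in> carrier A"
    show "?g (x \<otimes> y) = ?g x \<otimes> ?g y"
      by (rule eqI) (use cl fg xy in \<open>simp_all del: restrict_apply restrict_apply' add: star_homsD[OF f]\<close>)
    show "?g (x \<oplus> y) = ?g x \<oplus> ?g y"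
      by (rule eqI) (use cl fg xy in \<open>simp_all del: restrict_apply restrict_apply' add: star_homsD[OF f]\<close>)
  next
    fix x and c :: complex assume xy: "x \<in> carrier A"
    show "?g (c \<odot> x) = c \<odot> ?g x"
      by (rule eqI) (use cl fg xy in \<open>simp_all del: restrict_apply restrict_apply' add: star_homsD[OF f]\<close>)
    show "?g (adj A x) = adj A (?g x)"
      by (rule eqI) (use cl fg xy in \<open>simp_all del: restrict_apply restrict_apply' add: star_homsD[OF f] adj_closed\<close>)
  next
    show "?g \<one> = \<one>"
      by (rule eqI) (use cl fg in \<open>simp_all del: restrict_apply restrict_apply' add: star_homsD[OF f]\<close>)
  qed (use cl in auto)
qed

lemma
  shows carrier_aut: "carrier (aut_group A) = Bij (carrier A) \<inter> star_homs A A"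
    and one_aut: "\<one>\<^bsub>aut_group A\<^esub> = (\<lambda>x\<in>carrier A. x)"
  by (simp_all add: aut_group_def BijGroup_def)

lemma mult_aut:
  "f \<in> Bij (carrier A) \<Longrightarrow> g \<in> Bij (carrier A) \<Longrightarrow> f \<otimes>\<^bsub>aut_group A\<^esub> g = compose (carrier A) f g"
  by (simp add: aut_group_def BijGroup_def)

lemma group_aut: "group (aut_group A)"
  unfolding aut_group_def
proof (rule subgroup.subgroup_is_group[OF _ group_BijGroup], rule group.subgroupI[OF group_BijGroup])
  show "Bij (carrier A) \<inter> star_homs A A \<noteq> {}"
    using id_Bij id_star_homs by blast
next
  fix f assume "f \<in> Bij (carrier A) \<inter> star_homs A A"
  then show "inv\<^bsub>BijGroup (carrier A)\<^esub> f \<in> Bij (carrier A) \<inter> star_homs A A"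
    using restrict_inv_into_Bij[of f] inverse_star_homs[of f] by (simp add: inv_BijGroup)
next
  fix f g assume "f \<in> Bij (carrier A) \<inter> star_homs A A" "g \<in> Bij (carrier A) \<inter> star_homs A A"
  then show "f \<otimes>\<^bsub>BijGroup (carrier A)\<^esub> g \<in> Bij (carrier A) \<inter> star_homs A A"
    using compose_Bij[of f] compose_star_homs[of f] by (simp add: BijGroup_def)
qed (simp add: BijGroup_def)

lemma bij_if_inverse:
  assumes f: "f \<in> star_homs A A" and g: "g \<in> star_homs A A"
    and fg: "compose (carrier A) f g = (\<lambda>x\<in>carrier A. x)"
    and gf: "compose (carrier A) g f = (\<lambda>x\<in>carrier A. x)"
  shows "f \<in> carrier (aut_group A)"
proof -
  have "f (g x) = x" "g (f x) = x" if "x \<in> carrier A" for x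
    using that fun_cong[OF fg, of x] fun_cong[OF gf, of x] by (simp_all add: compose_def)
  then have "bij_betw f (carrier A) (carrier A)"
    using star_homsD(1)[OF f] star_homsD(1)[OF g] by (intro bij_betw_byWitness[of _ g]) auto
  then show ?thesis
    using f by (simp add: carrier_aut Bij_def star_homsD(7))
qed

section \<open>Inner automorphisms and the projection to outer classes\<close>

definition conj_by :: "'a \<Rightarrow> 'a \<Rightarrow> 'a" where
  "conj_by z = (\<lambda>x\<in>carrier A. z \<otimes> x \<otimes> adj A z)"

lemma inner_auts_eq: "inner_auts A = conj_by ` unitaries A"
  by (simp add: inner_auts_def conj_by_def)

lemma unitariesD:
  assumes "z \<in> unitaries A"
  shows "z \<in> carrier A" "adj A z \<otimes> z = \<one>" "z \<otimes> adj A z = \<one>"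
    "x \<in> carrier A \<Longrightarrow> adj A z \<otimes> (z \<otimes> x) = x" "x \<in> carrier A \<Longrightarrow> z \<otimes> (adj A z \<otimes> x) = x"
  using assms by (simp_all add: unitaries_def adj_closed flip: A_assoc)

lemma adj_unitary: "z \<in> unitaries A \<Longrightarrow> adj A z \<in> unitaries A"
  by (simp add: unitaries_def adj_closed adj_adj)

lemma mult_unitary:
  assumes "z \<in> unitaries A" "w \<in> unitaries A"
  shows "z \<otimes> w \<in> unitaries A"
  using unitariesD[OF assms(1)] unitariesD[OF assms(2)]
  by (simp add: unitaries_def adj_mult adj_closed A_assoc)

lemma one_unitary: "\<one> \<in> unitaries A"
  by (simp add: unitaries_def adj_one)

lemma star_hom_unitary: "f \<in> star_homs A A \<Longrightarrow> z \<in> unitaries A \<Longrightarrow> f z \<in> unitaries A"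
  by (simp add: unitaries_def star_homsD adj_closed flip: star_homsD(2,6))

lemma conj_by_star_homs:
  assumes "z \<in> unitaries A"
  shows "conj_by z \<in> star_homs A A"
  using unitariesD[OF assms]
  by (intro star_homsI)
    (simp_all add: conj_by_def adj_closed adj_mult adj_adj A_assoc smult_mult_left smult_mult_right
      ring.ring_simprules(13,23)[OF ring_A])

lemma conj_by_compose:
  assumes "z \<in> unitaries A" "w \<in> unitaries A"
  shows "compose (carrier A) (conj_by z) (conj_by w) = conj_by (z \<otimes> w)"
  using unitariesD[OF assms(1)] unitariesD[OF assms(2)]
  by (auto simp: conj_by_def compose_def restrict_def fun_eq_iff adj_closed adj_mult A_assoc)

lemma conj_by_one: "conj_by \<one> = (\<lambda>x\<in>carrier A. x)"
  by (auto simp: conj_by_def adj_one restrict_def fun_eq_iff)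

lemma conj_by_aut:
  assumes "z \<in> unitaries A"
  shows "conj_by z \<in> carrier (aut_group A)"
  by (rule bij_if_inverse[of _ "conj_by (adj A z)"])
    (simp_all add: assms adj_unitary conj_by_star_homs conj_by_compose conj_by_one unitariesD[OF assms])

lemma subgroup_inner: "subgroup (inner_auts A) (aut_group A)"
proof (rule group.subgroupI[OF group_aut])
  show "inner_auts A \<subseteq> carrier (aut_group A)" "inner_auts A \<noteq> {}"
    using conj_by_aut one_unitary by (auto simp: inner_auts_eq)
next
  fix f g assume "f \<in> inner_auts A" "g \<in> inner_auts A"
  then show "f \<otimes>\<^bsub>aut_group A\<^esub> g \<in> inner_auts A"
    using conj_by_aut mult_unitary
    by (auto simp: inner_auts_eq mult_aut carrier_aut conj_by_compose)
next
  fix f assume "f \<in> inner_auts A"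
  then obtain z where z: "z \<in> unitaries A" "f = conj_by z"
    by (auto simp: inner_auts_eq)
  have "inv\<^bsub>aut_group A\<^esub> f = conj_by (adj A z)"
  proof (rule group.inv_equality[OF group_aut])
    have "conj_by (adj A z) \<in> Bij (carrier A)" "conj_by z \<in> Bij (carrier A)"
      using conj_by_aut z adj_unitary by (auto simp: carrier_aut)
    then show "conj_by (adj A z) \<otimes>\<^bsub>aut_group A\<^esub> f = \<one>\<^bsub>aut_group A\<^esub>"
      by (simp add: z mult_aut one_aut conj_by_compose adj_unitary unitariesD conj_by_one)
  qed (use z conj_by_aut adj_unitary in auto)
  then show "inv\<^bsub>aut_group A\<^esub> f \<in> inner_auts A"
    using z adj_unitary by (auto simp: inner_auts_eq)
qed

text \<open>Conjugating \<open>conj_by z\<close> by an automorphism \<open>f\<close> gives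
  \<open>conj_by (f z)\<close>.\<close>

lemma normal_inner: "inner_auts A \<lhd> aut_group A"
  unfolding group.normal_inv_iff[OF group_aut]
proof (intro conjI ballI subgroup_inner)
  fix f h assume f: "f \<in> carrier (aut_group A)" and "h \<in> inner_auts A"
  then obtain z where z: "z \<in> unitaries A" "h = conj_by z"
    by (auto simp: inner_auts_eq)
  interpret G: group "aut_group A" by (rule group_aut)
  have f': "f \<in> star_homs A A" "f \<in> Bij (carrier A)"
    using f by (auto simp: carrier_aut)
  have fz: "f z \<in> unitaries A"
    using f' z star_hom_unitary by blast
  have B: "conj_by z \<in> Bij (carrier A)" "conj_by (f z) \<in> Bij (carrier A)"
    using conj_by_aut z fz by (auto simp: carrier_aut)
  have "f \<otimes>\<^bsub>aut_group A\<^esub> h = conj_by (f z) \<otimes>\<^bsub>aut_group A\<^esub> f"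
    using unitariesD[OF z(1)] B f'
    by (auto simp: z mult_aut compose_def restrict_def fun_eq_iff conj_by_def star_homsD[OF f'(1)] adj_closed)
  then have "f \<otimes>\<^bsub>aut_group A\<^esub> h \<otimes>\<^bsub>aut_group A\<^esub> inv\<^bsub>aut_group A\<^esub> f = conj_by (f z)"
    using f conj_by_aut[OF fz] by (simp add: G.m_assoc)
  then show "f \<otimes>\<^bsub>aut_group A\<^esub> h \<otimes>\<^bsub>aut_group A\<^esub> inv\<^bsub>aut_group A\<^esub> f \<in> inner_auts A"
    using fz by (simp add: inner_auts_eq)
qed

lemma out_proj_hom: "out_proj A \<in> hom (aut_group A) (out_group A)"
proof -
  have "out_proj A = (\<lambda>f. inner_auts A #>\<^bsub>aut_group A\<^esub> f)"
    by (simp add: out_proj_def fun_eq_iff)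
  then show ?thesis
    using normal.r_coset_hom_Mod[OF normal_inner] by (simp add: out_group_def)
qed

lemma one_out: "\<one>\<^bsub>out_group A\<^esub> = inner_auts A"
  by (simp add: out_group_def FactGroup_def)

lemma out_proj_eqD:
  assumes "f \<in> carrier (aut_group A)" "g \<in> carrier (aut_group A)" "out_proj A f = out_proj A g"
  obtains z where "z \<in> unitaries A" "f = compose (carrier A) (conj_by z) g"
proof -
  interpret G: group "aut_group A" by (rule group_aut)
  have "f \<in> out_proj A g"
    using G.rcos_self[OF assms(1) subgroup_inner] assms(3) by (simp add: out_proj_def)
  then obtain z where z: "z \<in> unitaries A" "f = conj_by z \<otimes>\<^bsub>aut_group A\<^esub> g"
    by (auto simp: out_proj_def r_coset_def inner_auts_eq)
  then show ?thesis
    using that[OF z(1)] conj_by_aut[OF z(1)] assms(2) by (simp add: mult_aut carrier_aut)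
qed

end

section \<open>Permutative unitaries\<close>

lemma words_2E:
  assumes "\<alpha> \<in> words n 2"
  obtains a b where "\<alpha> = [a, b]" "a \<in> {1..n}" "b \<in> {1..n}"
  using assms by (auto simp: words_def length_Suc_conv numeral_2_eq_2)

lemma finite_words: "finite (words n t)"
  using finite_lists_length_eq[of "{1..n}" t] by (simp add: words_def conj_commute)

lemma (in ring) semiring_R: "semiring R"
  by (rule semiring_axioms)

locale cuntz_four = plain_cstar_algebra A for A :: "'a cstar" (structure) +
  fixes S :: "nat \<Rightarrow> 'a"
  assumes fam: "cuntz_family 4 A S"
begin

lemma
  assumes "i \<in> {1..4}"
  shows S_closed: "S i \<in> carrier A" and S_isometry: "adj A (S i) \<otimes> S i = \<one>"
  using assms fam by (simp_all add: cuntz_family_def)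

lemma S_orthogonal:
  assumes ij: "i \<in> {1..4}" "j \<in> {1..4}" "i \<noteq> j"
  shows "adj A (S i) \<otimes> S j = \<zero>"
proof -
  note D = S_closed S_isometry
  have "card ({1..4} - {i, j}) = 2"
    using ij by (subst card_Diff_subset) auto
  then obtain h k where hk: "{1..4} - {i, j} = {h, k}" "h \<noteq> k"
    by (auto simp: card_2_iff)
  then have all: "{1..4} = insert i (insert j (insert h {k}))"
    and dist: "h \<notin> {i, j}" "k \<notin> {i, j}"
    using ij by blast+
  have in4: "h \<in> {1..4}" "k \<in> {1..4}"
    unfolding all by auto
  let ?p = "\<lambda>i. S i \<otimes> adj A (S i)"
  have proj: "projection (?p l)" if "l \<in> {1..4}" for l
    using D(1,2)[OF that] by (intro projection_range)
  then have cl: "?p l \<in> carrier A" if "l \<in> {1..4}" for l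
    using that by (simp add: projection_def)
  have AM: "abelian_monoid A"
    by (intro abelian_group.axioms ring.is_abelian_group ring_A)
  have "\<one> = (\<Oplus>l\<in>{1..4}. ?p l)"
    using fam by (simp add: cuntz_family_def)
  also have "\<dots> = ?p i \<oplus> (?p j \<oplus> (?p h \<oplus> ?p k))"
    unfolding all using ij hk(2) dist cl in4 by (simp add: abelian_monoid.finsum_insert[OF AM])
  also have "\<dots> = ?p i \<oplus> ?p j \<oplus> ?p h \<oplus> ?p k"
    using ij in4 cl by (simp add: abelian_monoid.a_assoc[OF AM])
  finally have 0: "?p i \<otimes> ?p j = \<zero>"
    using ij in4 by (intro projections_orthogonal[of _ _ "?p h" "?p k"] proj) auto
  note cl = D(1)[OF ij(1)] D(1)[OF ij(2)] adj_closed[OF D(1)[OF ij(1)]] adj_closed[OF D(1)[OF ij(2)]]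
  \<comment> \<open>Padding with two copies of \<open>\<one>\<close>, written as
    \<open>adj A (S i) \<otimes> S i\<close> and \<open>adj A (S j) \<otimes> S j\<close>, brings
    the two range projections together in the middle.\<close>
  have "adj A (S i) \<otimes> S j = (adj A (S i) \<otimes> S i) \<otimes> adj A (S i) \<otimes> (S j \<otimes> (adj A (S j) \<otimes> S j))"
    using cl D(2) ij by simp
  also have "\<dots> = adj A (S i) \<otimes> (?p i \<otimes> ?p j) \<otimes> S j"
    using cl by (simp add: monoid.m_assoc[OF ring.is_monoid[OF ring_A]])
  also have "\<dots> = \<zero>"
    unfolding 0 using cl by (simp add: ring.ring_simprules[OF ring_A])
  finally show ?thesis .
qed


lemma S_resolution:
  assumes "x \<in> carrier A"
  shows "x = (\<Oplus>i\<in>{1..4}. (x \<otimes> S i) \<otimes> adj A (S i))"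
proof -
  have "x = x \<otimes> (\<Oplus>i\<in>{1..4}. S i \<otimes> adj A (S i))"
    using fam assms by (simp add: cuntz_family_def)
  also have "\<dots> = (\<Oplus>i\<in>{1..4}. x \<otimes> (S i \<otimes> adj A (S i)))"
    using assms S_closed by (intro semiring.finsum_rdistr ring.semiring_R ring_A) (auto simp: adj_closed)
  also have "\<dots> = (\<Oplus>i\<in>{1..4}. (x \<otimes> S i) \<otimes> adj A (S i))"
    using assms S_closed
    by (intro abelian_monoid.finsum_cong' abelian_group.axioms ring.is_abelian_group ring_A)
      (auto simp: adj_closed A_assoc)
  finally show ?thesis .
qed

text \<open>The range projections sum to \<open>\<one>\<close>, so products with the generators
  determine an element. Identities between permutation unitaries are thereby checked word by word
  instead of through sums.\<close>

lemma eq_if_eq_on_S: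
  assumes "x \<in> carrier A" "y \<in> carrier A" "\<And>i. i \<in> {1..4} \<Longrightarrow> x \<otimes> S i = y \<otimes> S i"
  shows "x = y"
proof -
  have "x = (\<Oplus>i\<in>{1..4}. (x \<otimes> S i) \<otimes> adj A (S i))"
    by (rule S_resolution[OF assms(1)])
  also have "\<dots> = (\<Oplus>i\<in>{1..4}. (y \<otimes> S i) \<otimes> adj A (S i))"
    using assms S_closed
    by (intro abelian_monoid.finsum_cong' abelian_group.axioms ring.is_abelian_group ring_A)
      (auto simp: adj_closed)
  also have "\<dots> = y"
    by (rule S_resolution[OF assms(2), symmetric])
  finally show ?thesis .
qed

section \<open>Words of length two and permutation unitaries\<close>

abbreviation W :: "nat list \<Rightarrow> 'a" where "W \<equiv> S_word A S"

lemma W_pair: "a \<in> {1..4} \<Longrightarrow> b \<in> {1..4} \<Longrightarrow> W [a, b] = S a \<otimes> S b"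
  using S_closed by (simp add: S_word_def)

lemma W_closed: "\<alpha> \<in> words 4 2 \<Longrightarrow> W \<alpha> \<in> carrier A"
  using S_closed by (auto elim!: words_2E simp: W_pair simp del: atLeastAtMost_iff)

lemma W_adj_W:
  assumes "\<alpha> \<in> words 4 2" "\<beta> \<in> words 4 2"
  shows "adj A (W \<alpha>) \<otimes> W \<beta> = (if \<alpha> = \<beta> then \<one> else \<zero>)"
proof -
  obtain a b c d where ab: "\<alpha> = [a, b]" "a \<in> {1..4}" "b \<in> {1..4}"
    and cd: "\<beta> = [c, d]" "c \<in> {1..4}" "d \<in> {1..4}"
    using assms by (elim words_2E)
  note cl = S_closed[OF ab(2)] S_closed[OF ab(3)] S_closed[OF cd(2)] S_closed[OF cd(3)]
  have "adj A (W \<alpha>) \<otimes> W \<beta> = adj A (S b) \<otimes> ((adj A (S a) \<otimes> S c) \<otimes> S d)"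
    using ab cd cl by (simp add: W_pair adj_mult adj_closed A_assoc)
  also have "\<dots> = (if \<alpha> = \<beta> then \<one> else \<zero>)"
  proof (cases "a = c")
    case True
    then show ?thesis
      using ab cd cl S_isometry[OF ab(2)] S_isometry[OF ab(3)] S_orthogonal[OF ab(3) cd(3)]
      by auto
  next
    case False
    then show ?thesis
      using ab cd cl S_orthogonal[OF ab(2) cd(2)]
      by (simp add: adj_closed ring.ring_simprules[OF ring_A])
  qed
  finally show ?thesis .
qed

lemma eq_if_eq_on_words:
  assumes x: "x \<in> carrier A" "y \<in> carrier A" and eq: "\<And>\<alpha>. \<alpha> \<in> words 4 2 \<Longrightarrow> x \<otimes> W \<alpha> = y \<otimes> W \<alpha>"
  shows "x = y"
proof (rule eq_if_eq_on_S[OF x])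
  fix i :: nat assume i: "i \<in> {1..4}"
  show "x \<otimes> S i = y \<otimes> S i"
  proof (rule eq_if_eq_on_S)
    fix j :: nat assume j: "j \<in> {1..4}"
    have "[i, j] \<in> words 4 2"
      using i j by (simp add: words_def)
    then show "x \<otimes> S i \<otimes> S j = y \<otimes> S i \<otimes> S j"
      using eq[of "[i, j]"] W_pair[OF i j] x S_closed[OF i] S_closed[OF j] by (simp add: A_assoc)
  qed (use x S_closed[OF i] in auto)
qed

lemma eq_if_eq_on_words_left:
  assumes x: "x \<in> carrier A" "y \<in> carrier A"
    and eq: "\<And>\<alpha>. \<alpha> \<in> words 4 2 \<Longrightarrow> adj A (W \<alpha>) \<otimes> x = adj A (W \<alpha>) \<otimes> y"
  shows "x = y"
proof -
  have "adj A x = adj A y"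
  proof (rule eq_if_eq_on_words)
    fix \<alpha> assume \<alpha>: "\<alpha> \<in> words 4 2"
    have "adj A (adj A (W \<alpha>) \<otimes> x) = adj A (adj A (W \<alpha>) \<otimes> y)"
      using eq[OF \<alpha>] by simp
    then show "adj A x \<otimes> W \<alpha> = adj A y \<otimes> W \<alpha>"
      using x W_closed[OF \<alpha>] by (simp add: adj_mult adj_adj adj_closed)
  qed (use x in \<open>auto simp: adj_closed\<close>)
  then show ?thesis
    using x by (metis adj_adj)
qed

abbreviation U :: "(nat list \<Rightarrow> nat list) \<Rightarrow> 'a" where "U \<equiv> perm_unitary 4 2 A S"

lemma U_closed: "u permutes words 4 2 \<Longrightarrow> U u \<in> carrier A"
  unfolding perm_unitary_def
  by (intro abelian_monoid.finsum_closed abelian_group.axioms ring.is_abelian_group ring_A)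
    (auto simp: W_closed adj_closed permutes_in_image)

lemma U_W:
  assumes u: "u permutes words 4 2" and \<beta>: "\<beta> \<in> words 4 2"
  shows "U u \<otimes> W \<beta> = W (u \<beta>)"
proof -
  have u\<alpha>: "W (u \<alpha>) \<in> carrier A" if "\<alpha> \<in> words 4 2" for \<alpha>
    using that u by (simp add: W_closed permutes_in_image)
  have "U u \<otimes> W \<beta> = (\<Oplus>\<alpha>\<in>words 4 2. W (u \<alpha>) \<otimes> adj A (W \<alpha>) \<otimes> W \<beta>)"
    unfolding perm_unitary_def
    by (intro semiring.finsum_ldistr ring.semiring_R ring_A finite_words)
      (auto simp: W_closed adj_closed u\<alpha> \<beta>)
  also have "\<dots> = (\<Oplus>\<alpha>\<in>words 4 2. if \<beta> = \<alpha> then W (u \<alpha>) else \<zero>)"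
    by (intro abelian_monoid.finsum_cong' abelian_group.axioms ring.is_abelian_group ring_A)
      (auto simp: W_closed adj_closed u\<alpha> \<beta> A_assoc W_adj_W ring.ring_simprules[OF ring_A])
  also have "\<dots> = W (u \<beta>)"
    using \<beta> by (intro abelian_monoid.finsum_singleton abelian_group.axioms ring.is_abelian_group ring_A finite_words)
      (auto simp: u\<alpha>)
  finally show ?thesis .
qed

lemma U_compose:
  assumes "u permutes words 4 2" "v permutes words 4 2"
  shows "U u \<otimes> U v = U (u \<circ> v)"
  by (rule eq_if_eq_on_words)
    (simp_all add: assms U_closed U_W W_closed A_assoc permutes_compose permutes_in_image)

lemma U_id: "U id = \<one>"
  by (rule eq_if_eq_on_words) (simp_all add: U_closed U_W W_closed permutes_id)

text \<open>Tested between two words, the isometry property is the orthonormality of the elements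
  \<open>W \<alpha>\<close> together with injectivity of \<open>u\<close>. The right inverse given
  by the inverse permutation must then be the adjoint.\<close>

lemma U_unitary:
  assumes u: "u permutes words 4 2"
  shows "U u \<in> unitaries A"
proof -
  note cl = U_closed[OF u] U_closed[OF permutes_inv[OF u]]
  have 1: "adj A (U u) \<otimes> U u = \<one>"
  proof (rule eq_if_eq_on_words, goal_cases)
    case (3 \<beta>)
    show ?case
    proof (rule eq_if_eq_on_words_left, goal_cases)
      case (3 \<alpha>)
      have "adj A (W \<alpha>) \<otimes> (adj A (U u) \<otimes> U u \<otimes> W \<beta>) = adj A (U u \<otimes> W \<alpha>) \<otimes> (U u \<otimes> W \<beta>)"
        using 3 \<open>\<beta> \<in> words 4 2\<close> cl by (simp add: W_closed adj_mult adj_closed A_assoc)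
      also have "\<dots> = adj A (W \<alpha>) \<otimes> W \<beta>"
        using 3 \<open>\<beta> \<in> words 4 2\<close> u permutes_inj[OF u]
        by (auto simp: U_W W_adj_W permutes_in_image inj_eq)
      finally show ?case
        using 3 \<open>\<beta> \<in> words 4 2\<close> by (simp add: W_closed)
    qed (use cl 3 in \<open>auto simp: W_closed adj_closed\<close>)
  qed (use cl in \<open>auto simp: adj_closed\<close>)
  have 2: "U u \<otimes> U (inv_into UNIV u) = \<one>"
    by (simp add: U_compose permutes_inv[OF u] u permutes_inv_o[OF u] U_id)
  have "adj A (U u) = (adj A (U u) \<otimes> U u) \<otimes> U (inv_into UNIV u)"
    using cl 2 by (simp add: A_assoc adj_closed)
  then have "adj A (U u) = U (inv_into UNIV u)"
    using 1 cl by simp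
  then show ?thesis
    using 1 2 cl by (simp add: unitaries_def)
qed

lemma U_S_S:
  assumes "u permutes words 4 2" "c \<in> {1..4}" "b \<in> {1..4}" "u [c, b] = [a', b']"
  shows "U u \<otimes> S c \<otimes> S b = S a' \<otimes> S b'"
proof -
  have "[c, b] \<in> words 4 2"
    using assms by (simp add: words_def)
  moreover from this have "[a', b'] \<in> words 4 2"
    using assms by (metis permutes_in_image)
  then have "a' \<in> {1..4}" "b' \<in> {1..4}"
    by (auto simp: words_def)
  ultimately show ?thesis
    using U_W[OF assms(1), of "[c, b]"] assms S_closed U_closed[OF assms(1)] by (simp add: W_pair A_assoc del: atLeastAtMost_iff)
qed

end

section \<open>Permutative representations\<close>

lemma
  fixes \<xi> :: ell2
  assumes f: "inj f"
  shows summable_pull: "(\<lambda>x. (cmod (coord \<xi> (f x)))\<^sup>2) summable_on UNIV"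
    and infsum_pull: "(\<Sum>\<^sub>\<infinity>x. (cmod (coord \<xi> (f x)))\<^sup>2) \<le> (norm \<xi>)\<^sup>2"
proof -
  have "(\<lambda>y. (cmod (coord \<xi> y))\<^sup>2) summable_on range f"
    by (rule summable_on_subset_banach[OF summable_coord]) simp
  then show "(\<lambda>x. (cmod (coord \<xi> (f x)))\<^sup>2) summable_on UNIV"
    using summable_on_reindex[OF f, of "\<lambda>y. (cmod (coord \<xi> y))\<^sup>2"] by (simp add: o_def)
  have "(\<Sum>\<^sub>\<infinity>x. (cmod (coord \<xi> (f x)))\<^sup>2) = (\<Sum>\<^sub>\<infinity>y\<in>range f. (cmod (coord \<xi> y))\<^sup>2)"
    using infsum_reindex[OF f, of "\<lambda>y. (cmod (coord \<xi> y))\<^sup>2"] by (simp add: o_def)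
  also have "\<dots> \<le> (norm \<xi>)\<^sup>2"
    unfolding norm_ell2_sq
    by (rule infsum_mono_neutral)
      (auto intro: summable_coord summable_on_subset_banach[OF summable_coord])
  finally show "(\<Sum>\<^sub>\<infinity>x. (cmod (coord \<xi> (f x)))\<^sup>2) \<le> (norm \<xi>)\<^sup>2" .
qed

definition push_fun :: "(nat \<Rightarrow> nat) \<Rightarrow> (nat \<Rightarrow> complex) \<Rightarrow> nat \<Rightarrow> complex" where
  "push_fun f g y = (if y \<in> range f then g (inv_into UNIV f y) else 0)"

lemma
  fixes g :: "nat \<Rightarrow> complex"
  assumes f: "inj f" and g: "(\<lambda>x. (cmod (g x))\<^sup>2) summable_on UNIV"
  shows summable_push: "(\<lambda>y. (cmod (push_fun f g y))\<^sup>2) summable_on UNIV"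
    and infsum_push: "(\<Sum>\<^sub>\<infinity>y. (cmod (push_fun f g y))\<^sup>2) = (\<Sum>\<^sub>\<infinity>x. (cmod (g x))\<^sup>2)"
proof -
  have eq: "(\<lambda>x. (cmod (g x))\<^sup>2) = (\<lambda>y. (cmod (push_fun f g y))\<^sup>2) \<circ> f"
    using f by (auto simp: fun_eq_iff push_fun_def)
  have "(\<lambda>y. (cmod (push_fun f g y))\<^sup>2) summable_on range f"
    using g unfolding eq by (simp add: summable_on_reindex[OF f])
  also have "?this \<longleftrightarrow> (\<lambda>y. (cmod (push_fun f g y))\<^sup>2) summable_on UNIV"
    by (rule summable_on_cong_neutral) (auto simp: push_fun_def)
  finally show "(\<lambda>y. (cmod (push_fun f g y))\<^sup>2) summable_on UNIV" .
  have "(\<Sum>\<^sub>\<infinity>y. (cmod (push_fun f g y))\<^sup>2) = (\<Sum>\<^sub>\<infinity>y\<in>range f. (cmod (push_fun f g y))\<^sup>2)"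
    by (rule infsum_cong_neutral) (auto simp: push_fun_def)
  also have "\<dots> = (\<Sum>\<^sub>\<infinity>x. (cmod (g x))\<^sup>2)"
    unfolding eq by (rule infsum_reindex[OF f])
  finally show "(\<Sum>\<^sub>\<infinity>y. (cmod (push_fun f g y))\<^sup>2) = (\<Sum>\<^sub>\<infinity>x. (cmod (g x))\<^sup>2)" .
qed

definition push_op :: "(nat \<Rightarrow> nat) \<Rightarrow> ell2 \<Rightarrow>\<^sub>L ell2" where
  "push_op f = Blinfun (\<lambda>\<xi>. ell2_of (push_fun f (coord \<xi>)))"

definition pull_op :: "(nat \<Rightarrow> nat) \<Rightarrow> ell2 \<Rightarrow>\<^sub>L ell2" where
  "pull_op f = Blinfun (\<lambda>\<xi>. ell2_of (\<lambda>x. coord \<xi> (f x)))"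

lemma bounded_linear_ell2I:
  assumes "\<And>x y. \<phi> (x + y) = \<phi> x + \<phi> y" "\<And>r x. \<phi> (r *\<^sub>R x) = r *\<^sub>R \<phi> x"
    and "\<And>x. (norm (\<phi> x))\<^sup>2 \<le> (norm x)\<^sup>2"
  shows "bounded_linear (\<phi> :: ell2 \<Rightarrow> ell2)"
proof (rule bounded_linear_intro[where K = 1])
  show "norm (\<phi> x) \<le> norm x * 1" for x
    using power2_le_imp_le[OF assms(3)] by simp
qed (use assms in auto)

lemma coord_push_op:
  assumes f: "inj f"
  shows "coord (push_op f \<xi>) = push_fun f (coord \<xi>)"
proof -
  have c: "coord (ell2_of (push_fun f (coord \<xi>))) = push_fun f (coord \<xi>)" for \<xi>
    by (rule coord_ell2_of[OF summable_push[OF f summable_coord]])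
  have "bounded_linear (\<lambda>\<xi>. ell2_of (push_fun f (coord \<xi>)))"
  proof (rule bounded_linear_ell2I)
    fix x y r
    show "ell2_of (push_fun f (coord (x + y))) = ell2_of (push_fun f (coord x)) + ell2_of (push_fun f (coord y))"
      by (rule ell2_eqI) (simp only: c coord_plus[of "ell2_of _"], simp add: push_fun_def)
    show "ell2_of (push_fun f (coord (r *\<^sub>R x))) = r *\<^sub>R ell2_of (push_fun f (coord x))"
      by (rule ell2_eqI) (simp only: c coord_scaleR[of _ "ell2_of _"], simp add: push_fun_def)
    show "(norm (ell2_of (push_fun f (coord x))))\<^sup>2 \<le> (norm x)\<^sup>2"
      by (simp add: norm_ell2_sq c infsum_push[OF f summable_coord])
  qed
  then show ?thesis
    by (simp add: push_op_def bounded_linear_Blinfun_apply c)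
qed

lemma coord_pull_op:
  assumes f: "inj f"
  shows "coord (pull_op f \<xi>) = (\<lambda>x. coord \<xi> (f x))"
proof -
  have "bounded_linear (\<lambda>\<xi>. ell2_of (\<lambda>x. coord \<xi> (f x)))"
  proof (rule bounded_linear_ell2I)
    fix x y r
    show "ell2_of (\<lambda>n. coord (x + y) (f n)) = ell2_of (\<lambda>n. coord x (f n)) + ell2_of (\<lambda>n. coord y (f n))"
      using summable_pull[OF f, of x] summable_pull[OF f, of y] summable_pull[OF f, of "x + y"]
      by (intro ell2_eqI) simp
    show "ell2_of (\<lambda>n. coord (r *\<^sub>R x) (f n)) = r *\<^sub>R ell2_of (\<lambda>n. coord x (f n))"
      using summable_pull[OF f, of x] summable_pull[OF f, of "r *\<^sub>R x"]
      by (intro ell2_eqI) simp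
    show "(norm (ell2_of (\<lambda>n. coord x (f n))))\<^sup>2 \<le> (norm x)\<^sup>2"
      using summable_pull[OF f, of x] infsum_pull[OF f, of x] by (simp add: norm_ell2_sq[of "ell2_of _"])
  qed
  then show ?thesis
    using summable_pull[OF f] by (simp add: pull_op_def bounded_linear_Blinfun_apply)
qed

lemma adjoint_push_pull:
  assumes f: "inj f"
  shows "adjoint_to (push_op f) (pull_op f)"
  unfolding adjoint_to_def
proof (intro allI)
  fix \<xi> \<zeta>
  have "inner (push_op f \<xi>) \<zeta> = (\<Sum>\<^sub>\<infinity>y\<in>range f. inner (push_fun f (coord \<xi>) y) (coord \<zeta> y))"
    unfolding inner_ell2_def coord_push_op[OF f]
    by (rule infsum_cong_neutral) (auto simp: push_fun_def)
  also have "\<dots> = (\<Sum>\<^sub>\<infinity>x. inner (push_fun f (coord \<xi>) (f x)) (coord \<zeta> (f x)))"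
    using infsum_reindex[OF f] by (simp add: o_def)
  also have "\<dots> = inner \<xi> (pull_op f \<zeta>)"
    using f by (simp add: inner_ell2_def coord_pull_op push_fun_def)
  finally show "inner (push_op f \<xi>) \<zeta> = inner \<xi> (pull_op f \<zeta>)" .
qed

lemma
  assumes f: "inj f"
  shows push_clinear: "push_op f \<in> clinear_ops" and op_adj_push: "op_adj (push_op f) = pull_op f"
    and pull_clinear: "pull_op f \<in> clinear_ops"
proof -
  show push: "push_op f \<in> clinear_ops"
    by (rule adjoint_to_clinear(1)[OF _ adjoint_push_pull[OF f]], rule ell2_eqI)
      (simp add: coord_push_op[OF f] push_fun_def)
  show adj: "op_adj (push_op f) = pull_op f"
    by (rule op_adj_eqI[OF adjoint_push_pull[OF f]])
  show "pull_op f \<in> clinear_ops"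
    using op_adj_clinear[OF push] by (simp add: adj)
qed

section \<open>Basis vectors and fixed vectors\<close>

definition ket :: "nat \<Rightarrow> ell2" where
  "ket n = ell2_of (\<lambda>m. if m = n then 1 else 0)"

lemma coord_ket [simp]: "coord (ket n) = (\<lambda>m. if m = n then 1 else 0)"
proof -
  have "(\<lambda>m. (cmod (if m = n then 1 else 0))\<^sup>2) summable_on {n}"
    by simp
  also have "?this \<longleftrightarrow> (\<lambda>m. (cmod (if m = n then 1 else 0))\<^sup>2) summable_on UNIV"
    by (rule summable_on_cong_neutral) auto
  finally show ?thesis
    by (simp add: ket_def)
qed

lemma push_ket:
  assumes "inj f"
  shows "push_op f (ket n) = ket (f n)"
  using assms by (intro ell2_eqI) (auto simp: coord_push_op push_fun_def inj_eq)

lemma inner_cscale_ket: "inner \<xi> (cscale c (ket n)) = inner (coord \<xi> n) c"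
  by (subst inner_ell2_indicator[of n]) auto

text \<open>As \<open>T\<close> raises indices, its adjoint maps the basis vector \<open>n\<close>
  to a vector supported strictly below \<open>n\<close>, where the coordinates of
  \<open>\<eta>\<close> vanish by induction. So \<open>\<eta>\<close>, which equals
  \<open>T \<eta>\<close>, is orthogonal to that basis vector.\<close>

lemma no_fixed_vector:
  assumes T: "T \<in> clinear_ops" "\<And>n. T (ket n) = ket (g n)" and g: "\<And>n. n < g n"
    and fixed: "T \<eta> = \<eta>"
  shows "\<eta> = 0"
proof -
  note adj = adjoint_to_op_adj[OF T(1), unfolded adjoint_to_def, rule_format]
  have "coord \<eta> n = 0" for n
  proof (induction n rule: less_induct)
    case (less n)
    \<comment> \<open>Scaled by the coordinate itself: the real inner product with
      \<open>\<eta>\<close> is then the full squared modulus, not just a real part. The same device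
      is used for \<open>?v\<close>.\<close>
    let ?w = "cscale (coord \<eta> n) (ket n)"
    have "coord (op_adj T ?w) m = 0" if "m \<ge> n" for m
    proof -
      let ?v = "cscale (coord (op_adj T ?w) m) (ket m)"
      have "inner (op_adj T ?w) ?v = inner (T ?v) ?w"
        by (subst adj) (rule inner_commute)
      also have "\<dots> = 0"
        using that g[of m] by (simp add: clinear_opsD[OF T(1)] T(2) inner_cscale_ket)
      finally show ?thesis
        by (simp add: inner_cscale_ket)
    qed
    then have "inner (coord \<eta> m) (coord (op_adj T ?w) m) = 0" for m
      using less by (cases "m \<ge> n") auto
    then have "inner \<eta> (op_adj T ?w) = 0"
      unfolding inner_ell2_def by simp
    then have "inner \<eta> ?w = 0"
      using adj[of \<eta> ?w] by (simp add: fixed)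
    then show ?case
      by (simp add: inner_cscale_ket)
  qed
  then show ?thesis
    by (intro ell2_eqI) simp
qed

text \<open>A branching function system: four injections whose ranges partition the natural numbers,
  so that the induced isometries satisfy the Cuntz relations.\<close>

definition branching :: "(nat \<Rightarrow> nat \<Rightarrow> nat) \<Rightarrow> bool" where
  "branching F \<longleftrightarrow> (\<forall>c\<in>{1..4}. inj (F c)) \<and> (\<forall>y. \<exists>!c. c \<in> {1..4} \<and> y \<in> range (F c))"

lemma cuntz_family_branching:
  assumes F: "branching F"
  shows "cuntz_family 4 bounded_ops (\<lambda>c. encode_op (push_op (F c)))"
  unfolding cuntz_family_def
proof (intro conjI ballI)
  interpret ring bounded_ops by (rule ring_bounded_ops)
  note [simp] = bounded_ops_simps clinear_intros
  have inj: "inj (F c)" if "c \<in> {1..4}" for c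
    using F that by (simp add: branching_def)
  have clin: "push_op (F c) \<in> clinear_ops" "pull_op (F c) \<in> clinear_ops" if "c \<in> {1..4}" for c
    using inj[OF that] by (simp_all add: push_clinear pull_clinear)
  {
    fix c :: nat assume c: "c \<in> {1..4}"
    show "encode_op (push_op (F c)) \<in> carrier bounded_ops"
      using clin c by simp
    have "pull_op (F c) o\<^sub>L push_op (F c) = id_blinfun"
      using inj[OF c] by (intro blinfun_eqI ell2_eqI) (simp add: coord_pull_op coord_push_op push_fun_def)
    then show "adj bounded_ops (encode_op (push_op (F c))) \<otimes>\<^bsub>bounded_ops\<^esub> encode_op (push_op (F c)) =
        \<one>\<^bsub>bounded_ops\<^esub>"
      using clin[OF c] inj[OF c] by (simp add: op_adj_push)
  }
  let ?P = "\<lambda>c. push_op (F c) o\<^sub>L pull_op (F c)"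
  have P: "encode_op (push_op (F c)) \<otimes>\<^bsub>bounded_ops\<^esub> adj bounded_ops (encode_op (push_op (F c))) = encode_op (?P c)"
    and Pc: "encode_op (?P c) \<in> carrier bounded_ops" if "c \<in> {1..4}" for c
    using clin[OF that] inj[OF that] by (simp_all add: op_adj_push)
  have P_apply: "coord (?P c \<xi>) y = (if y \<in> range (F c) then coord \<xi> y else 0)" if "c \<in> {1..4}" for c \<xi> y
    using inj[OF that] by (auto simp: coord_pull_op coord_push_op push_fun_def)
  have "(\<Oplus>\<^bsub>bounded_ops\<^esub>c\<in>{1..4}. encode_op (push_op (F c)) \<otimes>\<^bsub>bounded_ops\<^esub> adj bounded_ops (encode_op (push_op (F c)))) =
      (\<Oplus>\<^bsub>bounded_ops\<^esub>c\<in>{1, 2, 3, 4}. encode_op (?P c))"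
    using P Pc by (intro finsum_cong') auto
  also have "\<dots> = encode_op (?P 1 + (?P 2 + (?P 3 + ?P 4)))"
    using Pc clin by (simp add: finsum_insert)
  also have "?P 1 + (?P 2 + (?P 3 + ?P 4)) = id_blinfun"
  proof (intro blinfun_eqI ell2_eqI)
    fix \<xi> y
    obtain c where c: "c \<in> {1..4}" "y \<in> range (F c)" and
      uniq: "\<And>d. d \<in> {1..4} \<Longrightarrow> y \<in> range (F d) \<Longrightarrow> d = c"
      using F unfolding branching_def by metis
    have P_c: "coord (?P d \<xi>) y = (if d = c then coord \<xi> y else 0)" if "d \<in> {1..4}" for d
    proof -
      have "y \<in> range (F d) \<longleftrightarrow> d = c"
        using c(2) uniq[OF that] by blast
      then show ?thesis
        unfolding P_apply[OF that] by simp
    qed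
    have "coord ((?P 1 + (?P 2 + (?P 3 + ?P 4))) \<xi>) y =
        coord (?P 1 \<xi>) y + (coord (?P 2 \<xi>) y + (coord (?P 3 \<xi>) y + coord (?P 4 \<xi>) y))"
      by (simp add: blinfun.add_left del: blinfun_apply_blinfun_compose)
    also have "\<dots> = coord \<xi> y"
    proof -
      have "c = 1 \<or> c = 2 \<or> c = 3 \<or> c = 4"
        using c by auto
      then show ?thesis
        using P_c[of 1] P_c[of 2] P_c[of 3] P_c[of 4]
        by (auto simp del: blinfun_apply_blinfun_compose)
    qed
    finally show "coord ((?P 1 + (?P 2 + (?P 3 + ?P 4))) \<xi>) y = coord (id_blinfun \<xi>) y"
      by simp
  qed
  finally show "(\<Oplus>\<^bsub>bounded_ops\<^esub>c\<in>{1..4}. encode_op (push_op (F c)) \<otimes>\<^bsub>bounded_ops\<^esub> adj bounded_ops (encode_op (push_op (F c)))) =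
      \<one>\<^bsub>bounded_ops\<^esub>"
    by simp
qed

section \<open>Permutative endomorphisms\<close>

text \<open>If \<open>S\<^sub>c\<close> maps the basis vector \<open>n\<close> to \<open>F c n\<close>, then \<open>u S\<^sub>c\<close> maps \<open>m\<close> to \<open>branch_step F u c m\<close>.\<close>

definition branch_step ::
    "(nat \<Rightarrow> nat \<Rightarrow> nat) \<Rightarrow> (nat list \<Rightarrow> nat list) \<Rightarrow> nat \<Rightarrow> nat \<Rightarrow> nat" where
  "branch_step F u c y =
    (let b = (THE b. b \<in> {1..4} \<and> y \<in> range (F b)); x = inv_into UNIV (F b) y
     in F (u [c, b] ! 0) (F (u [c, b] ! 1) x))"

lemma branch_step:
  assumes F: "branching F" and b: "b \<in> {1..4}"
  shows "branch_step F u c (F b x) = F (u [c, b] ! 0) (F (u [c, b] ! 1) x)"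
proof -
  have "(THE d. d \<in> {1..4} \<and> F b x \<in> range (F d)) = b"
    using F b unfolding branching_def by (intro the1_equality) blast+
  moreover have "inv_into UNIV (F b) (F b x) = x"
    using F b by (simp add: branching_def)
  ultimately show ?thesis
    by (simp add: branch_step_def)
qed

locale cuntz_algebra_four = cuntz_four A S for A :: "'a cstar" (structure) and S +
  assumes univ: "cuntz_algebra 4 A S"
begin

abbreviation endo :: "'a \<Rightarrow> 'a \<Rightarrow> 'a" where "endo \<equiv> cuntz_endo 4 A S"

lemma cuntz_family_unitary:
  assumes w: "w \<in> unitaries A"
  shows "cuntz_family 4 A (\<lambda>i. w \<otimes> S i)"
  unfolding cuntz_family_def
proof (intro conjI ballI)
  note wD = unitariesD[OF w]
  fix i :: nat assume i: "i \<in> {1..4}"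
  show "w \<otimes> S i \<in> carrier A"
    using wD(1) S_closed[OF i] by simp
  show "adj A (w \<otimes> S i) \<otimes> (w \<otimes> S i) = \<one>"
    using wD S_closed[OF i] S_isometry[OF i] by (simp add: adj_mult adj_closed A_assoc)
next
  note wD = unitariesD[OF w]
  have "(\<Oplus>i\<in>{1..4}. (w \<otimes> S i) \<otimes> adj A (w \<otimes> S i)) = (\<Oplus>i\<in>{1..4}. (w \<otimes> S i) \<otimes> adj A (S i) \<otimes> adj A w)"
    using wD(1) S_closed
    by (intro abelian_monoid.finsum_cong' abelian_group.axioms ring.is_abelian_group ring_A)
      (auto simp: adj_mult adj_closed A_assoc)
  also have "\<dots> = (\<Oplus>i\<in>{1..4}. (w \<otimes> S i) \<otimes> adj A (S i)) \<otimes> adj A w"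
    using wD(1) S_closed
    by (intro semiring.finsum_ldistr[symmetric] ring.semiring_R ring_A) (auto simp: adj_closed)
  also have "\<dots> = \<one>"
    unfolding S_resolution[OF wD(1), symmetric] by (rule wD(3))
  finally show "(\<Oplus>i\<in>{1..4}. (w \<otimes> S i) \<otimes> adj A (w \<otimes> S i)) = \<one>" .
qed

lemma endo_ex1:
  assumes "w \<in> unitaries A"
  shows "\<exists>!f. f \<in> star_homs A A \<and> (\<forall>i\<in>{1..4}. f (S i) = w \<otimes> S i)"
proof -
  have "cuntz_universal TYPE('a) 4 A S" "cstar_algebra A"
    using univ by (auto simp: cuntz_algebra_def)
  then show ?thesis
    using cuntz_family_unitary[OF assms] unfolding cuntz_universal_def by blast
qed

lemma
  assumes "w \<in> unitaries A"
  shows endo_star_homs: "endo w \<in> star_homs A A"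
    and endo_S: "i \<in> {1..4} \<Longrightarrow> endo w (S i) = w \<otimes> S i"
  using theI'[OF endo_ex1[OF assms]] by (simp_all add: cuntz_endo_def)

lemma endo_eqI:
  assumes "w \<in> unitaries A" "f \<in> star_homs A A" "\<And>i. i \<in> {1..4} \<Longrightarrow> f (S i) = w \<otimes> S i"
  shows "f = endo w"
  unfolding cuntz_endo_def using assms endo_ex1[OF assms(1)] by (intro the1_equality[symmetric]) auto

lemma endo_one: "endo \<one> = (\<lambda>x\<in>carrier A. x)"
  using one_unitary id_star_homs S_closed by (intro endo_eqI[symmetric]) auto

lemma U_S_in_words:
  assumes "u permutes words 4 2" "c \<in> {1..4}" "b \<in> {1..4}" "u [c, b] = [a', b']"
  shows "a' \<in> {1..4}" "b' \<in> {1..4}"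
proof -
  have "[c, b] \<in> words 4 2"
    using assms by (simp add: words_def)
  then have "[a', b'] \<in> words 4 2"
    using assms by (metis permutes_in_image)
  then show "a' \<in> {1..4}" "b' \<in> {1..4}"
    by (auto simp: words_def)
qed

text \<open>\<open>comm\<close> says that \<open>v\<close>, acting on the first two letters of a word of length three,
  commutes with \<open>u\<close> acting on the last two. In general, \<open>u \<circ> v\<close> on the right has to be replaced by
  \<open>u \<phi>(u) v \<phi>(u)\<^sup>*\<close>, where \<open>\<phi>(x) = \<Sum>\<^sub>i S\<^sub>i x S\<^sub>i\<^sup>*\<close>.\<close>

lemma endo_compose:
  assumes u: "u permutes words 4 2" and v: "v permutes words 4 2"
    and comm: "\<And>i b c b1 c1 a' b' b2 c2. \<lbrakk>i \<in> {1..4}; b \<in> {1..4}; c \<in> {1..4}; u [b, c] = [b1, c1];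
      v [i, b] = [a', b']; u [b', c] = [b2, c2]\<rbrakk> \<Longrightarrow> v [i, b1] = [a', b2] \<and> c1 = c2"
  shows "compose (carrier A) (endo (U u)) (endo (U v)) = endo (U (u \<circ> v))"
proof (rule endo_eqI)
  note uu = U_unitary[OF u] and uv = U_unitary[OF v]
  note cl = U_closed[OF u] U_closed[OF v]
  note hom = star_homsD[OF endo_star_homs[OF uu]]
  show "U (u \<circ> v) \<in> unitaries A"
    by (intro U_unitary permutes_compose u v)
  show "compose (carrier A) (endo (U u)) (endo (U v)) \<in> star_homs A A"
    by (intro compose_star_homs endo_star_homs uu uv)
  fix i :: nat assume i: "i \<in> {1..4}"
  note Si = S_closed[OF i]
  let ?x = "endo (U u) (U v \<otimes> S i)"
  have x: "?x \<in> carrier A"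
    using cl Si by (intro hom(1)) simp
  have ex_pair: "\<exists>a b. w [p, q] = [a, b]" if "w permutes words 4 2" "p \<in> {1..4}" "q \<in> {1..4}" for w and p q :: nat
  proof -
    have "w [p, q] \<in> words 4 2"
      using that permutes_in_image[OF that(1), of "[p, q]"] by (simp add: words_def)
    then show ?thesis
      by (auto elim: words_2E)
  qed
  \<comment> \<open>\<open>endo (U u)\<close> is known on generators, and
    \<open>U v \<otimes> S i\<close> becomes a product of generators after multiplication by
    \<open>S b\<close>, whose image is \<open>U u \<otimes> S b\<close>. This is the origin of the
    extra factor \<open>U u\<close>, cancelled at the end.\<close>
  have "?x \<otimes> U u = U u \<otimes> (U v \<otimes> S i \<otimes> U u)"
  proof (rule eq_if_eq_on_S)
    fix b :: nat assume b: "b \<in> {1..4}"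
    note Sb = S_closed[OF b]
    obtain a' b' where ab: "v [i, b] = [a', b']"
      using ex_pair[OF v i b] by blast
    note ab_in = U_S_in_words[OF v i b ab]
    note Sab = S_closed[OF ab_in(1)] S_closed[OF ab_in(2)]
    have "?x \<otimes> U u \<otimes> S b = ?x \<otimes> (U u \<otimes> S b)"
      by (rule A_assoc[OF x cl(1) Sb])
    also have "\<dots> = ?x \<otimes> endo (U u) (S b)"
      by (simp only: endo_S[OF uu b])
    also have "\<dots> = endo (U u) (U v \<otimes> S i \<otimes> S b)"
      using cl Si Sb by (intro hom(2)[symmetric]) auto
    also have "\<dots> = (U u \<otimes> S a') \<otimes> (U u \<otimes> S b')"
      using Sab ab_in by (simp add: U_S_S[OF v i b ab] hom(2) endo_S[OF uu])
    also have "\<dots> = U u \<otimes> (S a' \<otimes> (U u \<otimes> S b'))"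
      using cl Sab by (simp add: A_assoc)
    \<comment> \<open>Tested on a third letter \<open>c\<close>, this is exactly the commutation
      hypothesis \<open>comm\<close>.\<close>
    also have "S a' \<otimes> (U u \<otimes> S b') = U v \<otimes> S i \<otimes> (U u \<otimes> S b)"
    proof (rule eq_if_eq_on_S)
      fix c :: nat assume c: "c \<in> {1..4}"
      note Sc = S_closed[OF c]
      obtain b1 c1 where 1: "u [b, c] = [b1, c1]"
        using ex_pair[OF u b c] by blast
      obtain b2 c2 where 2: "u [b', c] = [b2, c2]"
        using ex_pair[OF u ab_in(2) c] by blast
      have 3: "v [i, b1] = [a', b2]" "c1 = c2"
        using comm[OF i b c 1 ab 2] by auto
      note in1 = U_S_in_words[OF u b c 1] and in2 = U_S_in_words[OF u ab_in(2) c 2]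
      note Scs = S_closed[OF in1(1)] S_closed[OF in1(2)] S_closed[OF in2(1)] S_closed[OF in2(2)]
      have "S a' \<otimes> (U u \<otimes> S b') \<otimes> S c = S a' \<otimes> (U u \<otimes> S b' \<otimes> S c)"
        using cl Sab Sc by (simp add: A_assoc)
      also have "\<dots> = (S a' \<otimes> S b2) \<otimes> S c2"
        using Sab Scs by (simp add: U_S_S[OF u ab_in(2) c 2] A_assoc)
      also have "\<dots> = (U v \<otimes> S i \<otimes> S b1) \<otimes> S c1"
        by (simp add: U_S_S[OF v i in1(1) 3(1)] 3(2))
      also have "\<dots> = U v \<otimes> S i \<otimes> (U u \<otimes> S b \<otimes> S c)"
        using cl Si Scs by (simp add: U_S_S[OF u b c 1] A_assoc)
      also have "\<dots> = U v \<otimes> S i \<otimes> (U u \<otimes> S b) \<otimes> S c"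
        using cl Si Sb Sc by (simp add: A_assoc)
      finally show "S a' \<otimes> (U u \<otimes> S b') \<otimes> S c = U v \<otimes> S i \<otimes> (U u \<otimes> S b) \<otimes> S c" .
    qed (use cl Sab Si Sb in auto)
    also have "U u \<otimes> (U v \<otimes> S i \<otimes> (U u \<otimes> S b)) = U u \<otimes> (U v \<otimes> S i \<otimes> U u) \<otimes> S b"
      using cl Si Sb by (simp add: A_assoc)
    finally show "?x \<otimes> U u \<otimes> S b = U u \<otimes> (U v \<otimes> S i \<otimes> U u) \<otimes> S b" .
  qed (use x cl Si in auto)
  then have "?x \<otimes> U u \<otimes> adj A (U u) = U u \<otimes> (U v \<otimes> S i \<otimes> U u) \<otimes> adj A (U u)"
    by simp
  then have "?x = U u \<otimes> (U v \<otimes> S i)"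
    using x cl Si unitariesD[OF uu] by (simp add: A_assoc adj_closed)
  also have "\<dots> = U (u \<circ> v) \<otimes> S i"
    using cl Si by (simp add: A_assoc flip: U_compose[OF u v])
  finally show "compose (carrier A) (endo (U u)) (endo (U v)) (S i) = U (u \<circ> v) \<otimes> S i"
    using Si i by (simp add: compose_def endo_S[OF uv])
qed

lemma conj_endo_intertwines:
  assumes "z \<in> unitaries A" "w \<in> unitaries A" "w' \<in> unitaries A"
    and eq: "endo w = compose (carrier A) (conj_by z) (endo w')" and i: "i \<in> {1..4}"
  shows "w \<otimes> S i \<otimes> z = z \<otimes> (w' \<otimes> S i)"
proof -
  note cl = unitariesD(1)[OF assms(1)] unitariesD(1)[OF assms(2)] unitariesD(1)[OF assms(3)] S_closed[OF i]
  have "w \<otimes> S i = z \<otimes> (w' \<otimes> S i) \<otimes> adj A z"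
    using fun_cong[OF eq, of "S i"] cl
    by (simp add: compose_def conj_by_def endo_S[OF assms(2) i] endo_S[OF assms(3) i])
  then show ?thesis
    using cl unitariesD[OF assms(1)] by (simp add: A_assoc adj_closed)
qed

text \<open>In the representation given by \<open>F\<close>, the unitary \<open>z\<close> would carry the fixed vector of
  \<open>\<lambda>\<^sub>v(S\<^sub>w)\<close> to one of \<open>\<lambda>\<^sub>u(S\<^sub>w)\<close>, but an isometry moving every basis vector strictly upwards has none.\<close>

lemma not_intertwined:
  assumes u: "u permutes words 4 2" and v: "v permutes words 4 2" and z: "z \<in> unitaries A"
    and twine: "\<And>i. i \<in> {1..4} \<Longrightarrow> U u \<otimes> S i \<otimes> z = z \<otimes> (U v \<otimes> S i)"
    and F: "branching F" and w: "set w \<subseteq> {1..4}"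
    and fixed: "foldr (branch_step F v) w n = n"
    and moving: "\<And>m. m < foldr (branch_step F u) w m"
  shows False
proof -
  have "cuntz_universal TYPE((nat \<Rightarrow> complex) \<Rightarrow> (nat \<Rightarrow> complex)) 4 A S"
    using univ by (auto simp: cuntz_algebra_def)
  then obtain \<rho> where \<rho>: "\<rho> \<in> star_homs A bounded_ops"
    and \<rho>_S: "\<And>i. i \<in> {1..4} \<Longrightarrow> \<rho> (S i) = encode_op (push_op (F i))"
    using cstar_algebra_bounded_ops cuntz_family_branching[OF F]
    unfolding cuntz_universal_def by metis
  note hom = star_homsD[OF \<rho>]
  define op where "op x = decode_op (\<rho> x)" for x
  have op_clinear: "op x \<in> clinear_ops" for x
    by (simp add: op_def)
  have op_mult: "op (x \<otimes> y) \<xi> = op x (op y \<xi>)" if "x \<in> carrier A" "y \<in> carrier A" for x y \<xi>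
    using that by (simp add: op_def hom(2) mult_bounded_ops compose_clinear)
  have op_one: "op \<one> \<xi> = \<xi>" for \<xi>
    by (simp add: op_def hom(4) one_bounded_ops id_clinear)
  have inj: "inj (F i)" if "i \<in> {1..4}" for i
    using F that by (simp add: branching_def)
  have op_S: "op (S i) (ket m) = ket (F i m)" if "i \<in> {1..4}" for i m
    using inj[OF that] that by (simp add: op_def \<rho>_S push_clinear push_ket)
  have op_US: "op (U x \<otimes> S c) (ket m) = ket (branch_step F x c m)"
    if x: "x permutes words 4 2" and c: "c \<in> {1..4}" for x c m
  proof -
    obtain b k where b: "b \<in> {1..4}" and m: "m = F b k"
      using F unfolding branching_def by blast
    have "x [c, b] \<in> words 4 2"
      using permutes_in_image[OF x, of "[c, b]"] b c by (simp add: words_def)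
    then obtain a' b' where ab: "x [c, b] = [a', b']"
      by (auto elim: words_2E)
    note ab_in = U_S_in_words[OF x c b ab]
    have "op (U x \<otimes> S c) (ket m) = op (U x \<otimes> S c \<otimes> S b) (ket k)"
      using U_closed[OF x] S_closed[OF c] S_closed[OF b] by (simp add: m op_mult op_S[OF b])
    also have "\<dots> = ket (F a' (F b' k))"
      using ab_in S_closed[OF ab_in(1)] S_closed[OF ab_in(2)] by (simp add: U_S_S[OF x c b ab] op_mult op_S[OF ab_in(1)] op_S[OF ab_in(2)])
    finally show ?thesis
      by (simp add: m branch_step[OF F b] ab)
  qed
  \<comment> \<open>\<open>P x w\<close> is \<lambda>\<open>\<^sub>x(S\<^sub>w)\<close> written out
    letter by letter.\<close>
  define P where "P x w = foldr (\<lambda>c a. (U x \<otimes> S c) \<otimes> a) w \<one>" for x w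
  have P_closed: "P x w \<in> carrier A" if "x permutes words 4 2" "set w \<subseteq> {1..4}" for x w
    using that(2) by (induction w) (auto simp: P_def U_closed[OF that(1)] S_closed)
  have op_P: "op (P x w) (ket m) = ket (foldr (branch_step F x) w m)"
    if "x permutes words 4 2" "set w \<subseteq> {1..4}" for x w m
    using that(2)
  proof (induction w)
    case (Cons c w)
    then have "op (P x (c # w)) (ket m) = op (U x \<otimes> S c) (op (P x w) (ket m))"
      using P_closed[OF that(1), of w] U_closed[OF that(1)] S_closed[of c]
      by (simp add: P_def op_mult)
    then show ?case
      using Cons op_US[OF that(1)] by simp
  qed (simp add: P_def op_one)
  have twine_P: "P u w \<otimes> z = z \<otimes> P v w"
    using w
  proof (induction w)
    case (Cons c w)
    note cl = P_closed[OF u, of w] P_closed[OF v, of w] U_closed[OF u] U_closed[OF v] S_closed[of c]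
      unitariesD(1)[OF z]
    have "P u (c # w) \<otimes> z = (U u \<otimes> S c) \<otimes> (P u w \<otimes> z)"
      using Cons cl by (simp add: P_def A_assoc)
    also have "\<dots> = (U u \<otimes> S c \<otimes> z) \<otimes> P v w"
      using Cons cl by (simp add: A_assoc)
    also have "\<dots> = z \<otimes> P v (c # w)"
      using Cons cl twine[of c] by (simp add: P_def A_assoc)
    finally show ?case .
  qed (use unitariesD(1)[OF z] in \<open>simp add: P_def\<close>)
  define \<eta> where "\<eta> = op z (ket n)"
  note zc = unitariesD(1)[OF z]
  have "op (P u w) \<eta> = op (P u w \<otimes> z) (ket n)"
    using P_closed[OF u w] zc by (simp add: \<eta>_def op_mult)
  also have "\<dots> = \<eta>"
    using P_closed[OF v w] zc by (simp add: twine_P op_mult op_P[OF v w] fixed \<eta>_def)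
  finally have "\<eta> = 0"
    by (intro no_fixed_vector[OF op_clinear op_P[OF u w] moving])
  then have "op (adj A z) (op z (ket n)) = 0"
    by (simp add: \<eta>_def)
  then have "ket n = 0"
    using zc by (simp add: op_one unitariesD(2)[OF z] adj_closed flip: op_mult)
  then have "coord (ket n) n = 0"
    by simp
  then show False by simp
qed

end

section \<open>The permutations generating the groups K\<close>

locale letters =
  fixes i j h k :: nat
  assumes distinct: "distinct [i, j, h, k]" and letters: "{i, j, h, k} = {1..4}"
begin

lemma neq [simp]:
  "i \<noteq> j" "j \<noteq> i" "i \<noteq> h" "h \<noteq> i" "i \<noteq> k" "k \<noteq> i"
  "j \<noteq> h" "h \<noteq> j" "j \<noteq> k" "k \<noteq> j" "h \<noteq> k" "k \<noteq> h"
  using distinct by auto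

lemma in_letters: "i \<in> {1..4}" "j \<in> {1..4}" "h \<in> {1..4}" "k \<in> {1..4}"
  unfolding letters[symmetric] by simp_all

lemma in_words [simp]:
  "[i, i] \<in> words 4 2" "[i, j] \<in> words 4 2" "[i, h] \<in> words 4 2" "[i, k] \<in> words 4 2"
  "[j, i] \<in> words 4 2" "[j, j] \<in> words 4 2" "[j, h] \<in> words 4 2" "[j, k] \<in> words 4 2"
  "[h, i] \<in> words 4 2" "[h, j] \<in> words 4 2" "[h, h] \<in> words 4 2" "[h, k] \<in> words 4 2"
  "[k, i] \<in> words 4 2" "[k, j] \<in> words 4 2" "[k, h] \<in> words 4 2" "[k, k] \<in> words 4 2"
  using in_letters by (simp_all add: words_def)

lemma letters_cases: "p \<in> {1..4} \<longleftrightarrow> p \<in> {i, j} \<or> p \<in> {h, k}"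
  unfolding letters[symmetric] by auto

definition block :: "nat list set" where
  "block = {[i, h], [i, k], [j, h], [j, k]}"

definition flip_fst :: "bool \<Rightarrow> nat list \<Rightarrow> nat list" where
  "flip_fst a = (if a then Transposition.transpose [i, i] [j, i] \<circ> Transposition.transpose [i, j] [j, j] else id)"

definition flip_snd :: "bool \<Rightarrow> nat list \<Rightarrow> nat list" where
  "flip_snd b = (if b then Transposition.transpose [h, h] [h, k] \<circ> Transposition.transpose [k, h] [k, k] else id)"

text \<open>For \<sigma> permuting \<open>block\<close>, the three factors have disjoint supports
  and commute. The remaining words, in \<open>{h,k} \<times> {i,j}\<close>, are fixed.\<close>

definition K_perm :: "(nat list \<Rightarrow> nat list) \<Rightarrow> bool \<Rightarrow> bool \<Rightarrow> nat list \<Rightarrow> nat list" where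
  "K_perm \<sigma> a b = \<sigma> \<circ> flip_fst a \<circ> flip_snd b"

definition swap_ij :: "bool \<Rightarrow> nat \<Rightarrow> nat" where
  "swap_ij a = (if a then Transposition.transpose i j else id)"

definition swap_hk :: "bool \<Rightarrow> nat \<Rightarrow> nat" where
  "swap_hk b = (if b then Transposition.transpose h k else id)"

lemma swap_ij_simps [simp]: "swap_ij a h = h" "swap_ij a k = k" "swap_ij False p = p"
    "swap_ij True i = j" "swap_ij True j = i"
  and swap_hk_simps [simp]: "swap_hk b i = i" "swap_hk b j = j" "swap_hk False p = p"
    "swap_hk True h = k" "swap_hk True k = h"
  by (simp_all add: swap_ij_def swap_hk_def Transposition.transpose_def)

lemma swap_ij_in: "p \<in> {i, j} \<Longrightarrow> swap_ij a p \<in> {i, j}"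
  by (cases a) auto

lemma swap_hk_in: "p \<in> {h, k} \<Longrightarrow> swap_hk b p \<in> {h, k}"
  by (cases b) auto

lemma block_subset: "block \<subseteq> words 4 2"
  by (simp add: block_def)

lemma blockE:
  assumes "\<alpha> \<in> block"
  obtains p q where "\<alpha> = [p, q]" "p \<in> {i, j}" "q \<in> {h, k}"
  using assms by (auto simp: block_def)

lemma block_iff: "[p, q] \<in> block \<longleftrightarrow> p \<in> {i, j} \<and> q \<in> {h, k}"
  by (auto simp: block_def)

context
  fixes \<sigma> assumes \<sigma>: "\<sigma> permutes block"
begin

lemma not_block: "\<alpha> \<notin> block \<Longrightarrow> \<sigma> \<alpha> = \<alpha>"
  using \<sigma> by (simp add: permutes_not_in)

text \<open>The first letter is arbitrary because \<open>swap_ij\<close> fixes \<open>h\<close> and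
  \<open>k\<close>. With the dual \<open>K_perm_fst\<close> and the block, three rules cover all
  sixteen words, the first two agreeing on \<open>{h,k} \<times> {i,j}\<close>.\<close>

lemma K_perm_snd:
  assumes "p \<in> {1..4}" "q \<in> {i, j}"
  shows "K_perm \<sigma> a b [p, q] = [swap_ij a p, q]"
proof -
  have "flip_fst a (flip_snd b [p, q]) = [swap_ij a p, q]"
    using assms unfolding letters_cases
    by (auto simp: flip_fst_def flip_snd_def swap_ij_def Transposition.transpose_def)
  moreover have "[swap_ij a p, q] \<notin> block"
    using assms by (auto simp: block_iff)
  ultimately show ?thesis
    by (simp add: K_perm_def not_block)
qed

lemma K_perm_fst:
  assumes "p \<in> {h, k}" "q \<in> {1..4}"
  shows "K_perm \<sigma> a b [p, q] = [p, swap_hk b q]"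
proof -
  have "flip_fst a (flip_snd b [p, q]) = [p, swap_hk b q]"
    using assms unfolding letters_cases
    by (auto simp: flip_fst_def flip_snd_def swap_hk_def Transposition.transpose_def)
  moreover have "[p, swap_hk b q] \<notin> block"
    using assms by (auto simp: block_iff)
  ultimately show ?thesis
    by (simp add: K_perm_def not_block)
qed

lemma K_perm_block:
  assumes "p \<in> {i, j}" "q \<in> {h, k}"
  shows "K_perm \<sigma> a b [p, q] = \<sigma> [p, q]"
proof -
  have "flip_fst a (flip_snd b [p, q]) = [p, q]"
    using assms by (auto simp: flip_fst_def flip_snd_def Transposition.transpose_def)
  then show ?thesis
    by (simp add: K_perm_def)
qed

lemma permutes_blockE:
  assumes "p \<in> {i, j}" "q \<in> {h, k}"
  obtains p' q' where "\<sigma> [p, q] = [p', q']" "p' \<in> {i, j}" "q' \<in> {h, k}"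
proof -
  have "\<sigma> [p, q] \<in> block"
    using assms permutes_in_image[OF \<sigma>] by (simp add: block_iff)
  then show ?thesis
    using that by (auto elim: blockE)
qed

lemma K_perm_permutes: "K_perm \<sigma> a b permutes words 4 2"
proof -
  have "flip_fst a permutes words 4 2" "flip_snd b permutes words 4 2"
    by (auto simp: flip_fst_def flip_snd_def permutes_id intro!: permutes_compose permutes_swap_id)
  then show ?thesis
    unfolding K_perm_def using permutes_subset[OF \<sigma> block_subset] by (intro permutes_compose)
qed

end

lemma K_perm_compose:
  assumes \<sigma>: "\<sigma> permutes block" and \<tau>: "\<tau> permutes block"
  shows "K_perm \<sigma> a b \<circ> K_perm \<tau> c d = K_perm (\<sigma> \<circ> \<tau>) (a \<noteq> c) (b \<noteq> d)"
proof (rule ext)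
  note \<sigma>\<tau> = permutes_compose[OF \<tau> \<sigma>]
  fix \<alpha>
  show "(K_perm \<sigma> a b \<circ> K_perm \<tau> c d) \<alpha> = K_perm (\<sigma> \<circ> \<tau>) (a \<noteq> c) (b \<noteq> d) \<alpha>"
  proof (cases "\<alpha> \<in> words 4 2")
    case False
    then show ?thesis
      by (simp add: permutes_not_in[OF K_perm_permutes[OF \<sigma>] False]
          permutes_not_in[OF K_perm_permutes[OF \<tau>] False] permutes_not_in[OF K_perm_permutes[OF \<sigma>\<tau>] False])
  next
    case True
    then obtain p q where \<alpha>: "\<alpha> = [p, q]" and pq: "p \<in> {1..4}" "q \<in> {1..4}"
      by (elim words_2E)
    consider "q \<in> {i, j}" | "p \<in> {h, k}" "q \<in> {h, k}" | "p \<in> {i, j}" "q \<in> {h, k}"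
      using pq unfolding letters_cases by blast
    then show ?thesis
    proof cases
      case 1
      have *: "swap_ij c p \<in> {1..4}" "swap_ij a (swap_ij c p) = swap_ij (a \<noteq> c) p"
        using pq(1) unfolding letters_cases by (auto simp: swap_ij_def Transposition.transpose_def)
      show ?thesis
        using *(2) by (simp add: \<alpha> K_perm_snd[OF \<tau> pq(1) 1] K_perm_snd[OF \<sigma> *(1) 1] K_perm_snd[OF \<sigma>\<tau> pq(1) 1])
    next
      case 2
      have *: "swap_hk d q \<in> {1..4}" "swap_hk b (swap_hk d q) = swap_hk (b \<noteq> d) q"
        using pq(2) unfolding letters_cases by (auto simp: swap_hk_def Transposition.transpose_def)
      show ?thesis
        using *(2) by (simp add: \<alpha> K_perm_fst[OF \<tau> 2(1) pq(2)] K_perm_fst[OF \<sigma> 2(1) *(1)] K_perm_fst[OF \<sigma>\<tau> 2(1) pq(2)])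
    next
      case 3
      obtain p' q' where *: "\<tau> [p, q] = [p', q']" "p' \<in> {i, j}" "q' \<in> {h, k}"
        using permutes_blockE[OF \<tau> 3] .
      show ?thesis
        using * by (simp add: \<alpha> K_perm_block[OF \<tau> 3] K_perm_block[OF \<sigma> *(2,3)] K_perm_block[OF \<sigma>\<tau> 3])
    qed
  qed
qed

lemma K_perm_id: "K_perm id False False = id"
  by (simp add: K_perm_def flip_fst_def flip_snd_def)

text \<open>Both permutations preserve the classes \<open>{i,j}\<close> and \<open>{h,k}\<close> in
  either position, and the class of the middle letter decides. If it is \<open>{i,j}\<close>, the
  left action keeps the middle letter and changes the first one independently of it; if it is
  \<open>{h,k}\<close>, the right action does the same with the last letter.\<close>

lemma K_perm_commute:
  assumes \<sigma>: "\<sigma> permutes block" and \<tau>: "\<tau> permutes block"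
    and x: "x \<in> {1..4}" "y \<in> {1..4}" "z \<in> {1..4}"
    and 1: "K_perm \<sigma> a b [y, z] = [y1, z1]" and 2: "K_perm \<tau> c d [x, y] = [x', y']"
    and 3: "K_perm \<sigma> a b [y', z] = [y2, z2]"
  shows "K_perm \<tau> c d [x, y1] = [x', y2] \<and> z1 = z2"
  using x(2) unfolding letters_cases
proof
  assume y: "y \<in> {i, j}"
  have y1: "y1 \<in> {i, j}"
    using x(3) unfolding letters_cases
  proof
    assume "z \<in> {i, j}"
    then show ?thesis
      using 1 y K_perm_snd[OF \<sigma> x(2), of z a b] swap_ij_in[OF y, of a] by auto
  next
    assume "z \<in> {h, k}"
    then show ?thesis
      using 1 y K_perm_block[OF \<sigma> y, of z a b] permutes_blockE[OF \<sigma> y, of z] by auto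
  qed
  have "[x', y'] = [swap_ij c x, y]"
    using 2 K_perm_snd[OF \<tau> x(1) y, of c d] by simp
  then show ?thesis
    using 1 3 K_perm_snd[OF \<tau> x(1) y1, of c d] by simp
next
  assume y: "y \<in> {h, k}"
  have y': "y' \<in> {h, k}"
    using x(1) unfolding letters_cases
  proof
    assume "x \<in> {i, j}"
    then show ?thesis
      using 2 y K_perm_block[OF \<tau> _ y, of x c d] permutes_blockE[OF \<tau> _ y, of x] by auto
  next
    assume "x \<in> {h, k}"
    then show ?thesis
      using 2 y K_perm_fst[OF \<tau> _ x(2), of x c d] swap_hk_in[OF y, of d] by auto
  qed
  have "[y1, z1] = [y, swap_hk b z]" "[y2, z2] = [y', swap_hk b z]"
    using 1 3 K_perm_fst[OF \<sigma> y x(3), of a b] K_perm_fst[OF \<sigma> y' x(3), of a b] by simp_all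
  then show ?thesis
    using 2 by simp
qed

lemma K_perms_eq: "K_perms i j h k =
    {K_perm (Transposition.transpose [i, h] [i, k]) False False,
     K_perm (Transposition.transpose [j, h] [j, k]) False False,
     K_perm (Transposition.transpose [i, h] [j, h]) False False,
     K_perm id True False, K_perm id False True}"
  by (simp add: K_perms_def K_perm_def flip_fst_def flip_snd_def)

text \<open>The three given transpositions are the edges of the path \<open>[i, k]\<close>,
  \<open>[i, h]\<close>, \<open>[j, h]\<close>, \<open>[j, k]\<close>. Conjugating one by another
  joins the ends of adjacent edges, which produces all transpositions of the block.\<close>

lemma transposition_induct:
  assumes \<sigma>: "\<sigma> permutes block" and id: "P id"
    and gens: "P (Transposition.transpose [i, h] [i, k])" "P (Transposition.transpose [j, h] [j, k])"
      "P (Transposition.transpose [i, h] [j, h])"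
    and comp: "\<And>\<sigma> \<tau>. \<sigma> permutes block \<Longrightarrow> \<tau> permutes block \<Longrightarrow> P \<sigma> \<Longrightarrow> P \<tau> \<Longrightarrow> P (\<sigma> \<circ> \<tau>)"
  shows "P \<sigma>"
proof -
  let ?t = Transposition.transpose
  have tr: "P (?t a c)" if "P (?t a b)" "P (?t b c)" "a \<noteq> c" "b \<noteq> c" "a \<in> block" "b \<in> block" "c \<in> block" for a b c
  proof -
    have "P (?t a b \<circ> ?t b c \<circ> ?t a b)"
      using that by (intro comp permutes_compose permutes_swap_id) auto
    then show ?thesis
      using that by (simp add: transpose_comp_triple)
  qed
  have sym: "P (?t b a)" if "P (?t a b)" for a b
    using that by (simp add: transpose_commute)
  have 1: "P (?t [i, k] [j, h])"
    by (rule tr[of _ "[i, h]"]) (use gens sym in \<open>auto simp: block_def\<close>)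
  have 2: "P (?t [i, h] [j, k])"
    by (rule tr[of _ "[j, h]"]) (use gens sym in \<open>auto simp: block_def\<close>)
  have 3: "P (?t [i, k] [j, k])"
    by (rule tr[of _ "[j, h]"]) (use gens 1 in \<open>auto simp: block_def\<close>)
  have all: "P (?t a b)" if "a \<in> block" "b \<in> block" "a \<noteq> b" for a b
    using that gens 1 2 3 gens[THEN sym] 1[THEN sym] 2[THEN sym] 3[THEN sym]
    unfolding block_def by auto
  have "finite block"
    by (simp add: block_def)
  with \<sigma> show ?thesis
  proof (induction rule: permutes_induct)
    case (swap a b p)
    then show ?case
      using all by (intro comp permutes_swap_id) auto
  qed (rule id)
qed

section \<open>Identification with the symmetric group on \<open>{1..4}\<close>\<close>

definition block_word :: "nat \<Rightarrow> nat list" where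
  "block_word n = (if n = 1 then [i, h] else if n = 2 then [i, k] else if n = 3 then [j, h] else [j, k])"

lemma bij_block_word: "bij_betw block_word {1..4} block"
proof -
  have "{1..4} = {1, 2, 3, 4 :: nat}" by auto
  then show ?thesis
    by (auto simp: bij_betw_def inj_on_def block_word_def block_def)
qed

definition block_perm :: "(nat \<Rightarrow> nat) \<Rightarrow> nat list \<Rightarrow> nat list" where
  "block_perm s = map_permutation {1..4} block_word s"

lemma block_perm_apply: "n \<in> {1..4} \<Longrightarrow> block_perm s (block_word n) = block_word (s n)"
  unfolding block_perm_def using bij_block_word by (intro map_permutation_apply) (simp add: bij_betw_def)

lemma block_perm_permutes: "s permutes {1..4} \<Longrightarrow> block_perm s permutes block"
  unfolding block_perm_def by (rule map_permutation_permutes[OF bij_block_word])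

lemma block_perm_compose:
  assumes "s permutes {1..4}" "t permutes {1..4}"
  shows "block_perm (s \<circ> t) = block_perm s \<circ> block_perm t"
proof (rule ext)
  fix \<alpha>
  show "block_perm (s \<circ> t) \<alpha> = (block_perm s \<circ> block_perm t) \<alpha>"
  proof (cases "\<alpha> \<in> block")
    case True
    then obtain n where n: "\<alpha> = block_word n" "n \<in> {1..4}"
      using bij_block_word unfolding bij_betw_def by blast
    then have "t n \<in> {1..4}"
      using permutes_in_image[OF assms(2), of n] by simp
    then show ?thesis
      by (simp only: n(1) block_perm_apply[OF n(2)] block_perm_apply o_def)
  next
    case False
    then show ?thesis
      by (simp add: permutes_not_in[OF block_perm_permutes[OF assms(1)] False]
          permutes_not_in[OF block_perm_permutes[OF assms(2)] False]
          permutes_not_in[OF block_perm_permutes[OF permutes_compose[OF assms(2,1)]] False])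
  qed
qed

lemma block_perm_inject:
  assumes s: "s permutes {1..4}" and eq: "block_perm s = id"
  shows "s = id"
proof (rule ext)
  have inj: "inj_on block_word {1..4}"
    using bij_block_word by (auto simp: bij_betw_def)
  fix n
  show "s n = id n"
  proof (cases "n \<in> {1..4}")
    case True
    then have "block_word (s n) = block_word n"
      using eq block_perm_apply[OF True, of s] by simp
    then show ?thesis
      using inj True permutes_in_image[OF s, of n] by (simp add: inj_on_eq_iff)
  qed (simp add: permutes_not_in[OF s])
qed

lemma block_perm_surj:
  assumes \<sigma>: "\<sigma> permutes block"
  obtains s where "s permutes {1..4}" "block_perm s = \<sigma>"
proof
  let ?g = "inv_into {1..4} block_word"
  show "map_permutation block ?g \<sigma> permutes {1..4}"
    by (rule map_permutation_permutes[OF bij_betw_inv_into[OF bij_block_word] \<sigma>])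
  show "block_perm (map_permutation block ?g \<sigma>) = \<sigma>"
    unfolding block_perm_def
    by (rule map_permutation_compose_inv[OF bij_betw_inv_into[OF bij_block_word] \<sigma>])
      (rule bij_betw_inv_into_right[OF bij_block_word])
qed

end

section \<open>Separating outer automorphisms by digit expansions\<close>

text \<open>Without \<open>\<tau>\<close>, the basis vector \<open>n\<close> stands for the infinite word of its base-4 digits, least
  significant first, which ends in the letter \<open>p\<close> repeated. Suitable \<open>\<tau>\<close> change the tail to the
  periodic words \<open>p q p q \<dots>\<close> and \<open>p q r p q r \<dots>\<close>.\<close>

definition digit :: "nat \<Rightarrow> nat \<Rightarrow> nat \<Rightarrow> nat \<Rightarrow> nat" where
  "digit p q r c = (if c = p then 0 else if c = q then 1 else if c = r then 2 else 3)"

text \<open>For \<tau> the identity, a letter \<open>c\<close> sends \<open>x\<close> to a larger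
  index, except that \<open>p\<close> fixes 0. A nontrivial \<tau> closes a longer cycle of small
  indices instead.\<close>

definition digit_rep :: "(nat \<Rightarrow> nat) \<Rightarrow> nat \<Rightarrow> nat \<Rightarrow> nat \<Rightarrow> nat \<Rightarrow> nat \<Rightarrow> nat" where
  "digit_rep \<tau> p q r c x = \<tau> (4 * x + digit p q r c)"

lemma digit_simps [simp]: "digit p q r p = 0" "p \<noteq> q \<Longrightarrow> digit p q r q = 1"
  "p \<noteq> r \<Longrightarrow> q \<noteq> r \<Longrightarrow> digit p q r r = 2"
  by (auto simp: digit_def)

lemma digit_less: "digit p q r c < 4"
  by (simp add: digit_def)

lemma digit_eq_0_iff [simp]: "digit p q r c = 0 \<longleftrightarrow> c = p"
  by (simp add: digit_def)

lemma digit_pos: "c \<noteq> p \<Longrightarrow> 1 \<le> digit p q r c"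
  by (simp add: digit_def)

lemma branching_digit_rep:
  assumes \<tau>: "bij \<tau>" and pqr: "distinct [p, q, r]" "{p, q, r} \<subseteq> {1..4}"
  shows "branching (digit_rep \<tau> p q r)"
  unfolding branching_def
proof (intro conjI ballI allI)
  show "inj (digit_rep \<tau> p q r c)" for c
  proof (rule injI)
    fix x y assume "digit_rep \<tau> p q r c x = digit_rep \<tau> p q r c y"
    then show "x = y"
      using injD[OF bij_is_inj[OF \<tau>], of "4 * x + digit p q r c" "4 * y + digit p q r c"]
      by (simp add: digit_rep_def)
  qed
  fix y
  let ?e = "digit p q r"
  have inj: "inj_on ?e {1..4}"
  proof (rule inj_onI)
    fix c d assume cd: "c \<in> {1..4}" "d \<in> {1..4}" "?e c = ?e d"
    have "card ({1..4} - {p, q, r}) = 1"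
      using pqr by (subst card_Diff_subset) auto
    then obtain s where s: "{1..4} - {p, q, r} = {s}"
      by (auto simp: card_1_singleton_iff)
    then have "c \<in> {p, q, r, s}" "d \<in> {p, q, r, s}" "s \<notin> {p, q, r}"
      using cd by blast+
    then show "c = d"
      using cd(3) pqr(1) by (auto simp: digit_def split: if_splits)
  qed
  have "?e ` {1..4} \<subseteq> {0..<4}"
    using digit_less by auto
  moreover have "card (?e ` {1..4}) = card {0..<4 :: nat}"
    using card_image[OF inj] by simp
  ultimately have surj: "?e ` {1..4} = {0..<4}"
    by (intro card_subset_eq) auto
  define n where "n = inv_into UNIV \<tau> y"
  have y: "y = \<tau> m \<longleftrightarrow> m = n" for m
    unfolding n_def using \<tau> by (auto simp: bij_def surj_f_inv_f)
  have "n mod 4 \<in> ?e ` {1..4}"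
    unfolding surj by simp
  then obtain c where c: "c \<in> {1..4}" "?e c = n mod 4"
    by (metis imageE)
  have range: "y \<in> range (digit_rep \<tau> p q r d) \<longleftrightarrow> ?e d = n mod 4" for d
  proof -
    have "y \<in> range (digit_rep \<tau> p q r d) \<longleftrightarrow> (\<exists>x. 4 * x + ?e d = n)"
      by (auto simp: digit_rep_def y image_iff)
    also have "\<dots> \<longleftrightarrow> ?e d = n mod 4"
    proof
      assume "\<exists>x. 4 * x + ?e d = n"
      then show "?e d = n mod 4"
        using digit_less[of p q r d] by auto
    next
      assume "?e d = n mod 4"
      then have "4 * (n div 4) + ?e d = n"
        by simp
      then show "\<exists>x. 4 * x + ?e d = n" ..
    qed
    finally show ?thesis .
  qed
  show "\<exists>!c. c \<in> {1..4} \<and> y \<in> range (digit_rep \<tau> p q r c)"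
    unfolding range
  proof (rule ex1I[of _ c])
    fix d assume "d \<in> {1..4} \<and> ?e d = n mod 4"
    then show "d = c"
      using c inj_onD[OF inj, of d c] by presburger
  qed (use c in blast)
qed

lemma branching_cases:
  assumes "branching F"
  obtains b x where "b \<in> {1..4}" "m = F b x"
  using assms unfolding branching_def by blast

lemma branch_step_id:
  assumes F: "branching F"
  shows "branch_step F id c m = F c m"
proof -
  obtain b x where "b \<in> {1..4}" "m = F b x"
    by (rule branching_cases[OF F])
  then show ?thesis
    using branch_step[OF F] by simp
qed

section \<open>Intertwining unitaries\<close>

context cuntz_algebra_four
begin

abbreviation L :: "(nat list \<Rightarrow> nat list) \<Rightarrow> 'a \<Rightarrow> 'a" where "L u \<equiv> endo (U u)"

definition intertwines :: "'a \<Rightarrow> (nat list \<Rightarrow> nat list) \<Rightarrow> (nat list \<Rightarrow> nat list) \<Rightarrow> bool" where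
  "intertwines z u v \<longleftrightarrow> z \<in> unitaries A \<and> u permutes words 4 2 \<and> v permutes words 4 2 \<and>
     (\<forall>c\<in>{1..4}. U u \<otimes> S c \<otimes> z = z \<otimes> (U v \<otimes> S c))"

lemma intertwines_sym:
  assumes "intertwines z u v"
  shows "intertwines (adj A z) v u"
proof -
  have z: "z \<in> unitaries A" and u: "u permutes words 4 2" and v: "v permutes words 4 2"
    using assms by (auto simp: intertwines_def)
  have "U v \<otimes> S c \<otimes> adj A z = adj A z \<otimes> (U u \<otimes> S c)" if c: "c \<in> {1..4}" for c
  proof -
    note cl = unitariesD(1)[OF z] U_closed[OF u] U_closed[OF v] S_closed[OF c]
    have "adj A z \<otimes> (U u \<otimes> S c) = adj A z \<otimes> (U u \<otimes> S c \<otimes> z) \<otimes> adj A z"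
      using cl unitariesD(3)[OF z] by (simp add: A_assoc adj_closed)
    also have "U u \<otimes> S c \<otimes> z = z \<otimes> (U v \<otimes> S c)"
      using assms c by (simp add: intertwines_def)
    finally show ?thesis
      using cl unitariesD(4)[OF z] by (simp add: A_assoc adj_closed)
  qed
  then show ?thesis
    using z u v by (simp add: intertwines_def adj_unitary)
qed

lemma intertwines_no_fixed:
  assumes "intertwines z u v" "branching F" "set w \<subseteq> {1..4}"
    and "foldr (branch_step F v) w n = n" "\<And>m. m < foldr (branch_step F u) w m"
  shows False
  using assms by (intro not_intertwined[of u v z F w n]) (auto simp: intertwines_def)

end

locale cuntz_letters = cuntz_algebra_four A S + letters i j h k
  for A :: "'a cstar" (structure) and S i j h k
begin

text \<open>The adjoint of \<open>z\<close> is used, so that the identity is the side that must move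
  every index: there the letters of the test word are simply prefixed.\<close>

lemma intertwines_id:
  assumes s: "s permutes block" and twine: "intertwines z (K_perm s a b) id"
  shows "s = id" "\<not> a" "\<not> b"
proof -
  note twine' = intertwines_sym[OF twine]
  note neg = intertwines_no_fixed[OF twine']
  show "\<not> a"
  proof
    assume a
    \<comment> \<open>The tail is \<open>j j j ...\<close>, with index 0. The flip turns the word
      \<open>[i, j]\<close> into \<open>[j, j]\<close>, so the letter \<open>i\<close> fixes this
      tail.\<close>
    let ?F = "digit_rep id j i h"
    have F: "branching ?F"
      using in_letters by (intro branching_digit_rep) auto
    show False
    proof (rule neg[OF F, of "[i]" 0])
      have "branch_step ?F (K_perm s a b) i (?F j 0) = ?F j (?F j 0)"
        using \<open>a\<close> by (subst branch_step[OF F in_letters(2)]) (simp add: K_perm_snd[OF s in_letters(1)])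
      then show "foldr (branch_step ?F (K_perm s a b)) [i] 0 = 0"
        by (simp add: digit_rep_def)
      show "m < foldr (branch_step ?F id) [i] m" for m
        by (simp add: branch_step_id[OF F] digit_rep_def)
    qed (use in_letters in auto)
  qed
  show "\<not> b"
  proof
    assume b
    \<comment> \<open>Now \<open>h k k k ...\<close>, with index \<open>?F h 0\<close>, is fixed by
      the letter \<open>h\<close>, because \<open>[h, h]\<close> becomes
      \<open>[h, k]\<close>.\<close>
    let ?F = "digit_rep id k h i"
    have F: "branching ?F"
      using in_letters by (intro branching_digit_rep) auto
    show False
    proof (rule neg[OF F, of "[h]" "?F h 0"])
      have "branch_step ?F (K_perm s a b) h (?F h 0) = ?F h (?F k 0)"
        using \<open>b\<close> in_letters by (subst branch_step[OF F in_letters(3)]) (simp add: K_perm_fst[OF s _ in_letters(3)])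
      then show "foldr (branch_step ?F (K_perm s a b)) [h] (?F h 0) = ?F h 0"
        by (simp add: digit_rep_def)
      show "m < foldr (branch_step ?F id) [h] m" for m
        by (simp add: branch_step_id[OF F] digit_rep_def)
    qed (use in_letters in auto)
  qed
  have "s \<alpha> = \<alpha>" if \<alpha>: "\<alpha> \<in> block" for \<alpha>
  proof (rule ccontr)
    assume ne: "s \<alpha> \<noteq> \<alpha>"
    obtain p' q' where pq': "\<alpha> = [p', q']" "p' \<in> {i, j}" "q' \<in> {h, k}"
      using \<alpha> by (rule blockE)
    obtain p q where pq: "s [p', q'] = [p, q]" "p \<in> {i, j}" "q \<in> {h, k}"
      using permutes_blockE[OF s pq'(2,3)] .
    have l: "p \<in> {1..4}" "q \<in> {1..4}" "p' \<in> {1..4}" "q' \<in> {1..4}"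
      using pq(2,3) pq'(2,3) unfolding letters_cases by blast+
    have d: "p \<noteq> q" "p' \<noteq> q" "q' \<noteq> p"
      using pq(2,3) pq'(2,3) by auto
    obtain r where r: "r \<in> {1..4}" "r \<noteq> p" "r \<noteq> q"
    proof -
      have "{1..4} - {p, q} \<noteq> {}"
        using pq(2,3) in_letters by auto
      then show ?thesis using that by blast
    qed
    \<comment> \<open>\<open>?F q 0 = 1\<close>, and \<open>?F p 1\<close> is the image of 4 under
      the transposition, that is 0; so index 0 is the word \<open>p q p q ...\<close>.\<close>
    let ?\<tau> = "Transposition.transpose 0 (4 :: nat)"
    let ?F = "digit_rep ?\<tau> p q r"
    have F: "branching ?F"
      using l r d by (intro branching_digit_rep) auto
    show False
    proof (rule neg[OF F, of "[p', q']" 0])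
      have F0: "?F p (?F q 0) = 0"
        using d by (simp add: digit_rep_def Transposition.transpose_def)
      have "branch_step ?F (K_perm s a b) q' (?F p (?F q 0)) = ?F q' (?F p (?F q 0))"
        using pq(2) by (subst branch_step[OF F l(1)]) (auto simp: K_perm_fst[OF s pq'(3) l(1)])
      moreover have "branch_step ?F (K_perm s a b) p' (?F q' 0) = ?F p (?F q 0)"
        by (subst branch_step[OF F l(4)]) (simp add: K_perm_block[OF s pq'(2,3)] pq)
      ultimately show "foldr (branch_step ?F (K_perm s a b)) [p', q'] 0 = 0"
        by (simp add: F0)
      \<comment> \<open>These conditions keep the computed indices away from 0 and 4: the value 4
        would require the letters \<open>p'\<close>, \<open>q'\<close> to be \<open>p\<close>,
        \<open>q\<close>.\<close>
      have e: "1 \<le> digit p q r q'" "digit p q r q' < 4" "digit p q r p' < 4"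
          "digit p q r q' = 1 \<longrightarrow> digit p q r p' \<noteq> 0"
        using d ne pq pq' by (auto simp: digit_def)
      show "m < foldr (branch_step ?F id) [p', q'] m" for m
      proof -
        have "?\<tau> (4 * m + digit p q r q') = 4 * m + digit p q r q'"
          using e(1,2) by (intro transpose_apply_other) presburger+
        moreover have "?\<tau> (4 * (4 * m + digit p q r q') + digit p q r p') = 4 * (4 * m + digit p q r q') + digit p q r p'"
          using e by (intro transpose_apply_other) presburger+
        ultimately show ?thesis
          using e by (simp add: branch_step_id[OF F] digit_rep_def)
      qed
    qed (use l in auto)
  qed
  then show "s = id"
    using s by (auto simp: fun_eq_iff permutes_def)
qed

end

section \<open>The groups K\<close>

lemma ex_distinct_letters:
  assumes "a \<in> {1..4}"
  obtains p q :: nat where "distinct [a, p, q]" "{a, p, q} \<subseteq> {1..4}"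
proof -
  have "a = 1 \<or> a = 2 \<or> a = 3 \<or> a = 4"
    using assms by auto
  then show ?thesis
    using that[of 2 3] that[of 1 3] that[of 1 2] by auto
qed

section \<open>Separating the groups for different pairs\<close>

context cuntz_algebra_four
begin

lemma intertwinesI:
  assumes "u permutes words 4 2" "v permutes words 4 2" "z \<in> unitaries A"
    and "L u = compose (carrier A) (conj_by z) (L v)"
  shows "intertwines z u v"
  using assms conj_endo_intertwines[OF assms(3) U_unitary[OF assms(1)] U_unitary[OF assms(2)]]
  by (simp add: intertwines_def)

lemma L_id: "L id = (\<lambda>x\<in>carrier A. x)"
  by (simp add: U_id endo_one)

text \<open>\<open>v\<close> sends \<open>[x, c]\<close> to \<open>[c, c]\<close> and so fixes the
  tail \<open>c c c ...\<close> under the letter \<open>x\<close>. The exchange on the side of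
  \<open>u\<close> prefixes \<open>y\<close>, a letter distinct from \<open>c\<close>, to words
  beginning with \<open>i\<close> or \<open>j\<close>, and \<open>x\<close> to the others.\<close>

lemma not_intertwines_overlapping:
  assumes "letters i j h k" "letters i' j' h' k'" and s: "s permutes letters.block i' j' h' k'"
    and xy: "x \<in> {i, j}" "x \<in> {i', j'}" "y \<in> {i, j}" "y \<notin> {i', j'}"
  shows "\<not> intertwines z (letters.K_perm i j h k id True False) (letters.K_perm i' j' h' k' s a b)"
proof
  interpret u: letters i j h k by fact
  interpret v: letters i' j' h' k' by fact
  let ?u = "u.K_perm id True False" and ?v = "v.K_perm s a b"
  assume twine: "intertwines z ?u ?v"
  define c where "c = v.swap_ij a x"
  have c: "c \<in> {i', j'}"
    unfolding c_def by (rule v.swap_ij_in[OF xy(2)])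
  have l: "c \<in> {1..4}" "x \<in> {1..4}" "y \<in> {1..4}"
    using c xy(1,3) v.letters_cases[of c] u.letters_cases[of x] u.letters_cases[of y] by blast+
  have ne: "y \<noteq> c" "x \<noteq> y"
    using c xy by auto
  have swap: "u.swap_ij True x = y"
    using xy(1,3) ne by auto
  obtain p q where pq: "distinct [c, p, q]" "{c, p, q} \<subseteq> {1..4}"
    using ex_distinct_letters[OF l(1)] .
  let ?F = "digit_rep id c p q"
  have F: "branching ?F"
    using pq by (intro branching_digit_rep) auto
  show False
  proof (rule intertwines_no_fixed[OF twine F, of "[x]" 0])
    have "?v [x, c] = [c, c]"
      using v.K_perm_snd[OF s l(2) c, of a b] by (simp only: c_def)
    then have "branch_step ?F ?v x (?F c 0) = ?F c (?F c 0)"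
      by (subst branch_step[OF F l(1)]) simp
    then show "foldr (branch_step ?F ?v) [x] 0 = 0"
      by (simp add: digit_rep_def)
    show "m < foldr (branch_step ?F ?u) [x] m" for m
    proof -
      obtain d n where dn: "d \<in> {1..4}" "m = ?F d n"
        by (rule branching_cases[OF F])
      show ?thesis
        using dn(1) unfolding u.letters_cases
      proof
        assume "d \<in> {i, j}"
        then have "branch_step ?F ?u x m = ?F y m"
          unfolding dn(2) by (subst branch_step[OF F dn(1)]) (simp add: u.K_perm_snd[OF permutes_id l(2)] swap)
        then show ?thesis
          using digit_pos[OF ne(1), of p q] by (simp add: digit_rep_def)
      next
        assume d: "d \<in> {h, k}"
        then have "branch_step ?F ?u x m = ?F x m"
          unfolding dn(2) by (subst branch_step[OF F dn(1)]) (simp add: u.K_perm_block[OF permutes_id xy(1) d])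
        \<comment> \<open>If \<open>x = c\<close>, prefixing gives \<open>4 * m\<close>, which
          exceeds \<open>m\<close> because the word of \<open>m\<close> begins with
          \<open>d\<close>, a letter other than \<open>c\<close>.\<close>
        moreover have "x \<noteq> c \<or> 1 \<le> m"
          using digit_pos[of d c p q] d xy(1) by (auto simp: dn(2) digit_rep_def)
        ultimately show ?thesis
          using digit_pos[of x c p q] by (auto simp: digit_rep_def)
      qed
    qed
  qed (use l in auto)
qed

text \<open>Disjoint pairs share no letter to test, so \<open>u\<close> is chosen in its block
  instead. The possible flip \<open>b\<close> of \<open>v\<close> is excluded by a tail of period
  one; without it, \<open>v\<close> cannot alter the letter \<open>i\<close> in the words that test
  \<open>u\<close>.\<close>

lemma not_intertwines_complementary:
  assumes "letters i j h k" "letters i' j' h' k'" and s: "s permutes letters.block i' j' h' k'"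
    and compl: "{i', j'} = {h, k}" "{h', k'} = {i, j}"
  shows "\<not> intertwines z (letters.K_perm i j h k (Transposition.transpose [i, h] [j, h]) False False)
      (letters.K_perm i' j' h' k' s a b)"
proof
  interpret u: letters i j h k by fact
  interpret v: letters i' j' h' k' by fact
  let ?t = "Transposition.transpose [i, h] [j, h]"
  have t: "?t permutes u.block"
    by (intro permutes_swap_id) (auto simp: u.block_def)
  let ?u = "u.K_perm ?t False False" and ?v = "v.K_perm s a b"
  assume twine: "intertwines z ?u ?v"
  have hk: "i \<in> {h', k'}" "j \<in> {h', k'}" "h \<in> {i', j'}"
    using compl by auto
  \<comment> \<open>With \<open>b\<close>, \<open>v\<close> turns \<open>[i, i]\<close> into
    \<open>[i, j]\<close>, hence fixes \<open>i j j j ...\<close> under the letter \<open>i\<close>.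
    \<open>u\<close> prefixes \<open>j\<close>, the letter of digit 0, only in front of
    \<open>h\<close>, where the index is positive.\<close>
  have "\<not> b"
  proof
    assume b
    let ?F = "digit_rep id j i h"
    have F: "branching ?F"
      using u.in_letters by (intro branching_digit_rep) auto
    have "i = h' \<and> j = k' \<or> i = k' \<and> j = h'"
      using hk(1,2) u.neq(1) by blast
    then have "v.swap_hk True i = j"
      by auto
    then have swap: "v.swap_hk b i = j"
      using \<open>b\<close> by simp
    show False
    proof (rule intertwines_no_fixed[OF twine F, of "[i]" "?F i 0"])
      have "branch_step ?F ?v i (?F i 0) = ?F i (?F j 0)"
        by (subst branch_step[OF F u.in_letters(1)]) (simp add: v.K_perm_fst[OF s hk(1) u.in_letters(1)] swap)
      then show "foldr (branch_step ?F ?v) [i] (?F i 0) = ?F i 0"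
        by (simp add: digit_rep_def)
      show "m < foldr (branch_step ?F ?u) [i] m" for m
      proof -
        obtain d n where dn: "d \<in> {1..4}" "m = ?F d n"
          by (rule branching_cases[OF F])
        consider "d \<in> {i, j}" | "d = h" | "d = k"
          using dn(1) unfolding u.letters_cases by blast
        then show ?thesis
        proof cases
          case 1
          have "branch_step ?F ?u i m = ?F i m"
            unfolding dn(2) by (subst branch_step[OF F dn(1)]) (simp add: u.K_perm_snd[OF t u.in_letters(1) 1])
          then show ?thesis by (simp add: digit_rep_def)
        next
          case 2
          have "branch_step ?F ?u i m = ?F j m"
            unfolding dn(2) by (subst branch_step[OF F dn(1)]) (simp add: 2 u.K_perm_block[OF t])
          then show ?thesis by (simp add: digit_rep_def dn(2) 2)
        next
          case 3
          have "branch_step ?F ?u i m = ?F i m"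
            unfolding dn(2) by (subst branch_step[OF F dn(1)]) (simp add: 3 u.K_perm_block[OF t])
          then show ?thesis by (simp add: digit_rep_def)
        qed
      qed
    qed (use u.in_letters in auto)
  qed
  \<comment> \<open>Makes 0, 1, 2 the indices of \<open>i j h i j h ...\<close> and its rotations
    starting with \<open>j\<close> and \<open>h\<close>: \<open>F h 0 = 2\<close>, while
    \<open>4 * 2 + 1 = 9\<close> is sent to 1 and \<open>4 * 1 = 4\<close> to 0.\<close>
  let ?\<tau> = "Transposition.transpose 0 4 \<circ> Transposition.transpose 1 (9 :: nat)"
  define F where "F = digit_rep ?\<tau> i j h"
  have F: "branching F"
    unfolding F_def using u.in_letters by (intro branching_digit_rep bij_comp) auto
  show False
  \<comment> \<open>The sides are exchanged: \<open>u\<close> fixes the tail because it turns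
    \<open>[i, h]\<close> into \<open>[j, h]\<close>, while \<open>v\<close> leaves
    \<open>i i\<close> in front of a letter from \<open>{h, k}\<close>.\<close>
  proof (rule intertwines_no_fixed[OF intertwines_sym[OF twine] F, of "[i, i, h]" 0])
    have F0: "F i (F j (F h 0)) = 0"
      by (simp add: F_def digit_rep_def Transposition.transpose_def)
    have "branch_step F ?u h (F i (F j (F h 0))) = F h (F i (F j (F h 0)))"
      by (subst branch_step[OF F u.in_letters(1)]) (simp add: u.K_perm_snd[OF t u.in_letters(3)])
    moreover have "branch_step F ?u i (F h 0) = F j (F h 0)"
      by (subst branch_step[OF F u.in_letters(3)]) (simp add: u.K_perm_block[OF t])
    moreover have "branch_step F ?u i (F j (F h 0)) = F i (F j (F h 0))"
      by (subst branch_step[OF F u.in_letters(2)]) (simp add: u.K_perm_snd[OF t u.in_letters(1)])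
    ultimately show "foldr (branch_step F ?u) [i, i, h] 0 = 0"
      unfolding F0 by simp
    show "m < foldr (branch_step F ?v) [i, i, h] m" for m
    proof -
      obtain d n where dn: "d \<in> {1..4}" "m = F d n"
        by (rule branching_cases[OF F])
      have "\<exists>c e. c \<in> {h, k} \<and> ?v [h, d] = [c, e]"
        using dn(1) unfolding v.letters_cases
      proof
        assume d: "d \<in> {i', j'}"
        have "v.swap_ij a h \<in> {h, k}"
          using v.swap_ij_in[OF hk(3)] compl by simp
        then show ?thesis
          using v.K_perm_snd[OF s u.in_letters(3) d] by blast
      next
        assume d: "d \<in> {h', k'}"
        then show ?thesis
          using v.K_perm_block[OF s hk(3) d] v.permutes_blockE[OF s hk(3) d] compl by metis
      qed
      then obtain c e where ce: "c \<in> {h, k}" "?v [h, d] = [c, e]"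
        by blast
      have c: "c \<in> {1..4}"
        using ce(1) unfolding u.letters_cases by blast
      have 1: "branch_step F ?v h m = F c (F e n)"
        unfolding dn(2) by (subst branch_step[OF F dn(1)]) (simp add: ce(2))
      \<comment> \<open>The second equation needs \<open>\<not> b\<close>.\<close>
      have "v.swap_hk b c = c" "v.swap_hk b i = i"
        using \<open>\<not> b\<close> by auto
      then have 2: "branch_step F ?v i (F c y) = F i (F c y)"
          "branch_step F ?v i (F i y) = F i (F i y)" for y
        using v.K_perm_fst[OF s hk(1) c] v.K_perm_fst[OF s hk(1) u.in_letters(1)]
        by (simp_all only: branch_step[OF F c] branch_step[OF F u.in_letters(1)]) simp_all
      have \<tau>: "?\<tau> y = y" if "y \<notin> {0, 1, 4, 9}" for y :: nat
        using that by (simp add: Transposition.transpose_def)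
      have Fc: "2 \<le> F c y \<and> 4 * y \<le> F c y" for y
      proof -
        have "2 \<le> digit i j h c" "digit i j h c < 4"
          using ce(1) by (auto simp: digit_def)
        then have "4 * y + digit i j h c \<noteq> 0" "4 * y + digit i j h c \<noteq> 1"
            "4 * y + digit i j h c \<noteq> 4" "4 * y + digit i j h c \<noteq> 9"
          by presburger+
        then have "4 * y + digit i j h c \<notin> {0, 1, 4, 9}"
          by blast
        then show ?thesis
          using \<open>2 \<le> digit i j h c\<close> \<tau> by (simp add: F_def digit_rep_def del: o_apply)
      qed
      have Fi: "F i y = 4 * y" if "2 \<le> y" for y
      proof -
        have "4 * y \<notin> {0, 1, 4, 9}"
          using that by simp presburger
        then show ?thesis
          using \<tau> by (simp add: F_def digit_rep_def del: o_apply)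
      qed
      \<comment> \<open>The image is at least 32 and at least \<open>64 * F e n\<close>. For
        \<open>n \<le> 2\<close> the former exceeds \<open>4 * n + 9\<close>, otherwise the latter
        does.\<close>
      have m: "m \<le> 4 * n + 9"
        using digit_less[of i j h d] by (simp add: dn(2) F_def digit_rep_def Transposition.transpose_def)
      have e: "n \<le> 2 \<or> n \<le> F e n"
        using digit_less[of i j h e] by (auto simp: F_def digit_rep_def Transposition.transpose_def)
      show ?thesis
      proof -
        have "foldr (branch_step F ?v) [i, i, h] m = F i (F i (F c (F e n)))"
          by (simp add: 1 2)
        also have "\<dots> = 16 * F c (F e n)"
          using Fc[of "F e n"] by (simp add: Fi)
        finally show ?thesis
          using Fc[of "F e n"] m e by linarith
      qed
    qed
  qed (use u.in_letters in auto)
qed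

end

section \<open>The isomorphism type of the groups and their images in the outer automorphism
  group\<close>

context cuntz_letters
begin

lemma L_compose:
  assumes "s permutes block" "t permutes block"
  shows "compose (carrier A) (L (K_perm s a b)) (L (K_perm t c d)) = L (K_perm (s \<circ> t) (a \<noteq> c) (b \<noteq> d))"
  using endo_compose[OF K_perm_permutes[OF assms(1)] K_perm_permutes[OF assms(2)]
      K_perm_commute[OF assms(1) assms(2)]]
  by (simp add: K_perm_compose[OF assms])

lemma L_aut:
  assumes s: "s permutes block"
  shows "L (K_perm s a b) \<in> carrier (aut_group A)"
proof (rule bij_if_inverse)
  note inv = permutes_inv[OF s]
  show "L (K_perm s a b) \<in> star_homs A A" "L (K_perm (inv_into UNIV s) a b) \<in> star_homs A A"
    by (intro endo_star_homs U_unitary K_perm_permutes s inv)+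
  show "compose (carrier A) (L (K_perm s a b)) (L (K_perm (inv_into UNIV s) a b)) = (\<lambda>x\<in>carrier A. x)"
    by (simp add: L_compose s inv permutes_inv_o[OF s] K_perm_id L_id)
  show "compose (carrier A) (L (K_perm (inv_into UNIV s) a b)) (L (K_perm s a b)) = (\<lambda>x\<in>carrier A. x)"
    by (simp add: L_compose s inv permutes_inv_o[OF s] K_perm_id L_id)
qed

abbreviation model :: "((nat \<Rightarrow> nat) \<times> int \<times> int) monoid" where
  "model \<equiv> sym_group 4 \<times>\<times> (integer_mod_group 2 \<times>\<times> integer_mod_group 2)"

definition model_aut :: "(nat \<Rightarrow> nat) \<times> int \<times> int \<Rightarrow> 'a \<Rightarrow> 'a" where
  "model_aut = (\<lambda>(s, a, b). L (K_perm (block_perm s) (a = 1) (b = 1)))"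

lemma group_model: "group model"
  by (intro DirProd_group sym_group_is_group group_integer_mod_group)

lemma in_model: "(s, a, b) \<in> carrier model \<longleftrightarrow> s permutes {1..4} \<and> a \<in> {0, 1} \<and> b \<in> {0, 1}"
proof -
  have "carrier (integer_mod_group 2) = {0, 1}"
    unfolding carrier_integer_mod_group by auto
  then show ?thesis
    by (simp only: carrier_DirProd mem_Times_iff fst_conv snd_conv sym_group_carrier)
qed

lemma model_aut_hom: "model_aut \<in> hom model (aut_group A)"
proof (rule homI)
  fix g assume "g \<in> carrier model"
  then show "model_aut g \<in> carrier (aut_group A)"
    by (cases g) (auto simp: model_aut_def in_model simp del: carrier_DirProd intro!: L_aut block_perm_permutes)
next
  fix g g' assume "g \<in> carrier model" "g' \<in> carrier model"
  then obtain s a b s' a' b' where g: "g = (s, a, b)" "g' = (s', a', b')"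
    and s: "s permutes {1..4}" "s' permutes {1..4}"
    and ab: "a \<in> {0, 1}" "b \<in> {0, 1}" "a' \<in> {0, 1}" "b' \<in> {0, 1}"
    using in_model by (cases g, cases g') auto
  have "g \<otimes>\<^bsub>model\<^esub> g' = (s \<circ> s', (a + a') mod 2, (b + b') mod 2)"
    by (simp add: g sym_group_mult)
  moreover have "((a + a') mod 2 = 1) = ((a = 1) \<noteq> (a' = 1))" "((b + b') mod 2 = 1) = ((b = 1) \<noteq> (b' = 1))"
    using ab by auto
  moreover have "L (K_perm (block_perm s) p q) \<in> Bij (carrier A)"
    "L (K_perm (block_perm s') p q) \<in> Bij (carrier A)" for p q
    using L_aut block_perm_permutes s by (auto simp: carrier_aut)
  ultimately show "model_aut (g \<otimes>\<^bsub>model\<^esub> g') = model_aut g \<otimes>\<^bsub>aut_group A\<^esub> model_aut g'"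
    using s by (simp add: model_aut_def g mult_aut L_compose block_perm_permutes block_perm_compose)
qed

text \<open>Gives at once the injectivity of \<open>model_aut\<close>, as the identity is inner, and
  the triviality of the kernel of \<open>out_proj\<close>.\<close>

lemma inner_model_aut:
  assumes g: "g \<in> carrier model" and inner: "model_aut g \<in> inner_auts A"
  shows "g = \<one>\<^bsub>model\<^esub>"
proof -
  obtain s a b where sab: "g = (s, a, b)" "s permutes {1..4}" "a \<in> {0, 1}" "b \<in> {0, 1}"
    using g in_model by (cases g) auto
  note s = block_perm_permutes[OF sab(2)]
  obtain z where z: "z \<in> unitaries A" "model_aut g = conj_by z"
    using inner by (auto simp: inner_auts_eq)
  have "compose (carrier A) (conj_by z) (L id) = conj_by z"
    by (auto simp: L_id compose_def conj_by_def restrict_def fun_eq_iff)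
  then have "intertwines z (K_perm (block_perm s) (a = 1) (b = 1)) id"
    using z by (intro intertwinesI K_perm_permutes s permutes_id) (simp_all add: model_aut_def sab(1))
  note id = intertwines_id[OF s this]
  show ?thesis
    using id(2,3) sab(3,4) block_perm_inject[OF sab(2) id(1)] by (auto simp: sab(1) sym_group_one)
qed

lemma group_hom_model: "group_hom model (aut_group A) model_aut"
  by (intro group_hom.intro group_hom_axioms.intro group_model group_aut model_aut_hom)

lemma L_in_model_aut:
  assumes "s permutes block"
  shows "L (K_perm s a b) \<in> model_aut ` carrier model"
proof -
  obtain t where t: "t permutes {1..4}" "block_perm t = s"
    by (rule block_perm_surj[OF assms])
  have "L (K_perm s a b) = model_aut (t, of_bool a, of_bool b)"
    by (simp add: model_aut_def t(2))
  moreover have "(t, of_bool a, of_bool b) \<in> carrier model"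
    using t(1) by (simp add: in_model del: carrier_DirProd)
  ultimately show ?thesis by blast
qed

text \<open>The image of a homomorphism is a subgroup and contains the generators. Conversely, the
  generators yield every block permutation by \<open>transposition_induct\<close>, and multiplying
  by the two flips yields the rest.\<close>

lemma K_group_eq: "K_group A S i j h k = model_aut ` carrier model"
proof
  interpret G: group "aut_group A" by (rule group_aut)
  let ?t = Transposition.transpose
  have sw: "?t [i, h] [i, k] permutes block" "?t [j, h] [j, k] permutes block" "?t [i, h] [j, h] permutes block"
    by (intro permutes_swap_id; simp add: block_def)+
  show "K_group A S i j h k \<subseteq> model_aut ` carrier model"
    unfolding K_group_def
  proof (rule G.generate_subgroup_incl)
    show "subgroup (model_aut ` carrier model) (aut_group A)"
      by (rule group_hom.img_is_subgroup[OF group_hom_model])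
    show "(\<lambda>u. L u) ` K_perms i j h k \<subseteq> model_aut ` carrier model"
      using sw permutes_id unfolding K_perms_eq by (auto intro: L_in_model_aut simp del: carrier_DirProd)
  qed
  have gen: "L u \<in> K_group A S i j h k" if "u \<in> K_perms i j h k" for u
    unfolding K_group_def using that by (intro generate.incl) blast
  have mult: "L (K_perm (s \<circ> t) (a \<noteq> c) (b \<noteq> d)) \<in> K_group A S i j h k"
    if "s permutes block" "t permutes block" "L (K_perm s a b) \<in> K_group A S i j h k"
      "L (K_perm t c d) \<in> K_group A S i j h k" for s t a b c d
  proof -
    have "L (K_perm s a b) \<otimes>\<^bsub>aut_group A\<^esub> L (K_perm t c d) \<in> K_group A S i j h k"
      using that(3,4) unfolding K_group_def by (rule generate.eng)
    then show ?thesis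
      using L_aut[OF that(1)] L_aut[OF that(2)] that(1,2) by (simp add: mult_aut carrier_aut L_compose)
  qed
  have one: "L (K_perm id False False) \<in> K_group A S i j h k"
    using generate.one[of "aut_group A"] by (simp add: K_perm_id L_id K_group_def one_aut)
  have all: "L (K_perm s False False) \<in> K_group A S i j h k" if "s permutes block" for s
    using that
  proof (rule transposition_induct)
    fix s t assume "s permutes block" "t permutes block"
      "L (K_perm s False False) \<in> K_group A S i j h k" "L (K_perm t False False) \<in> K_group A S i j h k"
    then show "L (K_perm (s \<circ> t) False False) \<in> K_group A S i j h k"
      using mult[of s t False False False False] by simp
  qed (rule one, (rule gen, simp add: K_perms_eq)+)
  have flip1: "L (K_perm id a False) \<in> K_group A S i j h k" for a
    using one gen[of "K_perm id True False"] by (cases a) (simp_all add: K_perms_eq)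
  have flip2: "L (K_perm id False b) \<in> K_group A S i j h k" for b
    using one gen[of "K_perm id False True"] by (cases b) (simp_all add: K_perms_eq)
  have "L (K_perm s a b) \<in> K_group A S i j h k" if "s permutes block" for s a b
  proof -
    have "L (K_perm id a b) \<in> K_group A S i j h k"
      using mult[OF permutes_id permutes_id flip1[of a] flip2[of b]] by simp
    then show ?thesis
      using mult[OF that permutes_id all[OF that]] by simp
  qed
  then show "model_aut ` carrier model \<subseteq> K_group A S i j h k"
    by (auto simp: model_aut_def sym_group_carrier block_perm_permutes)
qed

lemma K_groupE:
  assumes "f \<in> K_group A S i j h k"
  obtains s a b where "f = L (K_perm s a b)" "s permutes block"
  using assms block_perm_permutes by (auto simp: K_group_eq model_aut_def sym_group_carrier)

lemma subgroup_K_group: "subgroup (K_group A S i j h k) (aut_group A)"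
  unfolding K_group_eq by (rule group_hom.img_is_subgroup[OF group_hom_model])

lemma K_group_perm_auts: "K_group A S i j h k \<subseteq> perm_auts 4 2 A S"
  by (auto elim!: K_groupE simp: perm_auts_def perm_unitaries_def L_aut K_perm_permutes)

lemma K_group_iso: "(aut_group A)\<lparr>carrier := K_group A S i j h k\<rparr> \<cong> model"
proof (rule group.iso_sym[OF group_model])
  have "inj_on model_aut (carrier model)"
    unfolding group_hom.inj_on_one_iff[OF group_hom_model]
    using inner_model_aut subgroup.one_closed[OF subgroup_inner] by simp
  then have "model_aut \<in> iso model ((aut_group A)\<lparr>carrier := K_group A S i j h k\<rparr>)"
    using model_aut_hom by (auto simp: iso_def hom_def bij_betw_def K_group_eq)
  then show "model \<cong> (aut_group A)\<lparr>carrier := K_group A S i j h k\<rparr>"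
    by (auto simp: is_iso_def)
qed

lemma out_proj_hom_K_group:
  "out_proj A \<in> hom ((aut_group A)\<lparr>carrier := K_group A S i j h k\<rparr>) (out_group A)"
  by (rule homI)
    (use subgroup.subset[OF subgroup_K_group] in
      \<open>auto intro!: hom_in_carrier[OF out_proj_hom] hom_mult[OF out_proj_hom]\<close>)

lemma kernel_out_proj_K_group:
  "kernel ((aut_group A)\<lparr>carrier := K_group A S i j h k\<rparr>) (out_group A) (out_proj A) = {\<one>\<^bsub>aut_group A\<^esub>}"
proof (intro subset_antisym subsetI)
  interpret G: group "aut_group A" by (rule group_aut)
  fix f assume "f \<in> kernel ((aut_group A)\<lparr>carrier := K_group A S i j h k\<rparr>) (out_group A) (out_proj A)"
  then have f: "f \<in> K_group A S i j h k" "out_proj A f = inner_auts A"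
    by (auto simp: kernel_def one_out)
  then have "f \<in> inner_auts A"
    using G.rcos_self[OF _ subgroup_inner, of f] subgroup.subset[OF subgroup_K_group]
    by (auto simp: out_proj_def)
  moreover obtain g where g: "g \<in> carrier model" "f = model_aut g"
    using f(1) by (auto simp: K_group_eq simp del: carrier_DirProd)
  ultimately have "f = model_aut \<one>\<^bsub>model\<^esub>"
    using inner_model_aut[of g] by simp
  then show "f \<in> {\<one>\<^bsub>aut_group A\<^esub>}"
    using group_hom.hom_one[OF group_hom_model] by simp
next
  interpret G: group "aut_group A" by (rule group_aut)
  fix f assume "f \<in> {\<one>\<^bsub>aut_group A\<^esub>}"
  moreover have "\<one>\<^bsub>aut_group A\<^esub> \<in> K_group A S i j h k"
    by (rule subgroup.one_closed[OF subgroup_K_group])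
  moreover have "out_proj A \<one>\<^bsub>aut_group A\<^esub> = inner_auts A"
    unfolding out_proj_def using subgroup.subset[OF subgroup_inner] by (rule G.coset_mult_one)
  ultimately show "f \<in> kernel ((aut_group A)\<lparr>carrier := K_group A S i j h k\<rparr>) (out_group A) (out_proj A)"
    by (simp add: kernel_def one_out)
qed

end

text \<open>Equal images would give each element of one group a partner in the other, up to an
  intertwining unitary. \<open>x\<^sub>0\<close> has no partner if the two pairs meet, and
  \<open>w\<^sub>0'\<close> has none if they are disjoint.\<close>

lemma (in cuntz_algebra_four) out_proj_K_group_neq:
  assumes "letters i j h k" "letters i' j' h' k'" and ne: "{i, j} \<noteq> {i', j'}"
  shows "out_proj A ` K_group A S i j h k \<noteq> out_proj A ` K_group A S i' j' h' k'"
proof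
  interpret u: letters i j h k by fact
  interpret v: letters i' j' h' k' by fact
  interpret u: cuntz_letters A S i j h k ..
  interpret v: cuntz_letters A S i' j' h' k' ..
  assume eq: "out_proj A ` K_group A S i j h k = out_proj A ` K_group A S i' j' h' k'"
  have *: "\<exists>z s a b. s permutes v.block \<and> intertwines z (u.K_perm t c d) (v.K_perm s a b)"
    if t: "t permutes u.block" for t c d
  proof -
    have "L (u.K_perm t c d) \<in> K_group A S i j h k"
      unfolding u.K_group_eq by (rule u.L_in_model_aut[OF t])
    then have "out_proj A (L (u.K_perm t c d)) \<in> out_proj A ` K_group A S i' j' h' k'"
      unfolding eq[symmetric] by (rule imageI)
    then obtain f where f: "out_proj A (L (u.K_perm t c d)) = out_proj A f" "f \<in> K_group A S i' j' h' k'"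
      by (rule imageE)
    obtain s a b where s: "f = L (v.K_perm s a b)" "s permutes v.block"
      using f(2) by (rule v.K_groupE)
    obtain z where "z \<in> unitaries A" "L (u.K_perm t c d) = compose (carrier A) (conj_by z) f"
      by (rule out_proj_eqD[OF u.L_aut[OF t] _ f(1)]) (simp_all add: s v.L_aut)
    then have "intertwines z (u.K_perm t c d) (v.K_perm s a b)"
      using s t by (intro intertwinesI u.K_perm_permutes v.K_perm_permutes) auto
    then show ?thesis
      using s(2) by blast
  qed
  show False
  proof (cases "{i, j} \<inter> {i', j'} = {}")
    case True
    have "{h, k} = {1..4} - {i, j}"
      unfolding u.letters[symmetric] by auto
    moreover have "{h', k'} = {1..4} - {i', j'}"
      unfolding v.letters[symmetric] by auto
    moreover have "{i', j'} \<subseteq> {1..4}" "{i, j} \<subseteq> {1..4}"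
      using u.in_letters v.in_letters by auto
    ultimately have "{i', j'} \<subseteq> {h, k}" "{i, j} \<subseteq> {h', k'}"
      using True by blast+
    then have "{i', j'} = {h, k}" "{h', k'} = {i, j}"
      using u.neq(1) v.neq(1) by blast+
    moreover have "Transposition.transpose [i, h] [j, h] permutes u.block"
      by (intro permutes_swap_id) (simp_all add: u.block_def)
    ultimately show False
      using * not_intertwines_complementary[OF assms(1,2)] by blast
  next
    case False
    then obtain x where "x \<in> {i, j}" "x \<in> {i', j'}"
      by blast
    moreover have "\<not> {i, j} \<subseteq> {i', j'}"
      using ne u.neq(1) v.neq(1) by blast
    then obtain y where "y \<in> {i, j}" "y \<notin> {i', j'}"
      by blast
    ultimately show False
      using *[OF permutes_id] not_intertwines_overlapping[OF assms(1,2)] by blast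
  qed
qed

theorem theorem5p2:
  fixes A :: "'a cstar" and S :: "nat \<Rightarrow> 'a"
  assumes "cuntz_algebra 4 A S"
  shows
    "(\<forall>i j h k. i \<in> {1..4} \<and> j \<in> {1..4} \<and> i \<noteq> j \<and> h \<noteq> k \<and> {h, k} = {1..4} - {i, j} \<longrightarrow>
        subgroup (K_group A S i j h k) (aut_group A) \<and>
        K_group A S i j h k \<subseteq> perm_auts 4 2 A S \<and>
        (aut_group A)\<lparr>carrier := K_group A S i j h k\<rparr> \<cong>
          sym_group 4 \<times>\<times> (integer_mod_group 2 \<times>\<times> integer_mod_group 2) \<and>
        out_proj A \<in> hom ((aut_group A)\<lparr>carrier := K_group A S i j h k\<rparr>) (out_group A) \<and>
        kernel ((aut_group A)\<lparr>carrier := K_group A S i j h k\<rparr>) (out_group A) (out_proj A) =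
          {\<one>\<^bsub>aut_group A\<^esub>}) \<and>
     (\<forall>i j h k i' j' h' k'.
        i \<in> {1..4} \<and> j \<in> {1..4} \<and> i < j \<and> h \<noteq> k \<and> {h, k} = {1..4} - {i, j} \<and>
        i' \<in> {1..4} \<and> j' \<in> {1..4} \<and> i' < j' \<and> h' \<noteq> k' \<and> {h', k'} = {1..4} - {i', j'} \<and>
        (i, j) \<noteq> (i', j') \<longrightarrow>
        out_proj A ` K_group A S i j h k \<noteq> out_proj A ` K_group A S i' j' h' k')"
proof -
  have "cstar_algebra A" "cuntz_family 4 A S"
    using assms by (auto simp: cuntz_algebra_def)
  then interpret cuntz_algebra_four A S
    by (intro cuntz_algebra_four.intro cuntz_four.intro plain_cstar_algebra.intro
        cuntz_four_axioms.intro cuntz_algebra_four_axioms.intro assms)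
  have letters: "letters i j h k"
    if "i \<in> {1..4}" "j \<in> {1..4}" "i \<noteq> j" "h \<noteq> k" "{h, k} = {1..4} - {i, j}" for i j h k
  proof
    show "{i, j, h, k} = {1..4}"
      using that by blast
    have "h \<notin> {i, j}" "k \<notin> {i, j}"
      using that(5) by blast+
    then show "distinct [i, j, h, k]"
      using that(3,4) by auto
  qed
  show ?thesis
  proof (intro conjI allI impI; elim conjE)
    fix i j h k :: nat
    assume "i \<in> {1..4}" "j \<in> {1..4}" "i \<noteq> j" "h \<noteq> k" "{h, k} = {1..4} - {i, j}"
    then interpret letters i j h k by (rule letters)
    interpret cuntz_letters A S i j h k ..
    show "subgroup (K_group A S i j h k) (aut_group A)"
      "K_group A S i j h k \<subseteq> perm_auts 4 2 A S"
      "(aut_group A)\<lparr>carrier := K_group A S i j h k\<rparr> \<cong>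
        sym_group 4 \<times>\<times> (integer_mod_group 2 \<times>\<times> integer_mod_group 2)"
      "out_proj A \<in> hom ((aut_group A)\<lparr>carrier := K_group A S i j h k\<rparr>) (out_group A)"
      "kernel ((aut_group A)\<lparr>carrier := K_group A S i j h k\<rparr>) (out_group A) (out_proj A) =
        {\<one>\<^bsub>aut_group A\<^esub>}"
      by (rule subgroup_K_group K_group_perm_auts K_group_iso out_proj_hom_K_group kernel_out_proj_K_group)+
  next
    fix i j h k i' j' h' k' :: nat
    assume "i \<in> {1..4}" "j \<in> {1..4}" "i < j" "h \<noteq> k" "{h, k} = {1..4} - {i, j}"
      "i' \<in> {1..4}" "j' \<in> {1..4}" "i' < j'" "h' \<noteq> k'" "{h', k'} = {1..4} - {i', j'}"
      and "(i, j) \<noteq> (i', j')"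
    then show "out_proj A ` K_group A S i j h k \<noteq> out_proj A ` K_group A S i' j' h' k'"
      by (intro out_proj_K_group_neq letters) (auto simp: doubleton_eq_iff)
  qed
qed

end
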